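(* Let $s\in(0,1)$, $\Lambda\ge0$, and let $E$ be a $\Lambda$-minimal set for $\operatorname{Per}_s$ in an open bounded Lipschitz domain $\Omega\subseteq\mathbb{R}^n$ such that $0\in\partial E\cap\Omega$. Then the function $$\Phi_E(r)=r^{s-n}\int_{B_r^+}z^{1-s}|\nabla\widetilde u|^2\,dx\,dz+\frac{n-s}{s}\,\omega_n\,\hat\Lambda\,r^s$$ is increasing (non-strictly) for $r$ small enough, i.e. there is $r_0>0$ such that $\Phi_E(r_1)\le\Phi_E(r_2)$ whenever $0<r_1<r_2<r_0$.
   Context: All sets are Lebesgue measurable; $|\cdot|$ is Lebesgue measure; $\omega_n=|B_1|$ in $\mathbb{R}^n$. For disjoint $A,B\subseteq\mathbb{R}^n$, $\mathcal{L}(A,B):=\int_A\int_B\frac{dx\,dy}{|x-y|^{n+s}}$; $\operatorname{Per}_s(E,\Omega):=\mathcal{L}(E\cap\Omega,E^c)+\mathcal{L}(E\cap\Omega^c,E^c\cap\Omega)$. $E$ is $\Lambda$-minimal in $\Omega$ (open, bounded, Lipschitz) if $\operatorname{Per}_s(E,\Omega)<+\infty$ and $\operatorname{Per}_s(E,\Omega)\le\operatorname{Per}_s(F,\Omega)+\Lambda|E\Delta F|$ for every $F$ with $E\Delta F\subseteq\Omega$. Convention: $\partial E=\{x:\ 0<|E\cap B_r(x)|<\omega_nr^n\ \forall r>0\}$ after modification on a null set. $B_r^+=\{(x,z)\in\mathbb{R}^n\times(0,\infty):|x|^2+z^2<r^2\}$. The extension of $u=\chi_E-\chi_{E^c}$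 is $\widetilde u(x,z)=\int_{\mathbb{R}^n}P(x-y,z)u(y)\,dy$ for $z>0$, where $P(x,z)=C_P\frac{z^s}{(|x|^2+z^2)^{(n+s)/2}}$ and $C_P=\big(\int_{\mathbb{R}^n}\frac{dx}{(1+|x|^2)^{(n+s)/2}}\big)^{-1}$. $\hat\Lambda:=8\,\widetilde c_{n,s}\Lambda$, where $\widetilde c_{n,s}>0$ is the constant (known to exist, depending only on $n,s$) for which, whenever $u,v:\mathbb{R}^n\to\mathbb{R}$ have $\mathrm{J}_1(u),\mathrm{J}_1(v)<\infty$ and $u-v$ is compactly supported in $B_1$, $$\widetilde c_{n,s}(\mathrm{J}_1(v)-\mathrm{J}_1(u))=\inf_{U,\overline v}\int_{U\cap\{z>0\}}z^{1-s}(|\nabla\overline v|^2-|\nabla\widetilde u|^2)\,dx\,dz,$$ the infimum being over bounded Lipschitz domains $U\subseteq\mathbb{R}^{n+1}$ with $U\cap\{z=0\}\subseteq B_1$ and functions $\overline v$ on $\{z\ge0\}$ with $\operatorname{supp}(\overline v-\widetilde u)\Subset U$ and trace $v$ on $\{z=0\}$; here $\mathrm{J}_1(u)=\int_{B_1}\int_{B_1}\frac{|u(x)-u(y)|^2}{|x-y|^{n+s}}dx\,dy+2\int_{B_1^c}\int_{B_1}\frac{|u(x)-u(y)|^2}{|x-y|^{n+s}}dx\,dy$. *)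

theory Defs
  imports "HOL-Analysis.Analysis"
begin

text \<open>
  The ambient space $\mathbb{R}^n$ is a Euclidean space \<open>'a\<close> with \<open>n = DIM('a)\<close>; the extension variables
  \<open>(x, z)\<close> live in \<open>'a \<times> real\<close>, whose norm is \<open>sqrt (norm x ^ 2 + z ^ 2)\<close>. Nonnegative integrals
  that may diverge are taken in \<open>ennreal\<close>.
\<close>

section \<open>The fractional perimeter and minimality\<close>

definition interaction :: "real \<Rightarrow> 'a::euclidean_space set \<Rightarrow> 'a set \<Rightarrow> ennreal" where
  "interaction s A B =
     (\<integral>\<^sup>+x\<in>A. (\<integral>\<^sup>+y\<in>B. ennreal (1 / norm (x - y) powr (real DIM('a) + s)) \<partial>lebesgue) \<partial>lebesgue)"

definition frac_perimeter :: "real \<Rightarrow> 'a::euclidean_space set \<Rightarrow> 'a set \<Rightarrow> ennreal" where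
  "frac_perimeter s E \<Omega> = interaction s (E \<inter> \<Omega>) (- E) + interaction s (E \<inter> - \<Omega>) (- E \<inter> \<Omega>)"

text \<open>
  Near each boundary point the set is the strict epigraph of a Lipschitz function \<open>g\<close> over the
  hyperplane orthogonal to some unit vector \<open>\<nu>\<close>. Connectedness is not required.
\<close>

definition bounded_lipschitz_domain :: "'a::euclidean_space set \<Rightarrow> bool" where
  "bounded_lipschitz_domain \<Omega> \<longleftrightarrow> open \<Omega> \<and> bounded \<Omega> \<and>
     (\<forall>p\<in>frontier \<Omega>. \<exists>\<nu> g L \<delta>. norm \<nu> = 1 \<and> 0 < \<delta> \<and> L-lipschitz_on {y. y \<bullet> \<nu> = 0} g \<and>
        \<Omega> \<inter> ball p \<delta> = {x \<in> ball p \<delta>. (g (x - (x \<bullet> \<nu>) *\<^sub>R \<nu>) :: real) < x \<bullet> \<nu>})"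

definition Lambda_minimal :: "real \<Rightarrow> real \<Rightarrow> 'a::euclidean_space set \<Rightarrow> 'a set \<Rightarrow> bool" where
  "Lambda_minimal s \<Lambda> E \<Omega> \<longleftrightarrow> E \<in> sets lebesgue \<and> frac_perimeter s E \<Omega> < \<infinity> \<and>
     (\<forall>F\<in>sets lebesgue. sym_diff E F \<subseteq> \<Omega> \<longrightarrow>
        frac_perimeter s E \<Omega> \<le> frac_perimeter s F \<Omega> + ennreal \<Lambda> * emeasure lebesgue (sym_diff E F))"

text \<open>The boundary \<open>\<partial>E\<close>, in the convention that does not see null sets.\<close>

definition measure_boundary :: "'a::euclidean_space set \<Rightarrow> 'a set" where
  "measure_boundary E = {x. \<forall>r>0. 0 < measure lebesgue (E \<inter> ball x r) \<and>
     measure lebesgue (E \<inter> ball x r) < measure lebesgue (ball (0::'a) 1) * r ^ DIM('a)}"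

section \<open>The extension to the upper half space\<close>

definition upper_half_space :: "('a::euclidean_space \<times> real) set" where
  "upper_half_space = {X. 0 < snd X}"

definition poisson_const :: "'a::euclidean_space itself \<Rightarrow> real \<Rightarrow> real" where
  "poisson_const _ s =
     inverse (LINT x|lebesgue. 1 / (1 + norm (x::'a) ^ 2) powr ((real DIM('a) + s) / 2))"

definition poisson_kernel :: "real \<Rightarrow> 'a::euclidean_space \<Rightarrow> real \<Rightarrow> real" where
  "poisson_kernel s x z =
     poisson_const TYPE('a) s * (z powr s / (norm x ^ 2 + z ^ 2) powr ((real DIM('a) + s) / 2))"

definition extension :: "real \<Rightarrow> ('a::euclidean_space \<Rightarrow> real) \<Rightarrow> 'a \<times> real \<Rightarrow> real" where
  "extension s u X = (LINT y|lebesgue. poisson_kernel s (fst X - y) (snd X) * u y)"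

definition gradient :: "('b::real_inner \<Rightarrow> real) \<Rightarrow> 'b \<Rightarrow> 'b" where
  "gradient f X = (THE D. GDERIV f X :> D)"

section \<open>The constant relating the nonlocal energy to the extension energy\<close>

definition J1 :: "real \<Rightarrow> ('a::euclidean_space \<Rightarrow> real) \<Rightarrow> ennreal" where
  "J1 s u =
     (\<integral>\<^sup>+x\<in>ball 0 1. (\<integral>\<^sup>+y\<in>ball 0 1.
        ennreal (\<bar>u x - u y\<bar> ^ 2 / norm (x - y) powr (real DIM('a) + s)) \<partial>lebesgue) \<partial>lebesgue) +
     2 * (\<integral>\<^sup>+x\<in>- ball 0 1. (\<integral>\<^sup>+y\<in>ball 0 1.
        ennreal (\<bar>u x - u y\<bar> ^ 2 / norm (x - y) powr (real DIM('a) + s)) \<partial>lebesgue) \<partial>lebesgue)"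

definition weak_gradient_on ::
  "'b::euclidean_space set \<Rightarrow> ('b \<Rightarrow> real) \<Rightarrow> ('b \<Rightarrow> 'b) \<Rightarrow> bool" where
  "weak_gradient_on W f G \<longleftrightarrow>
     (\<forall>K. compact K \<and> K \<subseteq> W \<longrightarrow> set_integrable lebesgue K f \<and> set_integrable lebesgue K G) \<and>
     (\<forall>\<phi> D. (\<forall>X. GDERIV \<phi> X :> D X) \<and> continuous_on UNIV D \<and>
        compact (closure {X. \<phi> X \<noteq> 0}) \<and> closure {X. \<phi> X \<noteq> 0} \<subseteq> W \<longrightarrow>
        (LINT X:W|lebesgue. f X *\<^sub>R D X) = - (LINT X:W|lebesgue. \<phi> X *\<^sub>R G X))"

text \<open>
  The trace on \<open>{z = 0}\<close> is taken as the local \<open>L\<^sup>1\<close> limit of averages over thin layers, so it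
  depends only on the almost everywhere class of \<open>w\<close>.
\<close>

definition has_trace :: "('a::euclidean_space \<times> real \<Rightarrow> real) \<Rightarrow> ('a \<Rightarrow> real) \<Rightarrow> bool" where
  "has_trace w v \<longleftrightarrow>
     (\<forall>R>0. ((\<lambda>\<epsilon>. ennreal (1 / \<epsilon>) *
        (\<integral>\<^sup>+X\<in>ball 0 R \<times> {0<..<\<epsilon>}. ennreal \<bar>w X - v (fst X)\<bar> \<partial>lebesgue)) \<longlongrightarrow> 0) (at_right 0))"

text \<open>
  Competitors \<open>(U, w, G)\<close> with \<open>G\<close> the weak gradient of \<open>w\<close>. The closure below is
  taken in \<open>'a \<times> real\<close>, so the support may reach \<open>{z = 0}\<close>, but only inside \<open>U\<close>.
  The last condition excludes the competitors of energy \<open>+\<infinity>\<close>, which do not affect the infimum.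
\<close>

definition ext_energy_density ::
  "real \<Rightarrow> ('a::euclidean_space \<Rightarrow> real) \<Rightarrow> ('a \<times> real \<Rightarrow> 'a \<times> real) \<Rightarrow> 'a \<times> real \<Rightarrow> real" where
  "ext_energy_density s u G X =
     snd X powr (1 - s) * (norm (G X) ^ 2 - norm (gradient (extension s u) X) ^ 2)"

definition competitors ::
  "real \<Rightarrow> ('a::euclidean_space \<Rightarrow> real) \<Rightarrow> ('a \<Rightarrow> real) \<Rightarrow>
     (('a \<times> real) set \<times> ('a \<times> real \<Rightarrow> real) \<times> ('a \<times> real \<Rightarrow> 'a \<times> real)) set" where
  "competitors s u v = {(U, w, G).
     bounded_lipschitz_domain U \<and> {x. (x, 0) \<in> U} \<subseteq> ball 0 1 \<and>
     weak_gradient_on upper_half_space w G \<and> has_trace w v \<and>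
     compact (closure {X \<in> upper_half_space. w X \<noteq> extension s u X}) \<and>
     closure {X \<in> upper_half_space. w X \<noteq> extension s u X} \<subseteq> U \<and>
     set_integrable lebesgue (U \<inter> upper_half_space) (ext_energy_density s u G)}"

text \<open>
  \<open>is_extension_const TYPE('a) s c\<close>: \<open>c\<close> is the constant $\widetilde c_{n,s}$. It is characterised
  by this property; taking \<open>u = 0\<close> and \<open>v\<close> a bump function shows that it is unique.
\<close>

definition is_extension_const :: "'a::euclidean_space itself \<Rightarrow> real \<Rightarrow> real \<Rightarrow> bool" where
  "is_extension_const _ s c \<longleftrightarrow> 0 < c \<and>
     (\<forall>u v :: 'a \<Rightarrow> real.
        u \<in> borel_measurable lebesgue \<and> v \<in> borel_measurable lebesgue \<and>
        J1 s u < \<infinity> \<and> J1 s v < \<infinity> \<and> closure {x. u x - v x \<noteq> 0} \<subseteq> ball 0 1 \<longrightarrow>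
        ereal (c * (enn2real (J1 s v) - enn2real (J1 s u))) =
          (INF (U, w, G)\<in>competitors s u v.
             ereal (LINT X:U \<inter> upper_half_space|lebesgue. ext_energy_density s u G X)))"

section \<open>The monotone quantity\<close>

definition phase :: "'a set \<Rightarrow> 'a \<Rightarrow> real" where
  "phase E x = indicator E x - indicator (- E) x"

definition half_ball :: "real \<Rightarrow> ('a::euclidean_space \<times> real) set" where
  "half_ball r = {X. 0 < snd X \<and> norm (fst X) ^ 2 + snd X ^ 2 < r ^ 2}"

text \<open>Here \<open>\<Lambda>h\<close> stands for $\hat\Lambda$.\<close>

definition Phi :: "real \<Rightarrow> real \<Rightarrow> 'a::euclidean_space set \<Rightarrow> real \<Rightarrow> ennreal" where
  "Phi s \<Lambda>h E r =
     ennreal (r powr (s - real DIM('a))) *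
       (\<integral>\<^sup>+X\<in>half_ball r. ennreal (snd X powr (1 - s) *
          norm (gradient (extension s (phase E)) X) ^ 2) \<partial>lebesgue) +
     ennreal ((real DIM('a) - s) / s * measure lebesgue (ball (0::'a) 1) * \<Lambda>h * r powr s)"

end

theory Submission
  imports Defs
begin

text \<open>
  Let \<open>D(r)\<close> be the energy of the extension in the half ball of radius \<open>r\<close> and \<open>q = n - s\<close>. Fix
  \<open>a < r\<close> and compose the extension with the radial bi-Lipschitz map which fixes the complement of
  the ball of radius \<open>r\<close>, scales a tiny ball of radius \<open>t\<close> onto the ball of radius \<open>a\<close>, and
  in between sends radius \<open>\<tau>\<close> to \<open>\<phi>\<close>, where \<open>\<phi>\<^sup>q\<close> is affine in \<open>\<tau>\<^sup>q\<close>. As \<open>\<tau> \<phi>' \<le> \<phi>\<close>,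
  the gradient grows by at most \<open>\<phi> / \<tau>\<close>, and with this choice of \<open>\<phi>\<close> the Jacobian compensates
  all powers of \<open>\<phi> / \<tau>\<close> up to the slope of the affine function. The new trace is the phase of
  a set which differs from \<open>E\<close> only in the ball of radius \<open>r\<close>, so minimality applies, and \<open>t \<rightarrow> 0\<close> gives
  \<open>a\<^sup>-\<^sup>q D(a) \<le> r\<^sup>-\<^sup>q D(r) + (a\<^sup>-\<^sup>q - r\<^sup>-\<^sup>q) K r\<^sup>n\<close> with \<open>K\<close> equal to \<open>\<omega>\<^sub>n\<close> times \<open>8 c \<Lambda>\<close>. Summing this over
  fine partitions yields the monotonicity; no derivative of \<open>D\<close> is needed.
\<close>

section \<open>Polar coordinates\<close>

text \<open>The affine relation between \<open>tau^q\<close> and \<open>phi^q\<close> is dictated by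
  a count of powers. The squared gradient costs \<open>(phi/tau)^2\<close>, the weight gives back
  \<open>(phi/tau)^(1-s)\<close> and the spheres in dimension \<open>n + 1\<close> give back
  \<open>(phi/tau)^n\<close>. What remains is \<open>(tau/phi)^(q-1) dtau/dphi\<close>, which is
  constant exactly when \<open>d(tau^q)\<close> is a constant multiple of \<open>d(phi^q)\<close>.
  The tiny ball is the price for an admissible competitor: for \<open>t = 0\<close> the dilation
  factor blows up at the origin, and with it the Lipschitz bounds on which the trace and the
  finiteness of the nonlocal energy rest. Its own share of the energy is \<open>(t/a)^q D(a)\<close>
  and disappears in the limit. The coefficient \<open>(q/s) K\<close> of \<open>r^s\<close> has the
  derivative \<open>q K r^(s-1)\<close>. Since \<open>n = q + s\<close>, this is
  \<open>q r^(-q-1) K r^n\<close>, the infinitesimal form of the error in the inequality between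
  \<open>a\<close> and \<open>r\<close>. The constant \<open>c\<close> refers to the unit ball, so a
  ball inside the domain is first dilated to it, which turns \<open>\<Lambda>\<close> into
  \<open>\<Lambda> R^s\<close>. The 8 is the ratio of \<open>J1\<close> of a phase to the perimeter
  in the unit ball.\<close>

lemma nn_integral_lborel_scale:
  fixes f :: "'b::euclidean_space \<Rightarrow> ennreal"
  assumes [measurable]: "f \<in> borel_measurable borel" and c: "0 < c"
  shows "(\<integral>\<^sup>+x. f x \<partial>lborel) = ennreal (c ^ DIM('b)) * (\<integral>\<^sup>+x. f (c *\<^sub>R x) \<partial>lborel)"
  using c by (subst lborel_affine[of c 0])
     (simp_all add: nn_integral_density nn_integral_distr nn_integral_cmult ennreal_power)

text \<open>This is the surface measure divided by the dimension, with the volume of the unit ball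
  as total mass. The missing factor \<open>DIM('b)\<close> sits in \<open>radial_measure\<close>,
  whose distribution function is thereby exactly \<open>b ^ DIM('b)\<close>.\<close>

definition sphere_measure :: "'b::euclidean_space measure" where
  "sphere_measure = distr (density lborel (indicator (ball 0 1))) borel sgn"

definition radial_measure :: "'b::euclidean_space itself \<Rightarrow> real measure" where
  "radial_measure _ =
     density lborel (\<lambda>t. ennreal (real DIM('b) * t ^ (DIM('b) - 1)) * indicator {0<..} t)"

lemma sets_sphere_measure [measurable_cong, simp]: "sets sphere_measure = sets borel"
  by (simp add: sphere_measure_def)

lemma sets_radial_measure [measurable_cong, simp]:
  "sets (radial_measure TYPE('b::euclidean_space)) = sets borel"
  by (simp add: radial_measure_def)

lemma borel_measurable_sgn [measurable]: "(sgn :: 'b::euclidean_space \<Rightarrow> 'b) \<in> borel \<rightarrow>\<^sub>M borel"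
  unfolding sgn_div_norm by measurable

lemma ball_in_sets_borel [measurable]: "ball (x::'b::euclidean_space) r \<in> sets borel"
  by simp

lemma emeasure_sphere_measure:
  fixes B :: "'b::euclidean_space set"
  assumes [measurable]: "B \<in> sets borel"
  shows "emeasure sphere_measure B = emeasure lborel (ball 0 1 \<inter> sgn -` B)"
proof -
  have m: "sgn -` B \<in> sets borel"
    using measurable_sets[OF borel_measurable_sgn, of B] by simp
  show ?thesis
    using m unfolding sphere_measure_def
    by (simp add: emeasure_distr emeasure_density flip: indicator_inter_arith)
qed

lemma finite_measure_sphere_measure: "finite_measure (sphere_measure :: 'b::euclidean_space measure)"
proof
  have "space (sphere_measure :: 'b measure) = UNIV"
    by (simp add: sphere_measure_def)
  then show "emeasure (sphere_measure :: 'b measure) (space sphere_measure) \<noteq> \<infinity>"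
    using emeasure_lborel_ball_finite[of "0::'b" 1] by (simp add: emeasure_sphere_measure)
qed

lemma emeasure_radial_measure_lessThan:
  assumes "0 \<le> b"
  shows "emeasure (radial_measure TYPE('b::euclidean_space)) {..<b} = ennreal (b ^ DIM('b))"
proof -
  have "emeasure (radial_measure TYPE('b)) {..<b} =
      (\<integral>\<^sup>+t. ennreal (real DIM('b) * t ^ (DIM('b) - 1)) * indicator {0<..} t * indicator {..<b} t \<partial>lborel)"
    unfolding radial_measure_def by (subst emeasure_density) auto
  also have "\<dots> = (\<integral>\<^sup>+t. ennreal (real DIM('b) * t ^ (DIM('b) - 1)) * indicator {0..b} t \<partial>lborel)"
    using AE_lborel_singleton[of "0::real"] AE_lborel_singleton[of b]
    by (intro nn_integral_cong_AE) (auto simp: indicator_def)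
  also have "\<dots> = ennreal (b ^ DIM('b) - 0 ^ DIM('b))"
    using assms by (intro nn_integral_FTC_Icc) (auto intro!: derivative_eq_intros)
  finally show ?thesis by (simp add: power_0_left)
qed

lemma sigma_finite_radial_measure: "sigma_finite_measure (radial_measure TYPE('b::euclidean_space))"
proof
  let ?A = "range (\<lambda>i::nat. {..<real i})"
  have "\<Union>?A = UNIV" using reals_Archimedean2 by auto
  then show "\<exists>A. countable A \<and> A \<subseteq> sets (radial_measure TYPE('b)) \<and>
      \<Union>A = space (radial_measure TYPE('b)) \<and> (\<forall>a\<in>A. emeasure (radial_measure TYPE('b)) a \<noteq> \<infinity>)"
    by (intro exI[of _ ?A]) (auto simp: emeasure_radial_measure_lessThan, simp_all add: radial_measure_def)
qed

text \<open>The cone over \<open>B\<close> is invariant under dilations, so its part in a ball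
  scales like the ball.\<close>

lemma emeasure_cone_sector:
  fixes B :: "'b::euclidean_space set"
  assumes [measurable]: "B \<in> sets borel" and "0 \<le> b"
  shows "emeasure lborel (ball 0 b \<inter> sgn -` B) = ennreal (b ^ DIM('b)) * emeasure sphere_measure B"
proof (cases "b = 0")
  case True
  then show ?thesis by simp
next
  case False
  with assms have b: "0 < b" by simp
  have [measurable]: "sgn -` B \<in> sets borel"
    using measurable_sets[OF borel_measurable_sgn, of B] by simp
  have "emeasure lborel (ball 0 b \<inter> sgn -` B) = (\<integral>\<^sup>+x. indicator (ball 0 b \<inter> sgn -` B) x \<partial>lborel)"
    by (intro nn_integral_indicator[symmetric]) auto
  also have "\<dots> = ennreal (b ^ DIM('b)) * (\<integral>\<^sup>+x. indicator (ball 0 b \<inter> sgn -` B) (b *\<^sub>R x) \<partial>lborel)"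
    by (intro nn_integral_lborel_scale b borel_measurable_indicator) auto
  also have "(\<lambda>x. indicator (ball 0 b \<inter> sgn -` B) (b *\<^sub>R x) :: ennreal) = indicator (ball 0 1 \<inter> sgn -` B)"
    using b by (auto simp: fun_eq_iff indicator_def sgn_scaleR)
  also have "(\<integral>\<^sup>+x. indicator (ball 0 1 \<inter> sgn -` B) x \<partial>lborel) = emeasure sphere_measure B"
    by (simp add: emeasure_sphere_measure sets.Int)
  finally show ?thesis .
qed

text \<open>Uniqueness of the product measure leaves only rectangles \<open>A \<times> B\<close> to
  be compared. For half-lines \<open>A\<close> this is the volume of a cone sector, and half-lines
  generate the Borel sets.\<close>

lemma distr_norm_sgn:
  "distr lborel (borel \<Otimes>\<^sub>M borel) (\<lambda>x::'b::euclidean_space. (norm x, sgn x)) =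
     radial_measure TYPE('b) \<Otimes>\<^sub>M sphere_measure" (is "?D = ?R \<Otimes>\<^sub>M ?S")
proof (rule sym, rule pair_measure_eqI)
  show "sigma_finite_measure ?R" by (rule sigma_finite_radial_measure)
  show "sigma_finite_measure ?S"
    using finite_measure_sphere_measure by (rule finite_measure.axioms(1))
  show "sets (?R \<Otimes>\<^sub>M ?S) = sets ?D"
    by (auto intro: sets_pair_measure_cong)
  fix A B assume "A \<in> sets ?R" and "B \<in> sets ?S"
  then have A: "A \<in> sets borel" and B [measurable]: "B \<in> sets borel" by auto
  have sB [measurable]: "(sgn :: 'b \<Rightarrow> 'b) -` B \<in> sets borel"
    using measurable_sets[OF borel_measurable_sgn, of B] by simp
  \<comment> \<open>For fixed \<open>B\<close> both sides are regarded as measures in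
    \<open>A\<close>, so that the generator argument applies to one variable.\<close>
  let ?M = "distr (density lborel (indicator (sgn -` B))) borel (norm :: 'b \<Rightarrow> real)"
  let ?N = "density ?R (\<lambda>_. emeasure ?S B)"
  have eM: "emeasure ?M X = emeasure lborel (norm -` X \<inter> sgn -` B)" if X: "X \<in> sets borel" for X
  proof -
    have [measurable]: "(norm :: 'b \<Rightarrow> real) -` X \<in> sets borel"
      using measurable_sets[OF borel_measurable_continuous_onI[OF continuous_on_norm_id] X] by simp
    have "emeasure ?M X = (\<integral>\<^sup>+x. indicator (sgn -` B) x * indicator (norm -` X) x \<partial>lborel)"
      using X by (simp add: emeasure_distr emeasure_density)
    also have "\<dots> = (\<integral>\<^sup>+x. indicator (norm -` X \<inter> sgn -` B) x \<partial>lborel)"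
      by (intro nn_integral_cong) (auto simp: indicator_def)
    also have "\<dots> = emeasure lborel (norm -` X \<inter> sgn -` B)"
      by (intro nn_integral_indicator) auto
    finally show ?thesis .
  qed
  have "?M = ?N"
  proof (rule measure_eqI_generator_eq)
    let ?E = "range (\<lambda>b::real. {..<b})"
    show "Int_stable ?E"
    proof -
      have "{..<a} \<inter> {..<b} = {..<min a b}" for a b :: real by auto
      then show ?thesis by (auto simp: Int_stable_def)
    qed
    show "?E \<subseteq> Pow UNIV" "sets ?M = sigma_sets UNIV ?E" "sets ?N = sigma_sets UNIV ?E"
      by (auto simp: borel_Iio)
    fix X assume "X \<in> ?E"
    then obtain b where X: "X = {..<b}" by auto
    have "emeasure ?N X = emeasure ?S B * emeasure ?R {..<b}"
      by (simp add: X emeasure_density nn_integral_cmult_indicator)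
    moreover have "norm -` {..<b} = (ball 0 b :: 'b set)"
      by (auto simp: dist_norm)
    ultimately show "emeasure ?M X = emeasure ?N X"
    proof (cases "0 \<le> b")
      case True
      then show ?thesis
        using \<open>emeasure ?N X = _\<close> \<open>norm -` {..<b} = _\<close>
        by (simp add: X eM emeasure_cone_sector emeasure_radial_measure_lessThan mult.commute)
    next
      case False
      then have "emeasure ?R {..<b} \<le> emeasure ?R {..<0}"
        by (intro emeasure_mono) auto
      with False \<open>emeasure ?N X = _\<close> \<open>norm -` {..<b} = _\<close> show ?thesis
        by (simp add: X eM emeasure_radial_measure_lessThan power_0_left ball_empty)
    qed
  next
    let ?A = "\<lambda>i::nat. {..<real i}"
    show "range ?A \<subseteq> range lessThan" by auto
    show "(\<Union>i. ?A i) = UNIV" using reals_Archimedean2 by auto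
    show "emeasure ?M (?A i) \<noteq> \<infinity>" for i
    proof -
      have "emeasure ?M (?A i) \<le> emeasure lborel (ball 0 (real i) :: 'b set)"
        by (subst eM) (auto intro!: emeasure_mono simp: dist_norm)
      then show ?thesis
        using emeasure_lborel_ball_finite[of "0::'b" "real i"] by (auto simp: top_unique)
    qed
  qed
  then have "emeasure ?M A = emeasure ?N A" by simp
  also have "emeasure ?N A = emeasure ?R A * emeasure ?S B"
    using A by (simp add: emeasure_density nn_integral_cmult_indicator) (rule mult.commute)
  also have "emeasure ?M A = emeasure ?D (A \<times> B)"
    using A by (subst eM) (auto simp: emeasure_distr intro!: arg_cong[where f="emeasure lborel"])
  finally show "emeasure ?R A * emeasure ?S B = emeasure ?D (A \<times> B)" by simp
qed

lemma nn_integral_polar: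
  fixes f :: "'b::euclidean_space \<Rightarrow> ennreal"
  assumes [measurable]: "f \<in> borel_measurable borel"
  shows "(\<integral>\<^sup>+x. f x \<partial>lborel) =
    (\<integral>\<^sup>+\<theta>. (\<integral>\<^sup>+t. ennreal (real DIM('b) * t ^ (DIM('b) - 1)) * indicator {0<..} t * f (t *\<^sub>R \<theta>) \<partial>lborel)
       \<partial>sphere_measure)"
proof -
  interpret S: finite_measure "sphere_measure :: 'b measure"
    by (rule finite_measure_sphere_measure)
  interpret R: sigma_finite_measure "radial_measure TYPE('b)"
    by (rule sigma_finite_radial_measure)
  interpret P: pair_sigma_finite "radial_measure TYPE('b)" "sphere_measure :: 'b measure" ..
  have "(\<integral>\<^sup>+x. f x \<partial>lborel) = (\<integral>\<^sup>+x. f (norm x *\<^sub>R sgn x) \<partial>lborel)"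
    by (intro nn_integral_cong arg_cong[where f=f])
       (metis norm_eq_zero right_inverse scaleR_one scaleR_scaleR scaleR_zero_right sgn_div_norm)
  also have "\<dots> = (\<integral>\<^sup>+p. f (fst p *\<^sub>R snd p) \<partial>distr lborel (borel \<Otimes>\<^sub>M borel) (\<lambda>x::'b. (norm x, sgn x)))"
    by (subst nn_integral_distr) auto
  also have "\<dots> = (\<integral>\<^sup>+\<theta>. (\<integral>\<^sup>+t. f (t *\<^sub>R \<theta>) \<partial>radial_measure TYPE('b)) \<partial>sphere_measure)"
    unfolding distr_norm_sgn by (subst P.nn_integral_snd[symmetric]) auto
  finally show ?thesis
    unfolding radial_measure_def by (subst (asm) nn_integral_density) auto
qed

lemma AE_sphere_measure_norm: "AE \<theta> in (sphere_measure :: 'b::euclidean_space measure). norm \<theta> = 1"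
proof -
  have "AE x in lborel. x \<noteq> (0::'b)" by (rule AE_lborel_singleton)
  then show ?thesis
    unfolding sphere_measure_def
    by (subst AE_distr_iff, simp, simp, subst AE_density)
       (auto simp: norm_sgn intro: borel_measurable_indicator)
qed

section \<open>The radial deformation\<close>

text \<open>The exponent \<open>q\<close> is a free positive number here and becomes
  \<open>n - s\<close> later. The map is polymorphic in the space because it acts on the base, of
  dimension \<open>n\<close>, as well as on the half space, of dimension
  \<open>n + 1\<close>.\<close>

locale radial_stretch =
  fixes q t a r :: real
  assumes q_pos: "0 < q" and t_pos: "0 < t" and t_less_a: "t < a" and a_less_r: "a < r"
begin

text \<open>\<open>slope\<close> and \<open>shift\<close> are the two unknowns of
  \<open>slope * radius x powr q = x powr q + shift\<close>, fixed by the end conditions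
  \<open>radius t = a\<close> and \<open>radius r = r\<close>.\<close>

definition slope :: real where
  "slope = (r powr q - t powr q) / (r powr q - a powr q)"

definition shift :: real where
  "shift = (slope - 1) * r powr q"

text \<open>The quotient \<open>radius x / x\<close>, with the power of \<open>x\<close> moved under
  the root so that it is visibly decreasing.\<close>

definition profile :: "real \<Rightarrow> real" where
  "profile x = ((1 + shift * x powr (-q)) / slope) powr (1 / q)"

text \<open>Clamping the argument to the interval from \<open>t\<close> to \<open>r\<close> yields
  in one formula the dilation by \<open>a / t\<close> on the small ball and the identity outside the
  large one.\<close>

definition factor :: "real \<Rightarrow> real" where
  "factor x = profile (max t (min r x))"

definition stretch :: "'b::euclidean_space \<Rightarrow> 'b" where
  "stretch X = factor (norm X) *\<^sub>R X"

definition radius :: "real \<Rightarrow> real" where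
  "radius x = ((x powr q + shift) / slope) powr (1 / q)"

lemma pos [simp]: "0 < q" "0 < t" "0 < a" "0 < r" "t < r" "t < a" "a < r"
    "0 \<le> q" "0 \<le> t" "0 \<le> a" "0 \<le> r" "t \<le> r" "t \<le> a" "a \<le> r" "q \<noteq> 0" "t \<noteq> 0" "a \<noteq> 0" "r \<noteq> 0"
  using q_pos t_pos t_less_a a_less_r by auto

lemma powr_less: "t powr q < a powr q" "a powr q < r powr q" "0 < t powr q"
  by (auto intro!: powr_less_mono2)

lemma slope_gt_1: "1 < slope"
  using powr_less by (simp add: slope_def less_divide_eq)

lemma slope_pos [simp]: "0 < slope" "slope \<noteq> 0" "0 \<le> slope"
  using slope_gt_1 by auto

lemma shift_pos [simp]: "0 < shift" "0 \<le> shift"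
  using slope_gt_1 by (auto simp: shift_def)

lemma one_plus_shift: "0 < 1 + shift * x powr p"
  by (simp add: add_pos_nonneg)

lemma slope_mult_a: "slope * a powr q = t powr q + shift"
proof -
  have "slope * (r powr q - a powr q) = r powr q - t powr q"
    using powr_less by (simp add: slope_def)
  then show ?thesis by (simp add: shift_def algebra_simps)
qed

lemma profile_pos: "0 < x \<Longrightarrow> 0 < profile x"
  using one_plus_shift[of x "-q"] by (simp add: profile_def)

lemma profile_mult: "0 < x \<Longrightarrow> profile x * x = radius x"
proof -
  assume x: "0 < x"
  have "profile x * x = profile x * (x powr q) powr (1 / q)"
    using x by (simp add: powr_powr)
  also have "\<dots> = ((1 + shift * x powr (-q)) / slope * x powr q) powr (1 / q)"
    using x one_plus_shift[of x "-q"] unfolding profile_def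
    by (subst powr_mult[symmetric]) (simp_all add: less_imp_le)
  also have "(1 + shift * x powr (-q)) / slope * x powr q = (x powr q + shift) / slope"
    using x by (simp add: powr_minus field_simps)
  finally show ?thesis by (simp add: radius_def)
qed

lemma radius_t: "radius t = a"
proof -
  have "(t powr q + shift) / slope = a powr q"
    unfolding slope_mult_a[symmetric] by simp
  then show ?thesis by (simp add: radius_def powr_powr)
qed

lemma radius_r: "radius r = r"
proof -
  have "(r powr q + shift) / slope = r powr q"
    using slope_pos by (simp add: shift_def field_simps)
  then show ?thesis by (simp add: radius_def powr_powr)
qed

lemma profile_r: "profile r = 1"
  using profile_mult[of r] radius_r by simp

lemma profile_t: "profile t = a / t"
  using profile_mult[of t] radius_t by (simp add: field_simps)

lemma profile_antimono: "0 < x \<Longrightarrow> x \<le> y \<Longrightarrow> profile y \<le> profile x"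
  unfolding profile_def
  by (intro powr_mono2 divide_right_mono add_left_mono mult_left_mono powr_mono2')
     (auto intro!: divide_nonneg_pos add_nonneg_nonneg less_imp_le)

lemma profile_bounds:
  assumes "t \<le> x" "x \<le> r"
  shows "1 \<le> profile x" "profile x \<le> a / t"
proof -
  have "0 < x" using assms(1) t_pos by linarith
  then show "1 \<le> profile x" using profile_antimono[of x r] assms profile_r by simp
  show "profile x \<le> a / t" using profile_antimono[of t x] assms profile_t by simp
qed

lemma factor_bounds: "1 \<le> factor x" "factor x \<le> a / t"
  unfolding factor_def by (auto intro!: profile_bounds)

lemma factor_pos [simp]: "0 < factor x"
  using factor_bounds(1)[of x] by linarith

lemma factor_le_t: "x \<le> t \<Longrightarrow> factor x = a / t"
proof -
  assume "x \<le> t"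
  then have "max t (min r x) = t" using t_less_a a_less_r by linarith
  then show ?thesis by (simp add: factor_def profile_t)
qed

lemma factor_ge_r: "r \<le> x \<Longrightarrow> factor x = 1"
proof -
  assume "r \<le> x"
  then have "max t (min r x) = r" using t_less_a a_less_r by linarith
  then show ?thesis by (simp add: factor_def profile_r)
qed

lemma factor_between: "t \<le> x \<Longrightarrow> x \<le> r \<Longrightarrow> factor x = profile x"
  by (simp add: factor_def max_def min_def)

text \<open>Written as \<open>c * (profile x / x)\<close> with \<open>c\<close> between -1 and 0.
  The radial speed of the stretch is then \<open>(1 + c) * profile x\<close>, at most the tangential
  one.\<close>

definition profile_deriv :: "real \<Rightarrow> real" where
  "profile_deriv x = - (shift * x powr (-q) / (1 + shift * x powr (-q))) * (profile x / x)"

lemma has_real_derivative_profile: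
  assumes x: "0 < x"
  shows "(profile has_real_derivative profile_deriv x) (at x)"
proof -
  let ?A = "1 + shift * x powr (-q)"
  have A: "0 < ?A" using x by (simp add: add_pos_pos)
  have "((\<lambda>x. ((1 + shift * x powr (-q)) / slope) powr (1 / q)) has_real_derivative
      (1 / q) * (?A / slope) powr (1 / q - 1) * (shift * ((-q) * x powr (-q - 1)) / slope)) (at x)"
    using x A by (auto intro!: derivative_eq_intros)
  moreover have "(?A / slope) powr (1 / q - 1) = profile x / (?A / slope)"
    using A by (simp add: profile_def powr_diff)
  moreover have "x powr (-q - 1) = x powr (-q) / x"
    using x by (simp add: powr_diff)
  moreover have "(1 / q) * (P / (C / slope)) * (shift * ((-q) * (B / x)) / slope) =
      - (shift * B / C) * (P / x)" if "C \<noteq> 0" for P B C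
    using that x by (simp add: divide_simps)
  ultimately show ?thesis
    using A by (simp add: profile_def[abs_def] profile_deriv_def ac_simps)
qed

lemma profile_lipschitz: obtains L where "L-lipschitz_on {t..r} profile"
proof -
  have p: "0 < x" if "x \<in> {t..r}" for x
    using that t_pos by (meson atLeastAtMost_iff less_le_trans)
  have "continuous_on {t..r} profile"
    by (intro continuous_at_imp_continuous_on ballI)
       (use p has_real_derivative_profile DERIV_isCont in blast)
  then have "continuous_on {t..r} profile_deriv"
    unfolding profile_deriv_def
    using one_plus_shift by (intro continuous_intros ballI) (force dest!: p simp: less_le)+
  then have "compact (profile_deriv ` {t..r})"
    by (intro compact_continuous_image) auto
  then obtain B where B: "\<And>x. x \<in> {t..r} \<Longrightarrow> \<bar>profile_deriv x\<bar> \<le> B"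
    by (force dest!: compact_imp_bounded simp: bounded_iff)
  then have "0 \<le> B" by (force dest: B[of t])
  have "B-lipschitz_on {t..r} profile"
  proof (rule bounded_derivative_imp_lipschitz)
    show "(profile has_derivative (\<lambda>h. profile_deriv x * h)) (at x within {t..r})" if "x \<in> {t..r}" for x
      using has_real_derivative_profile[OF p[OF that]]
      by (simp add: has_field_derivative_def has_derivative_at_withinI)
    show "onorm (\<lambda>h. profile_deriv x * h) \<le> B" if "x \<in> {t..r}" for x
      using B[OF that] by (intro onorm_le) (auto simp: abs_mult intro: mult_right_mono)
  qed (auto simp: \<open>0 \<le> B\<close>)
  then show thesis by (rule that)
qed

lemma factor_lipschitz: obtains L where "0 \<le> L" "\<And>x y. \<bar>factor x - factor y\<bar> \<le> L * \<bar>x - y\<bar>"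
proof -
  obtain L where L: "L-lipschitz_on {t..r} profile" by (rule profile_lipschitz)
  have "0 \<le> L" using L by (rule lipschitz_on_nonneg)
  moreover have "\<bar>factor x - factor y\<bar> \<le> L * \<bar>x - y\<bar>" for x y
  proof -
    have "\<bar>factor x - factor y\<bar> \<le> L * \<bar>max t (min r x) - max t (min r y)\<bar>"
      using lipschitz_onD[OF L, of "max t (min r x)" "max t (min r y)"]
      by (simp add: factor_def dist_real_def)
    also have "\<dots> \<le> L * \<bar>x - y\<bar>"
      using \<open>0 \<le> L\<close> by (intro mult_left_mono) auto
    finally show ?thesis .
  qed
  ultimately show thesis by (rule that)
qed

lemma stretch_lipschitz:
  obtains L where "0 < L" "\<And>X Y::'b::euclidean_space. norm (stretch X - stretch Y) \<le> L * norm (X - Y)"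
proof -
  obtain K where K: "0 \<le> K" "\<And>x y. \<bar>factor x - factor y\<bar> \<le> K * \<bar>x - y\<bar>"
    using factor_lipschitz by blast
  let ?L = "a / t + K * r"
  have at: "1 \<le> a / t" by simp
  have Kr: "0 \<le> K * r" using K(1) by (simp add: less_imp_le)
  \<comment> \<open>By symmetry \<open>Y\<close> is the point nearer to the origin. Either both
    points are fixed, or \<open>norm Y < r\<close> controls the term in which the factor varies;
    this is where the summand \<open>K * r\<close> comes from.\<close>
  have *: "norm (stretch X - stretch Y) \<le> ?L * norm (X - Y)" if le: "norm Y \<le> norm X" for X Y :: 'b
  proof (cases "r \<le> norm Y")
    case True
    with le have "stretch X - stretch Y = X - Y" by (simp add: stretch_def factor_ge_r)
    moreover have "1 * norm (X - Y) \<le> ?L * norm (X - Y)"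
      using add_mono[OF at Kr] by (intro mult_right_mono) auto
    ultimately show ?thesis by simp
  next
    case False
    have "stretch X - stretch Y = factor (norm X) *\<^sub>R (X - Y) + (factor (norm X) - factor (norm Y)) *\<^sub>R Y"
      by (simp add: stretch_def algebra_simps)
    then have "norm (stretch X - stretch Y) \<le>
        factor (norm X) * norm (X - Y) + \<bar>factor (norm X) - factor (norm Y)\<bar> * norm Y"
      using norm_triangle_ineq[of "factor (norm X) *\<^sub>R (X - Y)" "(factor (norm X) - factor (norm Y)) *\<^sub>R Y"]
        factor_pos[of "norm X"] by simp
    also have "\<dots> \<le> a / t * norm (X - Y) + (K * norm (X - Y)) * r"
    proof (intro add_mono mult_right_mono mult_mono factor_bounds)
      show "\<bar>factor (norm X) - factor (norm Y)\<bar> \<le> K * norm (X - Y)"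
        using K(2)[of "norm X" "norm Y"] K(1) norm_triangle_ineq3[of X Y]
        by (meson mult_left_mono order_trans)
    qed (use False K in auto)
    finally show ?thesis by (simp add: algebra_simps)
  qed
  have "norm (stretch X - stretch Y) \<le> ?L * norm (X - Y)" for X Y :: 'b
    using *[of X Y] *[of Y X] by (cases "norm Y \<le> norm X") (auto simp: norm_minus_commute)
  moreover have "0 < ?L" using at Kr by linarith
  ultimately show thesis by (rule that[rotated])
qed

lemma continuous_on_stretch: "continuous_on UNIV (stretch :: 'b::euclidean_space \<Rightarrow> 'b)"
proof -
  obtain L where "0 < L" "\<And>X Y::'b. norm (stretch X - stretch Y) \<le> L * norm (X - Y)"
    using stretch_lipschitz by blast
  then have "L-lipschitz_on UNIV (stretch :: 'b \<Rightarrow> 'b)"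
    by (intro lipschitz_onI) (auto simp: dist_norm)
  then show ?thesis by (rule lipschitz_on_continuous_on)
qed

lemma borel_measurable_stretch [measurable]:
  "(stretch :: 'b::euclidean_space \<Rightarrow> 'b) \<in> borel \<rightarrow>\<^sub>M borel"
  by (intro borel_measurable_continuous_onI continuous_on_stretch)

lemma borel_measurable_factor [measurable]: "factor \<in> borel_measurable borel"
  unfolding factor_def profile_def by measurable

lemma stretch_outside: "r \<le> norm X \<Longrightarrow> stretch X = X"
  by (simp add: stretch_def factor_ge_r)

section \<open>Radii and integrals under the stretch\<close>

lemma radius_pos: "0 < x \<Longrightarrow> 0 < radius x"
  using profile_mult[of x] profile_pos[of x] by (metis mult_pos_pos)

lemma radius_mono: "0 < x \<Longrightarrow> x < y \<Longrightarrow> radius x < radius y"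
  unfolding radius_def
  by (intro powr_less_mono2 divide_strict_right_mono add_strict_right_mono)
     (auto intro!: divide_nonneg_pos add_nonneg_nonneg less_imp_le)

lemma norm_stretch: "norm (stretch X) = factor (norm X) * norm X"
  by (simp add: stretch_def less_imp_le)

lemma norm_stretch_less: "norm (stretch X) < r \<longleftrightarrow> norm X < r"
proof (cases "norm X < r")
  case True
  have "norm (stretch X) < r"
  proof (cases "norm X \<le> t")
    case le: True
    then have "norm (stretch X) = a / t * norm X" by (simp add: norm_stretch factor_le_t)
    also have "\<dots> \<le> a / t * t" using le by (intro mult_left_mono) (auto simp: less_imp_le)
    also have "\<dots> = a" by simp
    finally show ?thesis using a_less_r by (rule le_less_trans)
  next
    case False
    then have "norm (stretch X) = radius (norm X)"
      using True profile_mult[of "norm X"] less_trans[OF t_pos, of "norm X"]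
      by (simp add: norm_stretch factor_between)
    also have "\<dots> < radius r"
      using True False less_trans[OF t_pos, of "norm X"] by (intro radius_mono) auto
    finally show ?thesis by (simp add: radius_r)
  qed
  with True show ?thesis by simp
qed (simp add: stretch_outside)

text \<open>Differentiating the affine relation gives
  \<open>slope * radius x powr (q - 1) * radius' = x powr (q - 1)\<close>, the identity that absorbs
  the Jacobian in the change of variables.\<close>

lemma has_real_derivative_radius:
  assumes x: "0 < x"
  shows "(radius has_real_derivative (x powr (q - 1) / (slope * radius x powr (q - 1)))) (at x)"
proof -
  let ?A = "(x powr q + shift) / slope"
  have A: "0 < ?A" using x by (simp add: add_pos_pos)
  have "((\<lambda>x. ((x powr q + shift) / slope) powr (1 / q)) has_real_derivative
      (1 / q) * ?A powr (1 / q - 1) * (q * x powr (q - 1) / slope)) (at x)"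
    using x A by (auto intro!: derivative_eq_intros simp: add_pos_pos)
  moreover have "?A powr (1 / q - 1) = 1 / radius x powr (q - 1)"
    using A by (simp add: radius_def powr_powr diff_divide_distrib right_diff_distrib
        flip: powr_minus_divide)
  ultimately show ?thesis
    by (simp add: radius_def[abs_def] field_simps)
qed

text \<open>On the small ball the map is the dilation by \<open>a / t\<close>. Its Jacobian
  \<open>(a / t) ^ DIM('b)\<close> cancels against the weight up to
  \<open>(a / t) powr (-q)\<close>, so the contribution vanishes as \<open>t\<close> tends to
  0.\<close>

lemma nn_integral_stretch_inner:
  fixes f :: "'b::euclidean_space \<Rightarrow> ennreal"
  assumes [measurable]: "f \<in> borel_measurable borel"
  shows "(\<integral>\<^sup>+X. ennreal (factor (norm X) powr (DIM('b) - q)) * f (stretch X) * indicator (ball 0 t) X \<partial>lborel)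
    = ennreal ((t / a) powr q) * (\<integral>\<^sup>+Y. f Y * indicator (ball 0 a) Y \<partial>lborel)"
proof -
  have at: "0 < a / t" by simp
  have "(\<integral>\<^sup>+X. ennreal (factor (norm X) powr (DIM('b) - q)) * f (stretch X) * indicator (ball 0 t) X \<partial>lborel) =
    (\<integral>\<^sup>+X. ennreal ((a / t) powr (DIM('b) - q)) * (f ((a / t) *\<^sub>R X) * indicator (ball 0 a) ((a / t) *\<^sub>R X)) \<partial>lborel)"
    by (intro nn_integral_cong)
       (auto simp: indicator_def stretch_def factor_le_t less_imp_le field_simps)
  also have "\<dots> = ennreal ((a / t) powr (DIM('b) - q)) *
      (\<integral>\<^sup>+X. f ((a / t) *\<^sub>R X) * indicator (ball 0 a) ((a / t) *\<^sub>R X) \<partial>lborel)"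
    by (intro nn_integral_cmult) simp
  also have "(a / t) powr (DIM('b) - q) = (t / a) powr q * (a / t) ^ DIM('b)"
    using at by (simp add: powr_diff powr_divide powr_realpow field_simps)
  also have "ennreal ((t / a) powr q * (a / t) ^ DIM('b)) *
      (\<integral>\<^sup>+X. f ((a / t) *\<^sub>R X) * indicator (ball 0 a) ((a / t) *\<^sub>R X) \<partial>lborel) =
      ennreal ((t / a) powr q) * (\<integral>\<^sup>+Y. f Y * indicator (ball 0 a) Y \<partial>lborel)"
    using at by (subst (2) nn_integral_lborel_scale[of _ "a / t"]) (auto simp: ennreal_mult' mult.assoc)
  finally show ?thesis .
qed

text \<open>On a ray, with \<open>d = DIM('b)\<close> and \<open>phi = radius tau\<close>, one has
  \<open>(phi/tau)^(d-q) tau^(d-1) = phi^(d-1) (tau/phi)^(q-1) = slope phi^(d-1) phi'\<close>.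
  Substitution along the ray therefore leaves only the constant \<open>slope\<close>.\<close>

lemma nn_integral_stretch_outer:
  fixes f :: "'b::euclidean_space \<Rightarrow> ennreal"
  assumes [measurable]: "f \<in> borel_measurable borel"
  shows "(\<integral>\<^sup>+X. ennreal (factor (norm X) powr (DIM('b) - q)) * f (stretch X) * indicator (ball 0 r - ball 0 t) X \<partial>lborel)
    = ennreal slope * (\<integral>\<^sup>+Y. f Y * indicator (ball 0 r - ball 0 a) Y \<partial>lborel)"
proof -
  let ?n = "DIM('b)"
  let ?w = "\<lambda>x. ennreal (real ?n * x ^ (?n - 1)) * indicator {0<..} x"
  have inner: "(\<integral>\<^sup>+x. ?w x * (ennreal (factor (norm (x *\<^sub>R \<theta>)) powr (?n - q)) * f (stretch (x *\<^sub>R \<theta>)) *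
        indicator (ball 0 r - ball 0 t) (x *\<^sub>R \<theta>)) \<partial>lborel) =
      (\<integral>\<^sup>+x. ?w x * (ennreal slope * (f (x *\<^sub>R \<theta>) * indicator (ball 0 r - ball 0 a) (x *\<^sub>R \<theta>))) \<partial>lborel)"
    (is "?L = ?R")
    if \<theta>: "norm \<theta> = 1" for \<theta> :: 'b
  proof -
    let ?F = "\<lambda>x. ennreal (slope * (real ?n * x ^ (?n - 1))) * f (x *\<^sub>R \<theta>)"
    let ?d = "\<lambda>x. x powr (q - 1) / (slope * radius x powr (q - 1))"
    have pos': "0 < x" if "x \<in> {t..r}" for x
      using that t_pos by (meson atLeastAtMost_iff less_le_trans)
    \<comment> \<open>The annulus omits its outer sphere, whereas the substitution rule wants a
      closed interval; the endpoint \<open>r\<close> is a null set on the ray.\<close>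
    have "?R = (\<integral>\<^sup>+x. ?F x * indicator {radius t..radius r} x \<partial>lborel)"
      using AE_lborel_singleton[of r] unfolding radius_t radius_r
      by (intro nn_integral_cong_AE)
         (auto elim!: eventually_mono simp: indicator_def \<theta> ennreal_mult' ac_simps dest: less_le_trans[OF pos(3)])
    also have "\<dots> = (\<integral>\<^sup>+x. ?F (radius x) * ennreal (?d x) * indicator {t..r} x \<partial>lborel)"
    proof (rule nn_integral_substitution_aux)
      show "(radius has_real_derivative ?d x) (at x)" if "x \<in> {t..r}" for x
        using pos'[OF that] by (rule has_real_derivative_radius)
      have "continuous_on {t..r} radius"
        by (intro continuous_at_imp_continuous_on ballI)
           (use pos' has_real_derivative_radius DERIV_isCont in blast)
      then show "continuous_on {t..r} ?d"
        using pos' radius_pos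
        by (intro continuous_intros ballI) (metis less_irrefl powr_gt_zero mult_eq_0_iff slope_pos(2))+
      show "0 \<le> ?d x" if "x \<in> {t..r}" for x by simp
    qed auto
    also have "\<dots> = ?L"
      using AE_lborel_singleton[of r]
    proof (intro nn_integral_cong_AE, elim eventually_mono)
      fix x assume "x \<noteq> r"
      show "?F (radius x) * ennreal (?d x) * indicator {t..r} x =
        ?w x * (ennreal (factor (norm (x *\<^sub>R \<theta>)) powr (?n - q)) * f (stretch (x *\<^sub>R \<theta>)) *
        indicator (ball 0 r - ball 0 t) (x *\<^sub>R \<theta>))"
      proof (cases "x \<in> {t..r}")
        case True
        let ?\<rho> = "radius x"
        have x: "0 < x" and \<rho>: "0 < ?\<rho>"
          using pos'[OF True] radius_pos by auto
        have pr: "profile x = ?\<rho> / x"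
          using profile_mult[OF x] x by (simp add: field_simps)
        have "(slope * (real ?n * ?\<rho> ^ (?n - 1))) * ?d x =
          (real ?n * x ^ (?n - 1)) * (profile x powr (?n - q))"
        proof -
          have e: "real (?n - 1) = real ?n - 1" using DIM_positive[where 'a='b] by linarith
          have "slope * (real ?n * ?\<rho> powr real (?n - 1)) * ?d x =
              real ?n * x powr real (?n - 1) * (?\<rho> / x) powr (?n - q)"
            using x \<rho> unfolding e by (simp add: powr_diff powr_divide field_simps)
          then show ?thesis unfolding pr powr_realpow[OF x] powr_realpow[OF \<rho>] .
        qed
        then have "ennreal (slope * (real ?n * ?\<rho> ^ (?n - 1))) * ennreal (?d x) =
          ennreal (real ?n * x ^ (?n - 1)) * ennreal (profile x powr (?n - q))"
          using x \<rho> by (simp add: ennreal_mult'[symmetric] less_imp_le)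
        moreover have "stretch (x *\<^sub>R \<theta>) = ?\<rho> *\<^sub>R \<theta>"
          using True x \<theta> profile_mult[OF x] by (simp add: stretch_def factor_between)
        ultimately show ?thesis
          using True x \<theta> \<open>x \<noteq> r\<close> by (simp add: indicator_def factor_between ac_simps)
      next
        case False
        then show ?thesis using \<theta> by (auto simp: indicator_def)
      qed
    qed
    finally show ?thesis by simp
  qed
  have "(\<integral>\<^sup>+X. ennreal (factor (norm X) powr (?n - q)) * f (stretch X) * indicator (ball 0 r - ball 0 t) X \<partial>lborel)
    = (\<integral>\<^sup>+X. ennreal slope * (f X * indicator (ball 0 r - ball 0 a) X) \<partial>lborel)"
    using AE_sphere_measure_norm[where 'b='b]
    by (subst (1 2) nn_integral_polar, simp, simp, intro nn_integral_cong_AE)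
       (auto elim!: eventually_mono simp only: inner)
  also have "\<dots> = ennreal slope * (\<integral>\<^sup>+Y. f Y * indicator (ball 0 r - ball 0 a) Y \<partial>lborel)"
    by (intro nn_integral_cmult) simp
  finally show ?thesis .
qed

text \<open>In dimension \<open>n + 1\<close> with \<open>q = n - s\<close> the exponent of the
  weight is \<open>1 + s\<close>: two powers of the dilation for the squared gradient, less
  \<open>1 - s\<close> for the power of the height.\<close>

lemma nn_integral_stretch:
  fixes f :: "'b::euclidean_space \<Rightarrow> ennreal"
  assumes [measurable]: "f \<in> borel_measurable borel"
  shows "(\<integral>\<^sup>+X. ennreal (factor (norm X) powr (DIM('b) - q)) * f (stretch X) * indicator (ball 0 r) X \<partial>lborel)
    = ennreal ((t / a) powr q) * (\<integral>\<^sup>+Y. f Y * indicator (ball 0 a) Y \<partial>lborel) +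
      ennreal slope * (\<integral>\<^sup>+Y. f Y * indicator (ball 0 r - ball 0 a) Y \<partial>lborel)"
proof -
  have "indicator (ball 0 r) X = (indicator (ball 0 t) X + indicator (ball 0 r - ball 0 t) X :: ennreal)" for X :: 'b
    using less_trans[OF _ pos(5), of "norm X"] by (auto simp: indicator_def)
  then show ?thesis
    by (simp add: distrib_left nn_integral_add nn_integral_stretch_inner nn_integral_stretch_outer)
qed

text \<open>Composition with the stretch is bounded on \<open>L^1\<close>. It is applied on the
  base, to the trace and to the double integrals of the nonlocal energy. The exact formula inside
  the ball suffices, because its weight is bounded below.\<close>

lemma nn_integral_stretch_le:
  obtains C where "0 \<le> C" "\<And>f :: 'b::euclidean_space \<Rightarrow> ennreal. f \<in> borel_measurable borel \<Longrightarrow>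
    (\<integral>\<^sup>+X. f (stretch X) \<partial>lborel) \<le> ennreal C * (\<integral>\<^sup>+Y. f Y \<partial>lborel)"
proof -
  let ?n = "DIM('b)"
  \<comment> \<open>A lower bound for the weight that serves both signs of the exponent, as the
    factor lies between 1 and \<open>a / t\<close>.\<close>
  define d where "d = min 1 ((a / t) powr (?n - q))"
  have d: "0 < d" by (simp add: d_def)
  have d_le: "d \<le> factor x powr (?n - q)" for x
  proof (cases "0 \<le> ?n - q")
    case True
    then show ?thesis using factor_bounds(1)[of x] by (simp add: d_def ge_one_powr_ge_zero min_le_iff_disj)
  next
    case False
    then show ?thesis using factor_bounds(2)[of x]
      by (simp add: d_def min_le_iff_disj powr_mono2')
  qed
  define C where "C = 1 + ((t / a) powr q + slope) / d"
  have "(\<integral>\<^sup>+X. f (stretch X) \<partial>lborel) \<le> ennreal C * (\<integral>\<^sup>+Y. f Y \<partial>lborel)"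
    if [measurable]: "f \<in> borel_measurable borel" for f :: "'b \<Rightarrow> ennreal"
  proof -
    let ?I = "\<integral>\<^sup>+Y. f Y \<partial>lborel"
    have le: "(\<integral>\<^sup>+Y. f Y * indicator A Y \<partial>lborel) \<le> ?I" for A
      by (intro nn_integral_mono) (auto simp: indicator_def)
    have 1: "(\<integral>\<^sup>+X. f (stretch X) * indicator (- ball 0 r) X \<partial>lborel) \<le> ?I"
      by (intro nn_integral_mono) (auto simp: indicator_def stretch_outside)
    have "ennreal d * (\<integral>\<^sup>+X. f (stretch X) * indicator (ball 0 r) X \<partial>lborel) =
        (\<integral>\<^sup>+X. ennreal d * (f (stretch X) * indicator (ball 0 r) X) \<partial>lborel)"
      by (intro nn_integral_cmult[symmetric]) simp
    also have "\<dots> \<le> (\<integral>\<^sup>+X. ennreal (factor (norm X) powr (?n - q)) * f (stretch X) * indicator (ball 0 r) X \<partial>lborel)"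
      unfolding mult.assoc by (intro nn_integral_mono mult_right_mono ennreal_leI d_le) simp
    also have "\<dots> \<le> ennreal ((t / a) powr q) * ?I + ennreal slope * ?I"
      unfolding nn_integral_stretch[OF that] by (intro add_mono mult_left_mono le) auto
    also have "\<dots> = ennreal ((t / a) powr q + slope) * ?I"
      by (subst ennreal_plus) (auto simp: distrib_right)
    finally have "ennreal (1 / d) * (ennreal d * (\<integral>\<^sup>+X. f (stretch X) * indicator (ball 0 r) X \<partial>lborel)) \<le>
        ennreal (1 / d) * (ennreal ((t / a) powr q + slope) * ?I)"
      by (rule mult_left_mono) simp
    then have 2: "(\<integral>\<^sup>+X. f (stretch X) * indicator (ball 0 r) X \<partial>lborel) \<le>
        ennreal (((t / a) powr q + slope) / d) * ?I"
    proof -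
      have "ennreal (1 / d) * (ennreal A * J) = ennreal (A / d) * J" if "0 \<le> A" for A J
        using d that by (simp add: mult.assoc[symmetric] ennreal_mult'[symmetric])
      moreover have "ennreal (1 / d) * (ennreal d * J) = J" for J
        using d by (simp add: mult.assoc[symmetric] ennreal_mult'[symmetric])
      ultimately show ?thesis
        using \<open>ennreal (1 / d) * _ \<le> _\<close> by (simp del: ennreal_plus)
    qed
    have "(\<integral>\<^sup>+X. f (stretch X) \<partial>lborel) =
      (\<integral>\<^sup>+X. f (stretch X) * indicator (- ball 0 r) X + f (stretch X) * indicator (ball 0 r) X \<partial>lborel)"
      by (intro nn_integral_cong) (auto simp: indicator_def)
    also have "\<dots> = (\<integral>\<^sup>+X. f (stretch X) * indicator (- ball 0 r) X \<partial>lborel) +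
        (\<integral>\<^sup>+X. f (stretch X) * indicator (ball 0 r) X \<partial>lborel)"
      by (intro nn_integral_add) auto
    also have "\<dots> \<le> ?I + ennreal (((t / a) powr q + slope) / d) * ?I"
      using 1 2 by (rule add_mono)
    also have "\<dots> = ennreal C * ?I"
      using d by (simp add: C_def distrib_right)
    finally show ?thesis .
  qed
  moreover have "0 \<le> C" using d by (simp add: C_def)
  ultimately show thesis by (rule that[rotated])
qed

text \<open>The derivative multiplies tangential directions by the factor and the radial one by
  \<open>1 + c\<close> times the factor; the bounds on \<open>c\<close> say that the radial
  stretching never exceeds the tangential one. The two excluded spheres are where the factor changes
  its formula.\<close>

lemma has_derivative_stretch:
  fixes X :: "'b::euclidean_space"
  assumes "norm X \<noteq> t" "norm X \<noteq> r"
  obtains c where "-1 \<le> c" "c \<le> 0"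
    "(stretch has_derivative (\<lambda>Y. factor (norm X) *\<^sub>R (Y + (c * (sgn X \<bullet> Y)) *\<^sub>R sgn X))) (at X)"
proof -
  note result = that
  have const: thesis if op: "open W" and X: "X \<in> W" and eq: "\<And>Y. Y \<in> W \<Longrightarrow> factor (norm Y) = factor (norm X)" for W
  proof (rule result[of 0])
    have "((\<lambda>Y. factor (norm X) *\<^sub>R Y) has_derivative (\<lambda>Y. factor (norm X) *\<^sub>R Y)) (at X)"
      by (auto intro!: derivative_eq_intros)
    then have "(stretch has_derivative (\<lambda>Y. factor (norm X) *\<^sub>R Y)) (at X)"
      by (rule has_derivative_transform_within_open[OF _ op X]) (simp add: stretch_def eq)
    then show "(stretch has_derivative (\<lambda>Y. factor (norm X) *\<^sub>R (Y + (0 * (sgn X \<bullet> Y)) *\<^sub>R sgn X))) (at X)"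
      by simp
  qed auto
  consider "norm X < t" | "r < norm X" | "t < norm X" "norm X < r"
    using assms by linarith
  then show thesis
  proof cases
    case 1
    show ?thesis
      by (rule const[of "ball 0 t"]) (use 1 in \<open>auto simp: factor_le_t\<close>)
  next
    case 2
    show ?thesis
      by (rule const[of "- cball 0 r"]) (use 2 in \<open>auto simp: factor_ge_r\<close>)
  next
    case 3
    let ?x = "norm X"
    have x: "0 < ?x" using 3(1) t_pos by linarith
    define b where "b = shift * ?x powr (-q)"
    define c where "c = - (b / (1 + b))"
    have b: "0 \<le> b" by (simp add: b_def)
    have c: "-1 \<le> c" "c \<le> 0" using b by (auto simp: c_def field_simps)
    have pd: "profile_deriv ?x = c * (profile ?x / ?x)"
      by (simp add: profile_deriv_def c_def b_def)
    have dn: "(norm has_derivative (\<lambda>Y. sgn X \<bullet> Y)) (at X)"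
      using x by (intro has_derivative_eq_rhs[OF has_derivative_norm]) (auto simp: inner_commute)
    have "((\<lambda>Y. profile (norm Y)) has_derivative (\<lambda>Y. profile_deriv ?x * (sgn X \<bullet> Y))) (at X)"
      using has_derivative_compose[OF dn has_real_derivative_profile[OF x, unfolded has_field_derivative_def]] .
    then have "((\<lambda>Y. profile (norm Y) *\<^sub>R Y) has_derivative
        (\<lambda>Y. profile ?x *\<^sub>R Y + (profile_deriv ?x * (sgn X \<bullet> Y)) *\<^sub>R X)) (at X)"
      by (intro has_derivative_scaleR) auto
    then have "(stretch has_derivative
        (\<lambda>Y. profile ?x *\<^sub>R Y + (profile_deriv ?x * (sgn X \<bullet> Y)) *\<^sub>R X)) (at X)"
      by (rule has_derivative_transform_within_open[where s="ball 0 r - cball 0 t"])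
         (use 3 in \<open>auto simp: stretch_def factor_between\<close>)
    moreover have "(profile_deriv ?x * (sgn X \<bullet> Y)) *\<^sub>R X = (profile ?x * (c * (sgn X \<bullet> Y))) *\<^sub>R sgn X" for Y
      using x by (simp add: pd sgn_div_norm divide_inverse ac_simps)
    ultimately have "(stretch has_derivative
        (\<lambda>Y. factor ?x *\<^sub>R (Y + (c * (sgn X \<bullet> Y)) *\<^sub>R sgn X))) (at X)"
      using 3 by (simp add: factor_between scaleR_add_right)
    with c show ?thesis by (rule that)
  qed
qed

end

section \<open>The Poisson extension\<close>

lemma nn_integral_lborel_reflect:
  fixes f :: "'b::euclidean_space \<Rightarrow> ennreal"
  assumes [measurable]: "f \<in> borel_measurable borel"
  shows "(\<integral>\<^sup>+y. f (x - y) \<partial>lborel) = (\<integral>\<^sup>+y. f y \<partial>lborel)"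
  by (subst (2) lborel_affine[of "-1" x])
     (simp_all add: nn_integral_density nn_integral_distr nn_integral_cmult)

lemma nn_integral_inverse_powr_atLeast:
  assumes "0 < s"
  shows "(\<integral>\<^sup>+t. ennreal (t powr (-1 - s)) * indicator {1..} t \<partial>lborel) = ennreal (1 / s)"
proof -
  have "(\<integral>\<^sup>+t. ennreal (t powr (-1 - s)) * indicator {1..} t \<partial>lborel) = ennreal (0 - (- (1 powr (-s) / s)))"
  proof (rule nn_integral_FTC_atLeast)
    show "((\<lambda>t. - (t powr (-s) / s)) has_real_derivative t powr (-1 - s)) (at t)" if "1 \<le> t" for t :: real
      using that assms by (auto intro!: derivative_eq_intros simp: minus_diff_commute)
    have "((\<lambda>t. t powr (-s)) \<longlongrightarrow> 0) at_top"
      using assms by (intro tendsto_neg_powr filterlim_ident) auto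
    then show "((\<lambda>t. - (t powr (-s) / s)) \<longlongrightarrow> 0) at_top"
      using tendsto_minus[OF tendsto_divide[OF _ tendsto_const[of s]]] assms by force
  qed auto
  then show ?thesis by simp
qed

text \<open>In polar coordinates the radial density is, up to the dimension, at most 1 for all radii
  and at most \<open>x powr (-1 - s)\<close> beyond radius 1.\<close>

lemma nn_integral_bracket_finite:
  assumes "0 < s"
  shows "(\<integral>\<^sup>+x. ennreal (1 / (1 + norm (x::'a::euclidean_space) ^ 2) powr ((real DIM('a) + s) / 2)) \<partial>lborel) < \<infinity>"
proof -
  let ?n = "DIM('a)" and ?p = "(real DIM('a) + s) / 2"
  let ?w = "\<lambda>x. ennreal (real ?n * x ^ (?n - 1)) * indicator {0<..} x"
  interpret S: finite_measure "sphere_measure :: 'a measure"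
    by (rule finite_measure_sphere_measure)
  have bound: "x ^ (?n - 1) * (1 / (1 + x\<^sup>2) powr ?p) \<le> (1 + x\<^sup>2) powr (- (1 + s) / 2)" if "0 < x" for x :: real
  proof -
    have e: "real (?n - 1) = real ?n - 1" using DIM_positive[where 'a='a] by linarith
    have "x ^ (?n - 1) = (x\<^sup>2) powr (real (?n - 1) / 2)"
      using that by (simp only: powr_realpow[symmetric] powr_numeral[symmetric] powr_powr)
        (rule arg_cong[where f="\<lambda>e. x powr e"], linarith)
    also have "\<dots> \<le> (1 + x\<^sup>2) powr (real (?n - 1) / 2)"
      by (intro powr_mono2) auto
    finally have "x ^ (?n - 1) * (1 / (1 + x\<^sup>2) powr ?p) \<le> (1 + x\<^sup>2) powr (real (?n - 1) / 2) * (1 / (1 + x\<^sup>2) powr ?p)"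
      by (intro mult_right_mono) auto
    also have "\<dots> = (1 + x\<^sup>2) powr (real (?n - 1) / 2 - ?p)"
      by (simp add: powr_diff)
    also have "real (?n - 1) / 2 - ?p = - (1 + s) / 2"
      unfolding e by (simp add: field_simps)
    finally show ?thesis .
  qed
  have bound2: "x ^ (?n - 1) * (1 / (1 + x\<^sup>2) powr ?p) \<le> x powr (-1 - s)" if "1 \<le> x" for x :: real
  proof -
    have "(1 + x\<^sup>2) powr (- (1 + s) / 2) \<le> (x\<^sup>2) powr (- (1 + s) / 2)"
      using that assms by (intro powr_mono2') auto
    also have "\<dots> = x powr (-1 - s)"
    proof -
      have "2 * (- (1 + s) / 2) = -1 - s" by (simp add: field_simps)
      moreover have "x\<^sup>2 = x powr 2" using that by (simp flip: powr_numeral)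
      ultimately show ?thesis by (simp only: powr_powr)
    qed
    finally show ?thesis using bound[of x] that by linarith
  qed
  have bound1: "x ^ (?n - 1) * (1 / (1 + x\<^sup>2) powr ?p) \<le> 1" if "0 < x" for x :: real
  proof -
    have "(1 + x\<^sup>2) powr (- (1 + s) / 2) \<le> (1 + x\<^sup>2) powr 0"
      using that assms by (intro powr_mono) auto
    moreover have "1 + x\<^sup>2 \<noteq> 0" using that by (smt (verit) zero_le_power2)
    ultimately have "(1 + x\<^sup>2) powr (- (1 + s) / 2) \<le> 1" by simp
    then show ?thesis using bound[OF that] by linarith
  qed
  have inner: "(\<integral>\<^sup>+x. ?w x * ennreal (1 / (1 + norm (x *\<^sub>R \<theta>) ^ 2) powr ?p) \<partial>lborel) \<le> ennreal (real ?n * (1 + 1 / s))"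
    if \<theta>: "norm \<theta> = 1" for \<theta> :: 'a
  proof -
    have "(\<integral>\<^sup>+x. ?w x * ennreal (1 / (1 + norm (x *\<^sub>R \<theta>) ^ 2) powr ?p) \<partial>lborel) \<le>
      (\<integral>\<^sup>+x. ennreal (real ?n) * (indicator {0..1} x + ennreal (x powr (-1 - s)) * indicator {1..} x) \<partial>lborel)"
    proof (rule nn_integral_mono)
      fix x :: real
      show "?w x * ennreal (1 / (1 + norm (x *\<^sub>R \<theta>) ^ 2) powr ?p) \<le>
        ennreal (real ?n) * (indicator {0..1} x + ennreal (x powr (-1 - s)) * indicator {1..} x)"
      proof (cases "0 < x")
        case True
        then have eq: "?w x * ennreal (1 / (1 + norm (x *\<^sub>R \<theta>) ^ 2) powr ?p) =
            ennreal (real ?n) * ennreal (x ^ (?n - 1) * (1 / (1 + x\<^sup>2) powr ?p))"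
          using \<theta> by (simp add: ennreal_mult'[symmetric] mult.assoc)
        have "ennreal (x ^ (?n - 1) * (1 / (1 + x\<^sup>2) powr ?p)) \<le>
            indicator {0..1} x + ennreal (x powr (-1 - s)) * indicator {1..} x"
        proof (cases "x \<le> 1")
          case le: True
          then have "ennreal (x ^ (?n - 1) * (1 / (1 + x\<^sup>2) powr ?p)) \<le> indicator {0..1} x"
            using bound1[OF True] True by (simp add: ennreal_le_1)
          then show ?thesis by (simp add: add_increasing2)
        next
          case False
          then show ?thesis using bound2[of x] by (simp add: ennreal_leI)
        qed
        then show ?thesis unfolding eq by (rule mult_left_mono) simp
      qed simp
    qed
    also have "\<dots> = ennreal (real ?n) * (1 + ennreal (1 / s))"
      using nn_integral_inverse_powr_atLeast[OF assms]
      by (simp add: nn_integral_cmult nn_integral_add)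
    also have "\<dots> = ennreal (real ?n * (1 + 1 / s))"
      using assms by (simp add: ennreal_mult')
    finally show ?thesis .
  qed
  have "(\<integral>\<^sup>+x. ennreal (1 / (1 + norm (x::'a) ^ 2) powr ?p) \<partial>lborel) \<le>
      (\<integral>\<^sup>+\<theta>. ennreal (real ?n * (1 + 1 / s)) \<partial>(sphere_measure :: 'a measure))"
    using AE_sphere_measure_norm[where 'b='a]
    by (subst nn_integral_polar, simp, intro nn_integral_mono_AE) (rule eventually_mono, assumption, rule inner)
  also have "\<dots> < \<infinity>"
    using S.emeasure_finite[of "space sphere_measure"]
    by (simp add: ennreal_mult_eq_top_iff less_top[symmetric])
  finally show ?thesis .
qed

text \<open>A divergent Bochner integral would have the value 0, and so would its inverse.
  Finiteness is therefore what turns the normalising constant into a genuine one and gives the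
  kernel mass 1.\<close>

lemma poisson_const_pos:
  assumes "0 < s"
  shows "0 < poisson_const TYPE('a::euclidean_space) s"
    and "(\<integral>\<^sup>+x. ennreal (1 / (1 + norm (x::'a) ^ 2) powr ((real DIM('a) + s) / 2)) \<partial>lborel) =
      ennreal (1 / poisson_const TYPE('a) s)"
proof -
  let ?f = "\<lambda>x::'a. 1 / (1 + norm x ^ 2) powr ((real DIM('a) + s) / 2)"
  have int: "integrable lborel ?f"
    using nn_integral_bracket_finite[OF assms, where 'a='a] by (simp add: integrable_iff_bounded)
  have I: "integral\<^sup>L lborel ?f = 1 / poisson_const TYPE('a) s"
    by (simp add: poisson_const_def integral_completion inverse_eq_divide)
  have eq: "(\<integral>\<^sup>+x. ennreal (?f x) \<partial>lborel) = ennreal (integral\<^sup>L lborel ?f)"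
    using int by (intro nn_integral_eq_integral) auto
  have "0 < integral\<^sup>L lborel ?f"
  proof (rule ccontr)
    assume "\<not> ?thesis"
    with eq have "(\<integral>\<^sup>+x. ennreal (?f x) \<partial>lborel) = 0" by (simp add: ennreal_neg)
    then have "AE x in lborel. ennreal (?f x) = 0" by (subst (asm) nn_integral_0_iff_AE) auto
    moreover have "ennreal (?f x) \<noteq> 0" for x
    proof -
      have "1 + norm x ^ 2 \<noteq> 0" by (smt (verit) zero_le_power2)
      then show ?thesis by (simp add: ennreal_eq_0_iff not_le)
    qed
    ultimately have "AE x in (lborel :: 'a measure). False" by simp
    then show False by (simp add: AE_iff_null null_sets_def)
  qed
  then show "0 < poisson_const TYPE('a) s" using I by simp
  show "(\<integral>\<^sup>+x. ennreal (?f x) \<partial>lborel) = ennreal (1 / poisson_const TYPE('a) s)"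
    using eq I by simp
qed

section \<open>Scaling, mass and gradient of the Poisson kernel\<close>

lemma poisson_kernel_nonneg: "0 < s \<Longrightarrow> 0 \<le> poisson_kernel s (x::'a::euclidean_space) z"
  using poisson_const_pos(1)[of s, where 'a='a] by (simp add: poisson_kernel_def)

lemma borel_measurable_poisson_kernel [measurable (raw)]:
  assumes [measurable]: "f \<in> M \<rightarrow>\<^sub>M borel" "g \<in> M \<rightarrow>\<^sub>M borel"
  shows "(\<lambda>x. poisson_kernel s (f x :: 'a::euclidean_space) (g x)) \<in> borel_measurable M"
  unfolding poisson_kernel_def by measurable

text \<open>The kernel is homogeneous of degree \<open>- DIM('a)\<close> in both variables together,
  so every height reduces to height 1.\<close>

lemma poisson_kernel_scale:
  assumes "0 < z"
  shows "z ^ DIM('a) * poisson_kernel s (z *\<^sub>R x) z = poisson_kernel s (x::'a::euclidean_space) 1"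
proof -
  let ?p = "(real DIM('a) + s) / 2"
  have "norm (z *\<^sub>R x) ^ 2 + z ^ 2 = z\<^sup>2 * (norm x ^ 2 + 1)"
    using assms by (simp add: power_mult_distrib algebra_simps)
  moreover have "(z\<^sup>2 * (norm x ^ 2 + 1)) powr ?p = z powr (real DIM('a) + s) * (norm x ^ 2 + 1) powr ?p"
  proof -
    have "(z\<^sup>2) powr ?p = z powr (real DIM('a) + s)"
    proof -
      have "2 * ?p = real DIM('a) + s" by (simp add: field_simps)
      moreover have "z\<^sup>2 = z powr 2" using assms by (simp flip: powr_numeral)
      ultimately show ?thesis by (simp only: powr_powr)
    qed
    then show ?thesis by (simp add: powr_mult add_nonneg_nonneg)
  qed
  moreover have "z powr (real DIM('a) + s) = z ^ DIM('a) * z powr s"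
    using assms by (simp add: powr_add powr_realpow)
  ultimately show ?thesis
    using assms by (simp add: poisson_kernel_def)
qed

lemma nn_integral_poisson_kernel_origin:
  assumes "0 < s" "0 < z"
  shows "(\<integral>\<^sup>+y. ennreal (poisson_kernel s (y::'a::euclidean_space) z) \<partial>lborel) = 1"
proof -
  have "(\<integral>\<^sup>+y. ennreal (poisson_kernel s (y::'a) z) \<partial>lborel) =
      ennreal (z ^ DIM('a)) * (\<integral>\<^sup>+y. ennreal (poisson_kernel s (z *\<^sub>R (y::'a)) z) \<partial>lborel)"
    using assms by (intro nn_integral_lborel_scale) auto
  also have "\<dots> = (\<integral>\<^sup>+y. ennreal (z ^ DIM('a) * poisson_kernel s (z *\<^sub>R (y::'a)) z) \<partial>lborel)"
    using assms by (simp add: nn_integral_cmult ennreal_mult')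
  also have "\<dots> = (\<integral>\<^sup>+y. ennreal (poisson_const TYPE('a) s) *
      ennreal (1 / (1 + norm (y::'a) ^ 2) powr ((real DIM('a) + s) / 2)) \<partial>lborel)"
    unfolding poisson_kernel_scale[OF assms(2)]
    using poisson_const_pos(1)[OF assms(1), where 'a='a]
    by (intro nn_integral_cong) (simp add: poisson_kernel_def ennreal_mult'[symmetric] add.commute)
  also have "\<dots> = ennreal (poisson_const TYPE('a) s) * ennreal (1 / poisson_const TYPE('a) s)"
    using poisson_const_pos(2)[OF assms(1), where 'a='a] by (simp add: nn_integral_cmult)
  also have "\<dots> = 1"
    using poisson_const_pos(1)[OF assms(1), where 'a='a] by (simp add: ennreal_mult'[symmetric])
  finally show ?thesis .
qed

lemma nn_integral_poisson_kernel:
  assumes "0 < s" "0 < z"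
  shows "(\<integral>\<^sup>+y. ennreal (poisson_kernel s (x - y :: 'a::euclidean_space) z) \<partial>lborel) = 1"
  using nn_integral_lborel_reflect[of "\<lambda>y. ennreal (poisson_kernel s (y :: 'a) z)" x]
    nn_integral_poisson_kernel_origin[OF assms, where 'a='a] by simp

lemma poisson_kernel_integrable:
  assumes "0 < s" "0 < z"
  shows "integrable lborel (\<lambda>y. poisson_kernel s (x - y :: 'a::euclidean_space) z)"
    and "(LINT y|lborel. poisson_kernel s (x - y :: 'a) z) = 1"
proof -
  have "has_bochner_integral lborel (\<lambda>y. poisson_kernel s (x - y :: 'a) z) 1"
    using nn_integral_poisson_kernel[OF assms, of x] poisson_kernel_nonneg[OF assms(1)]
    by (intro has_bochner_integral_nn_integral) auto
  then show "integrable lborel (\<lambda>y. poisson_kernel s (x - y :: 'a) z)"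
    "(LINT y|lborel. poisson_kernel s (x - y :: 'a) z) = 1"
    by (auto simp: has_bochner_integral_iff)
qed

text \<open>Kept as the kernel times its logarithmic gradient: the bracket is of size
  \<open>1 / snd X\<close> uniformly in \<open>y\<close>, so bounds on the gradient integrate to
  bounds by the mass of the kernel.\<close>

definition poisson_gradient :: "real \<Rightarrow> 'a::euclidean_space \<times> real \<Rightarrow> 'a \<Rightarrow> 'a \<times> real" where
  "poisson_gradient s X y = poisson_kernel s (fst X - y) (snd X) *\<^sub>R
     ((s / snd X) *\<^sub>R (0, 1) -
      ((real DIM('a) + s) / (norm (fst X - y) ^ 2 + snd X ^ 2)) *\<^sub>R (fst X - y, snd X))"

lemma GDERIV_poisson_kernel:
  fixes X :: "'a::euclidean_space \<times> real"
  assumes "0 < snd X"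
  shows "GDERIV (\<lambda>X. poisson_kernel s (fst X - y) (snd X)) X :> poisson_gradient s X y"
proof -
  define x where "x = fst X - y"
  define z where "z = snd X"
  define b where "b = norm x ^ 2 + z ^ 2"
  let ?p = "(real DIM('a) + s) / 2" and ?K = "poisson_const TYPE('a) s"
  have z: "0 < z" using assms by (simp add: z_def)
  then have b: "0 < b" by (simp add: b_def add_nonneg_pos)
  have "((\<lambda>X. snd X powr s) has_derivative (\<lambda>h. s * z powr (s - 1) * snd h)) (at X)"
  proof -
    have "((\<lambda>w. w powr s) has_derivative (\<lambda>h. s * z powr (s - 1) * h)) (at (snd X))"
      using has_real_derivative_powr[OF z, of s] by (simp add: has_field_derivative_def z_def)
    from has_derivative_compose[OF bounded_linear_imp_has_derivative[OF bounded_linear_snd] this]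
    show ?thesis .
  qed
  moreover have "((\<lambda>X. (norm (fst X - y) ^ 2 + snd X ^ 2) powr (- ?p)) has_derivative
      (\<lambda>h. - ?p * b powr (- ?p - 1) * (2 * ((x, z) \<bullet> h)))) (at X)"
  proof -
    have "((\<lambda>X. (fst X - y) \<bullet> (fst X - y) + snd X * snd X) has_derivative (\<lambda>h. 2 * ((x, z) \<bullet> h))) (at X)"
      by (auto intro!: derivative_eq_intros simp: x_def z_def inner_prod_def inner_commute)
    then have d: "((\<lambda>X. norm (fst X - y) ^ 2 + snd X ^ 2) has_derivative (\<lambda>h. 2 * ((x, z) \<bullet> h))) (at X)"
      by (simp add: power2_norm_eq_inner power2_eq_square[of "snd _"])
    have "((\<lambda>w. w powr (- ?p)) has_derivative (\<lambda>h. - ?p * b powr (- ?p - 1) * h)) (at (norm (fst X - y) ^ 2 + snd X ^ 2))"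
      using has_real_derivative_powr[OF b, of "- ?p"] unfolding has_field_derivative_def b_def x_def z_def .
    from has_derivative_compose[OF d this] show ?thesis .
  qed
  ultimately have deriv: "((\<lambda>X. ?K * (snd X powr s * (norm (fst X - y) ^ 2 + snd X ^ 2) powr (- ?p))) has_derivative
      (\<lambda>h. ?K * (z powr s * (- ?p * b powr (- ?p - 1) * (2 * ((x, z) \<bullet> h))) +
        (s * z powr (s - 1) * snd h) * b powr (- ?p)))) (at X)"
    by (intro has_derivative_mult_right[OF has_derivative_eq_rhs[OF has_derivative_mult]])
       (auto simp: z_def b_def x_def)
  have eq: "?K * (z powr s * (- ?p * b powr (- ?p - 1) * (2 * ((x, z) \<bullet> h))) +
        (s * z powr (s - 1) * snd h) * b powr (- ?p)) = h \<bullet> poisson_gradient s X y" for h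
  proof -
    have e: "z powr (s - 1) = z powr s / z" "b powr (- ?p - 1) = b powr (- ?p) / b"
      using z b by (auto simp: powr_diff)
    have k: "poisson_kernel s x z = ?K * (z powr s * b powr (- ?p))"
      by (simp add: poisson_kernel_def x_def z_def b_def powr_minus field_simps)
    have g: "h \<bullet> poisson_gradient s X y =
      ?K * (z powr s * b powr (- ?p)) * ((s / z) * snd h - ((real DIM('a) + s) / b) * ((x, z) \<bullet> h))"
    proof -
      have "h \<bullet> (0::'a, 1::real) = snd h" by (simp add: inner_prod_def)
      then show ?thesis
        unfolding poisson_gradient_def x_def[symmetric] z_def[symmetric] b_def[symmetric]
          inner_scaleR_right inner_diff_right inner_commute[of h "(x, z)"] k by simp
    qed
    have aux: "A * (V * (- p * (R / b) * (2 * i)) + s * (V / z) * w * R) =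
        A * (V * R) * ((s / z) * w - (2 * p / b) * i)" for A V R i w p b s z :: real
      by (simp add: divide_inverse right_diff_distrib distrib_left)
    have "2 * ?p = real DIM('a) + s" by simp
    then show ?thesis
      unfolding g e aux by (simp only:)
  qed
  have "(\<lambda>X. poisson_kernel s (fst X - y) (snd X)) =
      (\<lambda>X. ?K * (snd X powr s * (norm (fst X - y) ^ 2 + snd X ^ 2) powr (- ?p)))"
    by (simp add: fun_eq_iff poisson_kernel_def powr_minus field_simps)
  then show ?thesis
    unfolding gderiv_def by (simp only: deriv[unfolded eq])
qed

lemma norm_poisson_gradient_le:
  fixes X :: "'a::euclidean_space \<times> real"
  assumes "0 < s" "0 < snd X"
  shows "norm (poisson_gradient s X y) \<le> (real DIM('a) + 2 * s) / snd X * poisson_kernel s (fst X - y) (snd X)"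
proof -
  let ?z = "snd X" and ?\<rho> = "norm (fst X - y, snd X)" and ?N = "real DIM('a) + s"
  have z: "?z \<le> ?\<rho>" by (simp add: norm_Pair real_le_rsqrt)
  then have \<rho>: "0 < ?\<rho>" using assms by linarith
  have \<rho>2: "norm (fst X - y) ^ 2 + ?z ^ 2 = ?\<rho> ^ 2"
    by (simp add: norm_Pair)
  have tri: "norm (c *\<^sub>R e - d *\<^sub>R w) \<le> \<bar>c\<bar> * norm e + \<bar>d\<bar> * norm w" for c d and e w :: "'a \<times> real"
    using norm_triangle_ineq4[of "c *\<^sub>R e" "d *\<^sub>R w"] by simp
  have "norm ((s / ?z) *\<^sub>R (0::'a, 1::real) - (?N / ?\<rho> ^ 2) *\<^sub>R (fst X - y, ?z)) \<le> s / ?z + ?N / ?\<rho>"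
    using assms \<rho> by (intro order_trans[OF tri]) (simp add: power2_eq_square norm_Pair[of 0])
  also have "\<dots> \<le> s / ?z + ?N / ?z"
    using z \<rho> assms by (intro add_left_mono divide_left_mono mult_pos_pos) auto
  also have "\<dots> = (real DIM('a) + 2 * s) / ?z"
    by (simp add: add_divide_distrib)
  finally show ?thesis
    using poisson_kernel_nonneg[OF assms(1), of "fst X - y" ?z]
    unfolding poisson_gradient_def norm_scaleR \<rho>2
    by (subst mult.commute, intro mult_mono) (auto intro: divide_nonneg_pos)
qed

text \<open>This provides the dominating function for differentiating under the integral sign.\<close>

lemma poisson_kernel_ball_le:
  fixes X :: "'a::euclidean_space \<times> real"
  assumes "0 < s" "0 < snd X0" "dist X0 X < snd X0 / 2"
  shows "snd X0 / 2 < snd X"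
    and "poisson_kernel s (fst X - y) (snd X) \<le>
      2 powr s * 2 powr (real DIM('a) + s) * poisson_kernel s (fst X0 - y) (snd X0)"
proof -
  let ?z = "snd X" and ?zz = "snd X0" and ?N = "real DIM('a) + s"
  let ?\<rho> = "norm (fst X - y, snd X)" and ?\<sigma> = "norm (fst X0 - y, snd X0)"
  have "\<bar>?zz - ?z\<bar> < ?zz / 2"
    using dist_snd_le[of X0 X] assms(3) by (simp add: dist_real_def)
  then show z: "?zz / 2 < ?z" by linarith
  have z2: "?z \<le> 2 * ?zz" using \<open>\<bar>?zz - ?z\<bar> < ?zz / 2\<close> assms(2) by linarith
  have zr: "?z \<le> ?\<rho>" by (simp add: norm_Pair real_le_rsqrt)
  have "(fst X0 - y, snd X0) = (fst X - y, snd X) + (X0 - X)"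
    by (simp add: prod_eq_iff)
  then have "?\<sigma> \<le> ?\<rho> + dist X0 X"
    using norm_triangle_ineq[of "(fst X - y, snd X)" "X0 - X"] by (simp add: dist_norm)
  \<comment> \<open>The shift is less than \<open>snd X0 / 2\<close>, which is less than
    \<open>snd X\<close> and hence than \<open>?\<rho>\<close>. This and
    \<open>snd X \<le> 2 * snd X0\<close> account for the two powers of 2 in the constant.\<close>
  then have \<rho>: "?\<sigma> \<le> 2 * ?\<rho>" using assms(3) z zr by linarith
  have \<rho>0: "0 < ?\<sigma>" using assms(2) by (simp add: zero_prod_def)
  have e: "(norm x ^ 2 + w ^ 2) powr (?N / 2) = norm (x, w) powr ?N" for x :: 'a and w :: real
  proof -
    have "norm x ^ 2 + w ^ 2 = norm (x, w) powr 2"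
      by (cases "norm (x, w) = 0") (auto simp: norm_Pair)
    moreover have "2 * (?N / 2) = ?N" by simp
    ultimately show ?thesis by (simp only: powr_powr)
  qed
  have "?z powr s / ?\<rho> powr ?N \<le> (2 powr s * ?zz powr s) / (?\<sigma> / 2) powr ?N"
  proof (rule frac_le)
    show "?z powr s \<le> 2 powr s * ?zz powr s"
      using z2 z assms by (simp add: powr_mult[symmetric] powr_mono2)
    show "(?\<sigma> / 2) powr ?N \<le> ?\<rho> powr ?N"
      using \<rho> assms by (intro powr_mono2) auto
    show "0 < (?\<sigma> / 2) powr ?N" using \<rho>0 by simp
  qed simp
  also have "\<dots> = 2 powr s * 2 powr ?N * (?zz powr s / ?\<sigma> powr ?N)"
    by (simp add: powr_divide field_simps)
  finally have "poisson_const TYPE('a) s * (?z powr s / ?\<rho> powr ?N) \<le>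
      poisson_const TYPE('a) s * (2 powr s * 2 powr ?N * (?zz powr s / ?\<sigma> powr ?N))"
    using poisson_const_pos(1)[OF assms(1), where 'a='a] by (intro mult_left_mono) auto
  then show "poisson_kernel s (fst X - y) (snd X) \<le>
      2 powr s * 2 powr ?N * poisson_kernel s (fst X0 - y) (snd X0)"
    by (simp only: poisson_kernel_def e mult.assoc mult.left_commute)
qed

text \<open>Dominated convergence for the normalised first-order remainders. Their majorant is
  \<open>2 * B\<close>: once for the increment, by the mean value inequality on the convex ball, and
  once for the linear term.\<close>

lemma GDERIV_integral:
  fixes f :: "'b::euclidean_space \<Rightarrow> 'c \<Rightarrow> real"
  assumes "0 < d"
    and deriv: "\<And>X y. X \<in> ball X0 d \<Longrightarrow> GDERIV (\<lambda>X. f X y) X :> D X y"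
    and bound: "\<And>X y. X \<in> ball X0 d \<Longrightarrow> norm (D X y) \<le> B y"
    and B: "integrable M B"
    and f: "\<And>X. X \<in> ball X0 d \<Longrightarrow> integrable M (f X)"
    and D [measurable]: "D X0 \<in> borel_measurable M"
  shows "GDERIV (\<lambda>X. \<integral>y. f X y \<partial>M) X0 :> (\<integral>y. D X0 y \<partial>M)"
proof -
  have X0: "X0 \<in> ball X0 d" using assms(1) by simp
  have intD: "integrable M (D X0)"
    by (rule Bochner_Integration.integrable_bound[OF B D], rule AE_I2, rule order_trans[OF bound[OF X0]]) simp
  have lip: "\<bar>f X y - f X0 y\<bar> \<le> B y * norm (X - X0)" if "X \<in> ball X0 d" for X y
  proof -
    have "norm (f X y - f X0 y) \<le> B y * norm (X - X0)"
    proof (rule differentiable_bound[OF convex_ball])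
      show "((\<lambda>X. f X y) has_derivative (\<lambda>h. h \<bullet> D Z y)) (at Z within ball X0 d)" if "Z \<in> ball X0 d" for Z
        using deriv[OF that] by (simp add: gderiv_def has_derivative_at_withinI)
      show "onorm (\<lambda>h. h \<bullet> D Z y) \<le> B y" if "Z \<in> ball X0 d" for Z
      proof (rule onorm_le)
        fix h
        have "\<bar>h \<bullet> D Z y\<bar> \<le> norm h * B y"
          using bound[OF that, of y] by (intro order_trans[OF Cauchy_Schwarz_ineq2] mult_left_mono) auto
        then show "norm (h \<bullet> D Z y) \<le> B y * norm h" by (simp add: mult.commute)
      qed
    qed (use that X0 in auto)
    then show ?thesis by simp
  qed
  let ?F = "\<lambda>X. \<integral>y. f X y \<partial>M" and ?G = "\<integral>y. D X0 y \<partial>M"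
  let ?q = "\<lambda>X y. (f X y - f X0 y - (X - X0) \<bullet> D X0 y) / norm (X - X0)"
  have "((\<lambda>X. (?F X - ?F X0 - (X - X0) \<bullet> ?G) / norm (X - X0)) \<longlongrightarrow> 0) (at X0 within ball X0 d)"
    unfolding tendsto_at_iff_sequentially o_def
  proof (intro allI impI)
    fix S assume S: "\<forall>i. S i \<in> ball X0 d - {X0}" and lim: "S \<longlonglongrightarrow> X0"
    have "(\<lambda>i. \<integral>y. ?q (S i) y \<partial>M) \<longlonglongrightarrow> (\<integral>y. 0 \<partial>M)"
    proof (rule integral_dominated_convergence[where w="\<lambda>y. 2 * B y"])
      show "(\<lambda>y. ?q (S i) y) \<in> borel_measurable M" for i
        using S f[of "S i"] f[OF X0] by (auto intro!: borel_measurable_divide borel_measurable_diff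
          borel_measurable_inner dest: borel_measurable_integrable)
      show "AE y in M. (\<lambda>i. ?q (S i) y) \<longlonglongrightarrow> 0"
      proof (rule AE_I2)
        fix y
        have "((\<lambda>X. (f X y - f X0 y - (X - X0) \<bullet> D X0 y) / norm (X - X0)) \<longlongrightarrow> 0) (at X0)"
          using deriv[OF X0, of y] unfolding gderiv_def has_derivative_at_within
          by (simp add: divide_inverse mult.commute diff_diff_eq)
        then show "(\<lambda>i. ?q (S i) y) \<longlonglongrightarrow> 0"
          using S lim by (auto simp: tendsto_at_iff_sequentially o_def)
      qed
      show "AE y in M. norm (?q (S i) y) \<le> 2 * B y" for i
      proof (rule AE_I2)
        fix y
        have Si: "S i \<in> ball X0 d" and n: "0 < norm (S i - X0)" using S by auto
        have "\<bar>(S i - X0) \<bullet> D X0 y\<bar> \<le> norm (S i - X0) * B y"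
          using bound[OF X0, of y] by (intro order_trans[OF Cauchy_Schwarz_ineq2] mult_left_mono) auto
        moreover note lip[OF Si, of y]
        ultimately have "\<bar>f (S i) y - f X0 y - (S i - X0) \<bullet> D X0 y\<bar> \<le> 2 * B y * norm (S i - X0)"
          by (simp only: mult.commute[of "norm _"] mult.assoc)
        then show "norm (?q (S i) y) \<le> 2 * B y"
          using n by (simp add: divide_le_eq)
      qed
    qed (use B in auto)
    moreover have eq: "(\<integral>y. ?q (S i) y \<partial>M) = (?F (S i) - ?F X0 - (S i - X0) \<bullet> ?G) / norm (S i - X0)" for i
      using S f[of "S i"] f[OF X0] intD by simp
    ultimately show "(\<lambda>i. (?F (S i) - ?F X0 - (S i - X0) \<bullet> ?G) / norm (S i - X0)) \<longlonglongrightarrow> 0"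
      by (simp only: eq Bochner_Integration.integral_zero)
  qed
  then show ?thesis
    using X0 at_within_open[OF X0 open_ball] unfolding gderiv_def has_derivative_at_within
    by (simp add: divide_inverse mult.commute diff_diff_eq bounded_linear_inner_left)
qed

section \<open>Regularity of the extension of a bounded datum\<close>

lemma gradient_eq: "GDERIV f X :> D \<Longrightarrow> gradient f X = D"
proof -
  assume D: "GDERIV f X :> D"
  show ?thesis
    unfolding gradient_def
  proof (rule the_equality)
    show "GDERIV f X :> D" by (rule D)
    fix D' assume "GDERIV f X :> D'"
    with D have "(\<lambda>h. h \<bullet> D') = (\<lambda>h. h \<bullet> D)"
      unfolding gderiv_def by (rule has_derivative_unique[rotated])
    then have "h \<bullet> (D' - D) = 0" for h by (simp add: inner_diff_right fun_eq_iff)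
    from this[of "D' - D"] show "D' = D" by simp
  qed
qed

text \<open>The datum is Borel so that integrands in several variables are measurable on Borel
  product spaces. A Lebesgue measurable set enters through a Borel representative.\<close>

locale bounded_datum =
  fixes s :: real and u :: "'a::euclidean_space \<Rightarrow> real"
  assumes s_pos: "0 < s" and u_borel [measurable]: "u \<in> borel_measurable borel" and u_le: "\<And>x. \<bar>u x\<bar> \<le> 1"
begin

lemma integrable_kernel_mult:
  assumes "0 < snd X"
  shows "integrable lborel (\<lambda>y. poisson_kernel s (fst X - y) (snd X) * u y)"
  using poisson_kernel_nonneg[OF s_pos] u_le
  by (intro Bochner_Integration.integrable_bound[OF poisson_kernel_integrable(1)[OF s_pos assms, of "fst X"]])
     (auto simp: abs_mult mult_left_le)

lemma extension_eq_lborel: "extension s u X = (LINT y|lborel. poisson_kernel s (fst X - y) (snd X) * u y)"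
  unfolding extension_def by (rule integral_completion) measurable

lemma borel_measurable_extension [measurable]: "extension s u \<in> borel_measurable borel"
proof -
  have "(\<lambda>X. LINT y|lborel. poisson_kernel s (fst X - y) (snd X) * u y) \<in> borel_measurable (borel \<Otimes>\<^sub>M borel)"
    by measurable
  then show ?thesis
    unfolding extension_eq_lborel[abs_def] by (simp add: borel_prod)
qed

definition ext_gradient :: "'a \<times> real \<Rightarrow> 'a \<times> real" where
  "ext_gradient X = (LINT y|lborel. u y *\<^sub>R poisson_gradient s X y)"

lemma borel_measurable_ext_gradient [measurable]: "ext_gradient \<in> borel_measurable borel"
proof -
  have "(\<lambda>X. LINT y|lborel. u y *\<^sub>R poisson_gradient s X y) \<in> borel_measurable (borel \<Otimes>\<^sub>M borel)"
    unfolding poisson_gradient_def by (measurable; simp add: borel_prod[symmetric])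
  then show ?thesis
    unfolding ext_gradient_def[abs_def] by (simp add: borel_prod)
qed

lemma GDERIV_extension:
  assumes X: "0 < snd X"
  shows "GDERIV (extension s u) X :> ext_gradient X"
proof -
  let ?N = "real DIM('a)"
  let ?C = "2 powr s * 2 powr (?N + s)"
  have Z: "0 < snd Z" "snd X / 2 < snd Z" if "Z \<in> ball X (snd X / 2)" for Z
    using poisson_kernel_ball_le(1)[OF s_pos X, of Z] that X by auto
  have "GDERIV (\<lambda>X. LINT y|lborel. poisson_kernel s (fst X - y) (snd X) * u y) X :>
      (LINT y|lborel. u y *\<^sub>R poisson_gradient s X y)"
  proof (rule GDERIV_integral[where d="snd X / 2" and
        B="\<lambda>y. (?N + 2 * s) / (snd X / 2) * (?C * poisson_kernel s (fst X - y) (snd X))"])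
    show "GDERIV (\<lambda>X. poisson_kernel s (fst X - y) (snd X) * u y) Z :> u y *\<^sub>R poisson_gradient s Z y"
      if "Z \<in> ball X (snd X / 2)" for Z y
      using GDERIV_poisson_kernel[OF Z(1)[OF that], of s y]
      by (auto simp: gderiv_def intro!: derivative_eq_intros)
    show "norm (u y *\<^sub>R poisson_gradient s Z y) \<le>
        (?N + 2 * s) / (snd X / 2) * (?C * poisson_kernel s (fst X - y) (snd X))"
      if "Z \<in> ball X (snd X / 2)" for Z y
    proof -
      have "norm (u y *\<^sub>R poisson_gradient s Z y) \<le> norm (poisson_gradient s Z y)"
        using u_le[of y] by (simp add: mult_left_le_one_le)
      also have "\<dots> \<le> (?N + 2 * s) / snd Z * poisson_kernel s (fst Z - y) (snd Z)"
        by (rule norm_poisson_gradient_le[OF s_pos Z(1)[OF that]])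
      also have "\<dots> \<le> (?N + 2 * s) / (snd X / 2) * (?C * poisson_kernel s (fst X - y) (snd X))"
        using that X s_pos Z[OF that] poisson_kernel_nonneg[OF s_pos]
        by (intro mult_mono divide_left_mono poisson_kernel_ball_le(2)) auto
      finally show ?thesis .
    qed
    show "integrable lborel (\<lambda>y. (?N + 2 * s) / (snd X / 2) * (?C * poisson_kernel s (fst X - y) (snd X)))"
      by (intro integrable_mult_right poisson_kernel_integrable(1) s_pos X)
    show "integrable lborel (\<lambda>y. poisson_kernel s (fst Z - y) (snd Z) * u y)" if "Z \<in> ball X (snd X / 2)" for Z
      using integrable_kernel_mult[OF Z(1)[OF that]] .
    show "(\<lambda>y. u y *\<^sub>R poisson_gradient s X y) \<in> borel_measurable lborel"
      unfolding poisson_gradient_def by measurable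
  qed (use X in auto)
  then show ?thesis
    unfolding extension_eq_lborel[abs_def] ext_gradient_def .
qed

lemma gradient_extension: "0 < snd X \<Longrightarrow> gradient (extension s u) X = ext_gradient X"
  by (rule gradient_eq[OF GDERIV_extension])

lemma norm_ext_gradient_le:
  assumes X: "0 < snd X"
  shows "norm (ext_gradient X) \<le> (real DIM('a) + 2 * s) / snd X"
proof -
  let ?C = "(real DIM('a) + 2 * s) / snd X"
  have "norm (ext_gradient X) \<le> (LINT y|lborel. ?C * poisson_kernel s (fst X - y) (snd X))"
    unfolding ext_gradient_def
  proof (rule Bochner_Integration.integral_norm_bound_integral)
    have m: "(\<lambda>y. u y *\<^sub>R poisson_gradient s X y) \<in> borel_measurable lborel"
      unfolding poisson_gradient_def by measurable
    show i: "integrable lborel (\<lambda>y. ?C * poisson_kernel s (fst X - y) (snd X))"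
      by (intro integrable_mult_right poisson_kernel_integrable(1) s_pos X)
    show le: "norm (u y *\<^sub>R poisson_gradient s X y) \<le> ?C * poisson_kernel s (fst X - y) (snd X)" for y
    proof -
      have "norm (u y *\<^sub>R poisson_gradient s X y) \<le> norm (poisson_gradient s X y)"
        using u_le[of y] by (simp add: mult_left_le_one_le)
      also note norm_poisson_gradient_le[OF s_pos X, of y]
      finally show ?thesis .
    qed
    show "integrable lborel (\<lambda>y. u y *\<^sub>R poisson_gradient s X y)"
      by (rule Bochner_Integration.integrable_bound[OF i m], rule AE_I2, rule order_trans[OF le])
         (metis abs_ge_self real_norm_def)
  qed
  then show ?thesis using poisson_kernel_integrable[OF s_pos X, of "fst X"] by simp
qed

text \<open>The gradient bound integrates over the convex region above height \<open>z0\<close>. The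
  constant degenerates as \<open>z0\<close> tends to 0, so Lipschitz continuity is available only
  above positive heights.\<close>

lemma extension_lipschitz:
  assumes "0 < z0"
  shows "((real DIM('a) + 2 * s) / z0)-lipschitz_on {X. z0 \<le> snd X} (extension s u)"
proof (rule bounded_derivative_imp_lipschitz)
  have "{X :: 'a \<times> real. z0 \<le> snd X} = UNIV \<times> {z0..}" by auto
  then show "convex {X :: 'a \<times> real. z0 \<le> snd X}" by (simp add: convex_Times)
  fix X :: "'a \<times> real" assume "X \<in> {X. z0 \<le> snd X}"
  then have X: "z0 \<le> snd X" "0 < snd X" using assms by auto
  show "(extension s u has_derivative (\<lambda>h. h \<bullet> ext_gradient X)) (at X within {X. z0 \<le> snd X})"
    using GDERIV_extension[OF X(2)] by (simp add: gderiv_def has_derivative_at_withinI)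
  have "norm (ext_gradient X) \<le> (real DIM('a) + 2 * s) / z0"
    using norm_ext_gradient_le[OF X(2)] X assms s_pos
    by (meson divide_left_mono add_nonneg_pos mult_pos_pos of_nat_0_le_iff order_trans less_imp_le zero_less_numeral)
  then have "norm (h \<bullet> ext_gradient X) \<le> (real DIM('a) + 2 * s) / z0 * norm h" for h
    using Cauchy_Schwarz_ineq2[of h "ext_gradient X"] mult_left_mono[OF _ norm_ge_zero[of h]]
    by (smt (verit) mult.commute real_norm_def)
  then show "onorm (\<lambda>h. h \<bullet> ext_gradient X) \<le> (real DIM('a) + 2 * s) / z0"
    by (rule onorm_le)
qed (use assms s_pos in auto)

end

section \<open>Weak gradients\<close>

text \<open>Sequences of difference quotients give measurability of gradients, their norm bounds and
  the limit in the integration by parts.\<close>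

lemma GDERIV_directional_limit:
  fixes f :: "'b::euclidean_space \<Rightarrow> real"
  assumes f: "GDERIV f X :> g" and h: "\<And>k. 0 < h k" "h \<longlonglongrightarrow> (0::real)"
  shows "(\<lambda>k. (f (X + h k *\<^sub>R e) - f X) / h k) \<longlonglongrightarrow> g \<bullet> e"
proof -
  have "((\<lambda>t. X + t *\<^sub>R e) has_derivative (\<lambda>t. t *\<^sub>R e)) (at 0)"
    by (auto intro!: derivative_eq_intros)
  from has_derivative_compose[OF this, of f "\<lambda>h. h \<bullet> g"] f
  have "((\<lambda>t. f (X + t *\<^sub>R e)) has_derivative (\<lambda>t. t *\<^sub>R e \<bullet> g)) (at 0)"
    by (simp add: gderiv_def)
  then have "((\<lambda>t. f (X + t *\<^sub>R e)) has_real_derivative (g \<bullet> e)) (at 0)"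
    by (simp add: has_field_derivative_def inner_commute mult_commute_abs)
  then have "((\<lambda>t. (f (X + t *\<^sub>R e) - f X) / t) \<longlongrightarrow> g \<bullet> e) (at 0)"
    by (simp add: DERIV_def)
  moreover have "filterlim h (at 0) sequentially"
    using h by (auto simp: filterlim_at less_imp_neq[symmetric] intro!: always_eventually)
  ultimately show ?thesis by (rule filterlim_compose)
qed

text \<open>Each component is a pointwise limit of difference quotients of the extension of
  \<open>f\<close> by zero, which is Borel on the whole space. The shifted point is eventually back
  in the open set \<open>W\<close>, so the extension does not affect the limit.\<close>

lemma borel_measurable_GDERIV:
  fixes f :: "'b::euclidean_space \<Rightarrow> real"
  assumes W: "open W" and f: "continuous_on W f" and N [measurable]: "N \<in> sets borel"
    and der: "\<And>X. X \<in> W - N \<Longrightarrow> GDERIV f X :> G X" and 0: "\<And>X. X \<notin> W - N \<Longrightarrow> G X = 0"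
  shows "G \<in> borel_measurable borel"
proof (rule borel_measurable_euclidean_space[THEN iffD2], rule ballI)
  fix e :: 'b assume "e \<in> Basis"
  have [measurable]: "W \<in> sets borel" using W by simp
  define f1 where "f1 X = indicator W X *\<^sub>R f X" for X
  have [measurable]: "f1 \<in> borel_measurable borel"
    unfolding f1_def[abs_def] by (rule borel_measurable_continuous_on_indicator[OF _ f]) simp
  define h where "h k = 1 / real (Suc k)" for k
  have h: "0 < h k" "h \<longlonglongrightarrow> 0" for k
    using LIMSEQ_inverse_real_of_nat by (auto simp: h_def[abs_def] inverse_eq_divide)
  let ?q = "\<lambda>k X. indicator (W - N) X * ((f1 (X + h k *\<^sub>R e) - f1 X) / h k)"
  show "(\<lambda>X. G X \<bullet> e) \<in> borel_measurable borel"
  proof (rule borel_measurable_LIMSEQ_real)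
    show "?q k \<in> borel_measurable borel" for k by measurable
    show "(\<lambda>k. ?q k X) \<longlonglongrightarrow> G X \<bullet> e" for X
    proof (cases "X \<in> W - N")
      case True
      have "(\<lambda>k. X + h k *\<^sub>R e) \<longlonglongrightarrow> X + 0 *\<^sub>R e"
        by (intro tendsto_intros h)
      then have "eventually (\<lambda>k. X + h k *\<^sub>R e \<in> W) sequentially"
        using W True by (intro topological_tendstoD) auto
      then have "eventually (\<lambda>k. (f (X + h k *\<^sub>R e) - f X) / h k = ?q k X) sequentially"
        by eventually_elim (use True in \<open>auto simp: f1_def\<close>)
      then show ?thesis
        using GDERIV_directional_limit[OF der[OF True] h] by (rule Lim_transform_eventually[rotated])
    qed (auto simp: 0)
  qed
qed

text \<open>The difference quotient is taken in the direction \<open>g\<close> itself, where its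
  limit is \<open>g \<bullet> g\<close>.\<close>

lemma norm_GDERIV_le:
  fixes f :: "'b::euclidean_space \<Rightarrow> real"
  assumes f: "GDERIV f X :> g" and W: "open W" "X \<in> W" and L: "L-lipschitz_on W f"
  shows "norm g \<le> L"
proof (cases "g = 0")
  case True
  then show ?thesis using lipschitz_on_nonneg[OF L] by simp
next
  case False
  define h where "h k = 1 / real (Suc k)" for k
  have h: "0 < h k" "h \<longlonglongrightarrow> 0" for k
    using LIMSEQ_inverse_real_of_nat by (auto simp: h_def[abs_def] inverse_eq_divide)
  have "(\<lambda>k. X + h k *\<^sub>R g) \<longlonglongrightarrow> X + 0 *\<^sub>R g"
    by (intro tendsto_intros h)
  then have "eventually (\<lambda>k. X + h k *\<^sub>R g \<in> W) sequentially"
    using W by (intro topological_tendstoD) auto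
  then have "eventually (\<lambda>k. (f (X + h k *\<^sub>R g) - f X) / h k \<le> L * norm g) sequentially"
  proof eventually_elim
    case (elim k)
    have "\<bar>f (X + h k *\<^sub>R g) - f X\<bar> \<le> L * (h k * norm g)"
      using lipschitz_onD[OF L elim W(2)] h(1)[of k] by (simp add: dist_norm)
    then show ?case using h(1)[of k] by (simp add: divide_le_eq algebra_simps)
  qed
  with GDERIV_directional_limit[OF f h] have "g \<bullet> g \<le> L * norm g"
    by (rule tendsto_upperbound) simp
  then show ?thesis
    using False by (simp add: dot_square_norm power2_eq_square)
qed

lemma integral_lborel_translate:
  fixes p :: "'b::euclidean_space \<Rightarrow> real"
  assumes "integrable lborel p"
  shows "integrable lborel (\<lambda>X. p (X + v))" "(LINT X|lborel. p (X + v)) = (LINT X|lborel. p X)"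
proof -
  have [measurable]: "p \<in> borel_measurable borel" using assms by auto
  have d: "distr lborel borel ((+) v) = (lborel :: 'b measure)" by (rule lborel_distr_plus)
  show "integrable lborel (\<lambda>X. p (X + v))"
    using assms by (subst (asm) d[symmetric], subst (asm) integrable_distr_eq) (auto simp: add.commute)
  show "(LINT X|lborel. p (X + v)) = (LINT X|lborel. p X)"
    by (subst (2) d[symmetric], subst integral_distr) (auto simp: add.commute)
qed

lemma compact_upper_half_space_bound:
  fixes K :: "('a::euclidean_space \<times> real) set"
  assumes "compact K" "K \<subseteq> upper_half_space"
  obtains z where "0 < z" "\<And>X. X \<in> K \<Longrightarrow> z \<le> snd X"
proof (cases "K = {}")
  case True
  then show ?thesis using that[of 1] by simp
next
  case False
  obtain X where "X \<in> K" "\<And>Y. Y \<in> K \<Longrightarrow> snd X \<le> snd Y"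
    using continuous_attains_inf[OF assms(1) False continuous_on_snd[OF continuous_on_id]] by auto
  with assms(2) show ?thesis by (intro that[of "snd X"]) (auto simp: upper_half_space_def)
qed

lemma open_upper_half_space: "open (upper_half_space :: ('a::euclidean_space \<times> real) set)"
proof -
  have "upper_half_space = (UNIV :: 'a set) \<times> {0<..}"
    by (auto simp: upper_half_space_def)
  show ?thesis unfolding \<open>upper_half_space = _\<close> by (intro open_Times) auto
qed

lemma upper_half_space_borel [measurable]: "(upper_half_space :: ('a::euclidean_space \<times> real) set) \<in> sets borel"
  by (intro borel_open open_upper_half_space)

lemma continuous_on_upper_half_space_lipschitz:
  fixes f :: "'a::euclidean_space \<times> real \<Rightarrow> real"
  assumes lip: "\<And>z. 0 < z \<Longrightarrow> \<exists>L. L-lipschitz_on {X. z \<le> snd X} f"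
  shows "continuous_on upper_half_space f"
proof (rule continuous_at_imp_continuous_on, rule ballI)
  fix X :: "'a \<times> real" assume "X \<in> upper_half_space"
  then have X: "0 < snd X" by (simp add: upper_half_space_def)
  then obtain L where "L-lipschitz_on {Y. snd X / 2 \<le> snd Y} f" using lip[of "snd X / 2"] by auto
  then have c: "continuous_on {Y. snd X / 2 \<le> snd Y} f" by (rule lipschitz_on_continuous_on)
  have "open ((UNIV :: 'a set) \<times> {snd X / 2<..})" by (simp add: open_Times)
  moreover have "continuous_on (UNIV \<times> {snd X / 2<..}) f" by (rule continuous_on_subset[OF c]) auto
  moreover have "X \<in> UNIV \<times> {snd X / 2<..}" using X by (simp add: mem_Times_iff)
  ultimately show "isCont f X" using continuous_on_eq_continuous_at by blast
qed

text \<open>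
  Difference quotients of \<open>f \<cdot> \<phi>\<close> integrate to zero by translation invariance and are dominated,
  so their a.e. limit, the derivative of the product, integrates to zero as well.
\<close>

lemma weak_gradient_on_upper_half_spaceI:
  fixes f :: "'a::euclidean_space \<times> real \<Rightarrow> real"
  assumes lip: "\<And>z. 0 < z \<Longrightarrow> \<exists>L. L-lipschitz_on {X. z \<le> snd X} f"
    and N: "N \<in> null_sets lborel"
    and der: "\<And>X. X \<in> upper_half_space - N \<Longrightarrow> GDERIV f X :> G X"
    and 0: "\<And>X. X \<notin> upper_half_space - N \<Longrightarrow> G X = 0"
  shows "weak_gradient_on upper_half_space f G"
proof -
  let ?W = "upper_half_space :: ('a \<times> real) set"
  have cont: "continuous_on ?W f"
    using lip by (rule continuous_on_upper_half_space_lipschitz)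
  have N_borel: "N \<in> sets borel" using N by (simp add: null_sets_def)
  have [measurable]: "G \<in> borel_measurable borel"
    by (rule borel_measurable_GDERIV[OF open_upper_half_space cont N_borel der 0])
  have G_le: "\<exists>L. 0 \<le> L \<and> (\<forall>X. z \<le> snd X \<longrightarrow> norm (G X) \<le> L)" if z: "0 < z" for z
  proof -
    obtain L where L: "L-lipschitz_on {X. z / 2 \<le> snd X} f" using lip[of "z / 2"] z by auto
    have "norm (G X) \<le> L" if X: "z \<le> snd X" for X
    proof (cases "X \<in> ?W - N")
      case True
      show ?thesis
      proof (rule norm_GDERIV_le[OF der[OF True]])
        show "open ((UNIV :: 'a set) \<times> {z / 2<..})" by (simp add: open_Times)
        show "X \<in> UNIV \<times> {z / 2<..}" using X z by (simp add: mem_Times_iff)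
        show "L-lipschitz_on (UNIV \<times> {z / 2<..}) f" by (rule lipschitz_on_subset[OF L]) auto
      qed
    next
      case False
      then show ?thesis using lipschitz_on_nonneg[OF L] by (simp add: 0)
    qed
    with lipschitz_on_nonneg[OF L] show ?thesis by blast
  qed
  have int_compact: "integrable lborel (\<lambda>X. indicator K X *\<^sub>R g X)"
    if "compact K" "continuous_on K g" for K :: "('a \<times> real) set" and g :: "_ \<Rightarrow> real"
    using that by (rule borel_integrable_compact)
  have int_G: "integrable lborel (\<lambda>X. indicator K X *\<^sub>R G X)" if K: "compact K" "K \<subseteq> ?W" for K
  proof -
    obtain z where z: "0 < z" "\<And>X. X \<in> K \<Longrightarrow> z \<le> snd X"
      using compact_upper_half_space_bound[OF K] by blast
    obtain L where L: "\<forall>X. z \<le> snd X \<longrightarrow> norm (G X) \<le> L" using G_le[OF z(1)] by blast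
    have [measurable]: "K \<in> sets borel" using K(1) by (simp add: borel_compact)
    have "integrable lborel (\<lambda>X. indicator K X *\<^sub>R L)"
      by (intro int_compact K(1) continuous_on_const)
    then show ?thesis
    proof (rule Bochner_Integration.integrable_bound)
      have "norm (G X) \<le> \<bar>L\<bar>" if "X \<in> K" for X
        using L z(2)[OF that] abs_ge_self[of L] order_trans by blast
      then show "AE X in lborel. norm (indicator K X *\<^sub>R G X) \<le> norm (indicator K X *\<^sub>R L)"
        by (intro AE_I2) (simp add: indicator_def)
    qed measurable
  qed
  have "(LINT X:?W|lebesgue. f X *\<^sub>R D X) = - (LINT X:?W|lebesgue. \<phi> X *\<^sub>R G X)"
    if \<phi>: "\<And>X. GDERIV \<phi> X :> D X" and D: "continuous_on UNIV D"
      and S: "compact (closure {X. \<phi> X \<noteq> 0})" "closure {X. \<phi> X \<noteq> 0} \<subseteq> ?W" for \<phi> D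
  proof -
    define S where "S = closure {X. \<phi> X \<noteq> 0}"
    have S: "compact S" "S \<subseteq> ?W" "closed S" using S by (auto simp: S_def)
    have \<phi>0: "\<phi> X = 0" if "X \<notin> S" for X
      using that closure_subset[of "{X. \<phi> X \<noteq> 0}"] by (auto simp: S_def)
    have \<phi>_cont: "continuous_on A \<phi>" for A
      using \<phi> by (intro continuous_at_imp_continuous_on ballI)
        (auto simp: gderiv_def dest: has_derivative_continuous)
    have [measurable]: "\<phi> \<in> borel_measurable borel" "D \<in> borel_measurable borel" "S \<in> sets borel"
      using \<phi>_cont D S(3) by (auto intro: borel_measurable_continuous_onI)
    \<comment> \<open>\<open>\<phi>\<close> vanishes on the open complement of its support, so its
      gradient vanishes there too.\<close>
    have D0: "D X = 0" if "X \<notin> S" for X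
    proof -
      have "((\<lambda>_. 0) has_derivative (\<lambda>h. h \<bullet> 0)) (at X)" by simp
      then have "GDERIV \<phi> X :> 0"
        unfolding gderiv_def
        by (rule has_derivative_transform_within_open[where s="- S"]) (use S(3) that \<phi>0 in auto)
      then have "gradient \<phi> X = 0" by (rule gradient_eq)
      with gradient_eq[OF \<phi>] show ?thesis by simp
    qed
    obtain z2 where z2: "0 < z2" "\<And>X. X \<in> S \<Longrightarrow> z2 \<le> snd X"
      using compact_upper_half_space_bound[OF S(1,2)] by blast
    \<comment> \<open>Half the distance of the support to the boundary is kept as room: with steps
      of length at most \<open>d \<le> z\<close>, if one of the two points of a difference quotient
      lies in \<open>S\<close>, both have height at least \<open>z\<close>.\<close>
    define z where "z = z2 / 2"
    have z: "0 < z" using z2 by (simp add: z_def)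
    define d where "d = min z 1"
    have d: "0 < d" "d \<le> z" "d \<le> 1" using z by (auto simp: d_def)
    obtain L where L: "L-lipschitz_on {X. z \<le> snd X} f" using lip[OF z] by blast
    \<comment> \<open>A compact set outside which every difference quotient below vanishes. The cut
      at height \<open>z\<close> keeps it where \<open>f\<close> is Lipschitz and therefore
      bounded.\<close>
    define S' where "S' = {x + y | x y. x \<in> S \<and> y \<in> cball 0 1} \<inter> {X. z \<le> snd X}"
    have "{X :: 'a \<times> real. z \<le> snd X} = UNIV \<times> {z..}" by auto
    then have "closed {X :: 'a \<times> real. z \<le> snd X}" by (simp add: closed_Times)
    then have S': "compact S'"
      unfolding S'_def by (intro compact_Int_closed compact_sums S(1) compact_cball)
    have "continuous_on S' f"
      by (rule continuous_on_subset[OF lipschitz_on_continuous_on[OF L]]) (auto simp: S'_def)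
    then obtain Mf where Mf: "\<And>X. X \<in> S' \<Longrightarrow> \<bar>f X\<bar> \<le> Mf"
      using compact_imp_bounded[OF compact_continuous_image[OF _ S']] by (force simp: bounded_iff)
    obtain Mp0 where Mp0: "\<And>X. X \<in> S \<Longrightarrow> \<bar>\<phi> X\<bar> \<le> Mp0"
      using compact_imp_bounded[OF compact_continuous_image[OF \<phi>_cont S(1)]] by (force simp: bounded_iff)
    define Mp where "Mp = max 0 Mp0"
    have Mp: "\<bar>\<phi> X\<bar> \<le> Mp" for X
      using Mp0[of X] \<phi>0[of X] by (cases "X \<in> S") (auto simp: Mp_def)
    obtain Md0 where Md0: "\<And>X. X \<in> S \<Longrightarrow> norm (D X) \<le> Md0"
      using compact_imp_bounded[OF compact_continuous_image[OF continuous_on_subset[OF D subset_UNIV] S(1)]]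
      by (force simp: bounded_iff)
    define Md where "Md = max 0 Md0"
    have Md: "norm (D X) \<le> Md" for X
      using Md0[of X] D0[of X] by (cases "X \<in> S") (auto simp: Md_def)
    have \<phi>_lip: "Md-lipschitz_on UNIV \<phi>"
    proof (rule bounded_derivative_imp_lipschitz)
      show "(\<phi> has_derivative (\<lambda>h. h \<bullet> D X)) (at X within UNIV)" for X
        using \<phi>[of X] by (simp add: gderiv_def)
      show "onorm (\<lambda>h. h \<bullet> D X) \<le> Md" for X
      proof (rule onorm_le)
        fix h
        have "\<bar>h \<bullet> D X\<bar> \<le> norm h * Md"
          by (intro order_trans[OF Cauchy_Schwarz_ineq2] mult_left_mono Md) auto
        then show "norm (h \<bullet> D X) \<le> Md * norm h" by (simp add: mult.commute)
      qed
    qed (auto simp: Md_def)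
    define f1 where "f1 X = indicator ?W X *\<^sub>R f X" for X
    have [measurable]: "f1 \<in> borel_measurable borel"
      unfolding f1_def[abs_def] by (rule borel_measurable_continuous_on_indicator[OF _ cont]) simp
    define p where "p X = f1 X * \<phi> X" for X
    have [measurable]: "p \<in> borel_measurable borel" unfolding p_def[abs_def] by measurable
    have p0: "p X = 0" if "X \<notin> S" for X using \<phi>0[OF that] by (simp add: p_def)
    have f1_S: "(\<lambda>X. indicator S X *\<^sub>R (f X * g X)) = (\<lambda>X. f1 X * g X)"
      if "\<And>X. X \<notin> S \<Longrightarrow> g X = 0" for g :: "_ \<Rightarrow> real"
      using that S(2) by (fastforce simp: f1_def indicator_def fun_eq_iff)
    have contS: "continuous_on S f" using cont S(2) by (rule continuous_on_subset)
    have p_int: "integrable lborel p"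
      using int_compact[OF S(1) continuous_on_mult[OF contS \<phi>_cont]]
      by (subst (asm) f1_S) (auto simp: \<phi>0 p_def[abs_def])
    define h where "h k = d / real (Suc k)" for k
    have h: "0 < h k" "h k \<le> d" "h \<longlonglongrightarrow> 0" for k
    proof -
      have "(\<lambda>k. d * inverse (real (Suc k))) \<longlonglongrightarrow> d * 0"
        by (intro tendsto_mult tendsto_const LIMSEQ_inverse_real_of_nat)
      then show "h \<longlonglongrightarrow> 0" by (simp add: h_def[abs_def] divide_inverse)
    qed (use d in \<open>auto simp: h_def divide_le_eq\<close>)
    have main: "(LINT X|lborel. f1 X * (D X \<bullet> e)) = - (LINT X|lborel. \<phi> X * (G X \<bullet> e))"
      and int1: "integrable lborel (\<lambda>X. f1 X * (D X \<bullet> e))" and int2: "integrable lborel (\<lambda>X. \<phi> X * (G X \<bullet> e))"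
      if e: "e \<in> Basis" for e
    proof -
      let ?q = "\<lambda>k X. (p (X + h k *\<^sub>R e) - p X) / h k"
      let ?p' = "\<lambda>X. f1 X * (D X \<bullet> e) + \<phi> X * (G X \<bullet> e)"
      have "continuous_on S (\<lambda>X. D X \<bullet> e)"
        using D by (intro continuous_intros) (auto intro: continuous_on_subset)
      from int_compact[OF S(1) continuous_on_mult[OF contS this]]
      show int1: "integrable lborel (\<lambda>X. f1 X * (D X \<bullet> e))"
        by (subst (asm) f1_S) (auto simp: D0)
      have "integrable lborel (\<lambda>X. Mp *\<^sub>R norm (indicator S X *\<^sub>R G X))"
        using int_G[OF S(1,2)] by (intro integrable_scaleR_right integrable_norm)
      then show int2: "integrable lborel (\<lambda>X. \<phi> X * (G X \<bullet> e))"
      proof (rule Bochner_Integration.integrable_bound)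
        show "AE X in lborel. norm (\<phi> X * (G X \<bullet> e)) \<le> norm (Mp *\<^sub>R norm (indicator S X *\<^sub>R G X))"
        proof (rule AE_I2)
          fix X
          show "norm (\<phi> X * (G X \<bullet> e)) \<le> norm (Mp *\<^sub>R norm (indicator S X *\<^sub>R G X))"
            using Mp[of X] Basis_le_norm[OF e, of "G X"] \<phi>0[of X]
            by (cases "X \<in> S") (auto simp: abs_mult intro!: mult_mono intro: order_trans)
        qed
      qed measurable
      have lim: "(\<lambda>k. ?q k X) \<longlonglongrightarrow> ?p' X" if X: "X \<notin> N" for X
      proof (cases "X \<in> ?W")
        case True
        have "GDERIV (\<lambda>X. f X * \<phi> X) X :> (f X *\<^sub>R D X + \<phi> X *\<^sub>R G X)"
          using X True by (intro GDERIV_mult der \<phi>) auto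
        then have "GDERIV p X :> (f X *\<^sub>R D X + \<phi> X *\<^sub>R G X)"
          unfolding gderiv_def
          by (rule has_derivative_transform_within_open[OF _ open_upper_half_space True]) (simp add: p_def f1_def)
        from GDERIV_directional_limit[OF this h(1,3), of e] True show ?thesis
          by (simp add: inner_add_left f1_def)
      next
        case False
        then have "X \<in> - S" using S(2) by auto
        have "(\<lambda>k. X + h k *\<^sub>R e) \<longlonglongrightarrow> X + 0 *\<^sub>R e"
          by (intro tendsto_intros h)
        then have "eventually (\<lambda>k. X + h k *\<^sub>R e \<in> - S) sequentially"
          using S(3) \<open>X \<in> - S\<close> by (intro topological_tendstoD) auto
        then have "eventually (\<lambda>k. ?q k X = 0) sequentially"
          by eventually_elim (use \<open>X \<in> - S\<close> in \<open>auto simp: p0\<close>)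
        moreover have "?p' X = 0" using False \<open>X \<in> - S\<close> by (simp add: f1_def \<phi>0)
        ultimately show ?thesis by (simp add: tendsto_eventually)
      qed
      \<comment> \<open>Discrete product rule: the increment of \<open>f\<close> against a bound for
        \<open>\<phi>\<close>, plus a bound for \<open>f\<close> against the increment of
        \<open>\<phi>\<close>.\<close>
      define C where "C = L * Mp + Mf * Md"
      have bound: "\<bar>?q k X\<bar> \<le> C * indicator S' X" for k X
      proof (cases "X \<in> S \<or> X + h k *\<^sub>R e \<in> S")
        case True
        have he: "norm (h k *\<^sub>R e) \<le> d" using h(1,2)[of k] e by simp
        have sn: "\<bar>snd (h k *\<^sub>R e)\<bar> \<le> d"
          using norm_snd_le[of "fst (h k *\<^sub>R e)" "snd (h k *\<^sub>R e)"] he norm_snd_le order_trans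
          by (metis prod.collapse real_norm_def)
        have zz: "z \<le> snd X" "z \<le> snd (X + h k *\<^sub>R e)"
          using True z2(2)[of X] z2(2)[of "X + h k *\<^sub>R e"] sn d z by (auto simp: z_def)
        have XS': "X \<in> S'"
        proof -
          have "X = X + 0" "X = (X + h k *\<^sub>R e) + (- (h k *\<^sub>R e))" by auto
          moreover have "(0 :: 'a \<times> real) \<in> cball 0 1" "- (h k *\<^sub>R e) \<in> cball 0 1"
            using he d by auto
          ultimately show ?thesis using True zz unfolding S'_def by blast
        qed
        have eq: "p (X + h k *\<^sub>R e) - p X = (f (X + h k *\<^sub>R e) - f X) * \<phi> (X + h k *\<^sub>R e) +
            f X * (\<phi> (X + h k *\<^sub>R e) - \<phi> X)"
          using zz z by (simp add: p_def f1_def upper_half_space_def algebra_simps)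
        have "\<bar>f (X + h k *\<^sub>R e) - f X\<bar> \<le> L * h k"
          using lipschitz_onD[OF L, of "X + h k *\<^sub>R e" X] zz h(1)[of k] e by (simp add: dist_norm)
        moreover have "\<bar>\<phi> (X + h k *\<^sub>R e) - \<phi> X\<bar> \<le> Md * h k"
          using lipschitz_onD[OF \<phi>_lip, of "X + h k *\<^sub>R e" X] h(1)[of k] e by (simp add: dist_norm)
        ultimately have "\<bar>p (X + h k *\<^sub>R e) - p X\<bar> \<le> (L * h k) * Mp + Mf * (Md * h k)"
          unfolding eq using Mf[OF XS'] Mp[of "X + h k *\<^sub>R e"]
          by (intro order_trans[OF abs_triangle_ineq] add_mono) (auto simp: abs_mult intro!: mult_mono)
        also have "\<dots> = C * h k" by (simp add: C_def algebra_simps)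
        finally show ?thesis using h(1)[of k] XS' by (simp add: divide_le_eq)
      next
        case False
        \<comment> \<open>\<open>Mf\<close> is known to be nonnegative only when \<open>S'\<close>
          contains a point, hence the restriction.\<close>
        have "0 \<le> C" if "X \<in> S'"
          using Mf[OF that] lipschitz_on_nonneg[OF L] by (auto simp: C_def Mp_def Md_def)
        with False show ?thesis by (simp add: p0 indicator_def)
      qed
      have "(\<lambda>k. LINT X|lborel. ?q k X) \<longlonglongrightarrow> (LINT X|lborel. ?p' X)"
      proof (rule integral_dominated_convergence[where w="\<lambda>X. C * indicator S' X"])
        show "integrable lborel (\<lambda>X. C * indicator S' X)"
          using int_compact[OF S' continuous_on_const[of _ C]] by (simp add: mult.commute)
        show "AE X in lborel. (\<lambda>k. ?q k X) \<longlonglongrightarrow> ?p' X"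
          using AE_not_in[OF N] by eventually_elim (rule lim)
        show "AE X in lborel. norm (?q k X) \<le> C * indicator S' X" for k
          by (rule AE_I2, simp only: real_norm_def, rule bound)
      qed (measurable)
      moreover have "(LINT X|lborel. ?q k X) = 0" for k
        using integral_lborel_translate[OF p_int, of "h k *\<^sub>R e"] p_int by simp
      ultimately have "(LINT X|lborel. ?p' X) = 0"
        by (simp only: LIMSEQ_const_iff)
      then show "(LINT X|lborel. f1 X * (D X \<bullet> e)) = - (LINT X|lborel. \<phi> X * (G X \<bullet> e))"
        using int1 int2 by simp
    qed
    have l1: "(LINT X:?W|lebesgue. f X *\<^sub>R D X) = (LINT X|lborel. f1 X *\<^sub>R D X)"
    proof -
      have "(LINT X|lebesgue. f1 X *\<^sub>R D X) = (LINT X|lborel. f1 X *\<^sub>R D X)"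
        by (rule integral_completion) measurable
      then show ?thesis
        by (simp add: set_lebesgue_integral_def f1_def)
    qed
    have l2: "(LINT X:?W|lebesgue. \<phi> X *\<^sub>R G X) = (LINT X|lborel. \<phi> X *\<^sub>R G X)"
    proof -
      have "indicator ?W X *\<^sub>R (\<phi> X *\<^sub>R G X) = \<phi> X *\<^sub>R G X" for X
        using 0[of X] by (auto simp: indicator_def)
      then have "(LINT X:?W|lebesgue. \<phi> X *\<^sub>R G X) = (LINT X|lebesgue. \<phi> X *\<^sub>R G X)"
        unfolding set_lebesgue_integral_def by (simp only:)
      also have "\<dots> = (LINT X|lborel. \<phi> X *\<^sub>R G X)"
        by (rule integral_completion) measurable
      finally show ?thesis .
    qed
    have i1: "integrable lborel (\<lambda>X. f1 X *\<^sub>R D X)"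
    proof -
      have "integrable lborel (\<lambda>X. \<Sum>e\<in>Basis. (f1 X * (D X \<bullet> e)) *\<^sub>R e)"
        using int1 by (intro Bochner_Integration.integrable_sum integrable_scaleR_left)
      moreover have "(\<Sum>e\<in>Basis. (f1 X * (D X \<bullet> e)) *\<^sub>R e) = f1 X *\<^sub>R D X" for X
        using euclidean_representation[of "f1 X *\<^sub>R D X"] by simp
      ultimately show ?thesis by simp
    qed
    have i2: "integrable lborel (\<lambda>X. \<phi> X *\<^sub>R G X)"
    proof -
      have "integrable lborel (\<lambda>X. \<Sum>e\<in>Basis. (\<phi> X * (G X \<bullet> e)) *\<^sub>R e)"
        using int2 by (intro Bochner_Integration.integrable_sum integrable_scaleR_left)
      moreover have "(\<Sum>e\<in>Basis. (\<phi> X * (G X \<bullet> e)) *\<^sub>R e) = \<phi> X *\<^sub>R G X" for X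
        using euclidean_representation[of "\<phi> X *\<^sub>R G X"] by simp
      ultimately show ?thesis by simp
    qed
    show ?thesis
      unfolding l1 l2
    proof (rule euclidean_eqI)
      fix e :: "'a \<times> real" assume e: "e \<in> Basis"
      show "(LINT X|lborel. f1 X *\<^sub>R D X) \<bullet> e = (- (LINT X|lborel. \<phi> X *\<^sub>R G X)) \<bullet> e"
        using main[OF e] integral_inner_left[OF i1, of e] integral_inner_left[OF i2, of e]
        by simp
    qed
  qed
  moreover have "set_integrable lebesgue K f \<and> set_integrable lebesgue K G" if K: "compact K" "K \<subseteq> ?W" for K
    using int_compact[OF K(1) continuous_on_subset[OF cont K(2)]] int_G[OF K]
    unfolding set_integrable_def by (auto intro!: integrable_completion[THEN iffD2])
  ultimately show ?thesis
    unfolding weak_gradient_on_def by blast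
qed

section \<open>Traces\<close>

lemma borel_measurable_fst_snd [measurable]:
  "(fst :: 'b::second_countable_topology \<times> 'c::second_countable_topology \<Rightarrow> 'b) \<in> borel \<rightarrow>\<^sub>M borel"
  "(snd :: 'b \<times> 'c \<Rightarrow> 'c) \<in> borel \<rightarrow>\<^sub>M borel"
  by (intro borel_measurable_continuous_onI continuous_on_fst continuous_on_snd continuous_on_id)+

text \<open>\<open>A\<close> is squeezed between a compact \<open>T\<close> and an open
  \<open>U\<close>. For shifts shorter than the radius by which \<open>T\<close> fits into
  \<open>U\<close>, a point that enters \<open>A\<close> either lands in \<open>A - T\<close> or
  starts in \<open>U - A\<close>, and both sets are small.\<close>

lemma borel_translate_inside_le:
  fixes A :: "'b::euclidean_space set"
  assumes A [measurable]: "A \<in> sets borel" and bnd: "bounded A" and \<epsilon>: "0 < \<epsilon>"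
  obtains \<delta> where "0 < \<delta>"
    "\<And>h. norm h < \<delta> \<Longrightarrow> emeasure lborel {x. x + h \<in> A \<and> x \<notin> A} \<le> ennreal \<epsilon>"
proof -
  have AL: "A \<in> sets lebesgue" using A by simp
  obtain U where U: "open U" "A \<subseteq> U" "emeasure lebesgue (U - A) < ennreal (\<epsilon> / 2)"
    using sets_lebesgue_outer_open[OF AL, of "\<epsilon> / 2"] \<epsilon> by (metis half_gt_zero)
  obtain T where T: "closed T" "T \<subseteq> A" "emeasure lebesgue (A - T) < ennreal (\<epsilon> / 2)"
    using sets_lebesgue_inner_closed[OF AL, of "\<epsilon> / 2"] \<epsilon> by (metis half_gt_zero)
  have "compact T" using T bnd by (meson bounded_subset compact_eq_bounded_closed)
  then obtain \<delta> where \<delta>: "0 < \<delta>" "(\<Union>x\<in>T. ball x \<delta>) \<subseteq> U"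
    using compact_subset_open_imp_ball_epsilon_subset[of T U] U(1,2) T(2) by blast
  have [measurable]: "U \<in> sets borel" "T \<in> sets borel" using U(1) T(1) by auto
  show thesis
  proof (rule that[OF \<delta>(1)])
    fix h :: 'b assume h: "norm h < \<delta>"
    have sub: "{x. x + h \<in> A \<and> x \<notin> A} \<subseteq> {x. x + h \<in> A - T} \<union> (U - A)"
    proof
      fix x assume x: "x \<in> {x. x + h \<in> A \<and> x \<notin> A}"
      show "x \<in> {x. x + h \<in> A - T} \<union> (U - A)"
      proof (cases "x + h \<in> T")
        case True
        then have "x \<in> ball (x + h) \<delta>" using h by (simp add: dist_norm)
        then show ?thesis using True \<delta>(2) x by blast
      qed (use x in auto)
    qed
    have [measurable]: "{x. x + h \<in> A - T} \<in> sets borel"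
      by measurable
    have "emeasure lborel {x. x + h \<in> A - T} = emeasure (distr lborel borel ((+) h)) (A - T)"
      by (subst emeasure_distr) (auto simp: vimage_def add.commute)
    also have "\<dots> = emeasure lborel (A - T)" by (simp add: lborel_distr_plus)
    finally have e: "emeasure lborel {x. x + h \<in> A - T} = emeasure lborel (A - T)" .
    have "emeasure lborel {x. x + h \<in> A \<and> x \<notin> A} \<le> emeasure lborel ({x. x + h \<in> A - T} \<union> (U - A))"
      by (rule emeasure_mono[OF sub]) simp
    also have "\<dots> \<le> emeasure lborel {x. x + h \<in> A - T} + emeasure lborel (U - A)"
      by (rule emeasure_subadditive) auto
    also have "\<dots> \<le> ennreal (\<epsilon> / 2) + ennreal (\<epsilon> / 2)"
      unfolding e using U(3) T(3) by (intro add_mono) (auto simp: less_imp_le)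
    also have "\<dots> = ennreal \<epsilon>" using \<epsilon> by (simp flip: ennreal_plus)
    finally show "emeasure lborel {x. x + h \<in> A \<and> x \<notin> A} \<le> ennreal \<epsilon>" .
  qed
qed

lemma borel_measurable_phase [measurable]:
  "E \<in> sets borel \<Longrightarrow> phase E \<in> borel_measurable borel"
  unfolding phase_def[abs_def] by (intro borel_measurable_diff borel_measurable_indicator) auto

lemma ennreal_pos_real_between:
  assumes "0 < (b::ennreal)"
  obtains \<epsilon> where "0 < \<epsilon>" "ennreal \<epsilon> < b"
proof (cases b)
  case (real x)
  with assms show ?thesis by (intro that[of "x / 2"]) (auto simp: ennreal_less_iff)
next
  case top
  then show ?thesis by (intro that[of 1]) (auto simp: less_top[symmetric])
qed

lemma abs_phase_le: "\<bar>phase E x\<bar> \<le> 1"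
  by (simp add: phase_def indicator_def)

text \<open>Local \<open>L^1\<close> continuity of translations. The phase jumps by 2 on the points
  that enter \<open>E\<close> and on those that leave it, whence the quarter of
  \<open>\<epsilon>\<close>. Intersecting with the ball of radius \<open>R + 1\<close> makes the set
  bounded without affecting shifts shorter than 1.\<close>

lemma phase_translation_tendsto:
  fixes E :: "'a::euclidean_space set"
  assumes E [measurable]: "E \<in> sets borel"
  shows "((\<lambda>h. \<integral>\<^sup>+x\<in>ball 0 R. ennreal \<bar>phase E (x + h) - phase E x\<bar> \<partial>lborel) \<longlongrightarrow> 0) (at 0)"
proof (rule order_tendstoI)
  fix a :: ennreal assume "0 < a"
  then obtain \<epsilon> where \<epsilon>: "0 < \<epsilon>" "ennreal \<epsilon> < a"
    by (rule ennreal_pos_real_between)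
  let ?A = "E \<inter> ball 0 (R + 1)"
  have A: "?A \<in> sets borel" "bounded ?A" by (auto intro: bounded_subset[OF bounded_ball])
  obtain \<delta> where \<delta>: "0 < \<delta>"
    "\<And>h. norm h < \<delta> \<Longrightarrow> emeasure lborel {x. x + h \<in> ?A \<and> x \<notin> ?A} \<le> ennreal (\<epsilon> / 4)"
    using borel_translate_inside_le[OF A, of "\<epsilon> / 4"] \<epsilon>(1) by auto
  have "(\<integral>\<^sup>+x\<in>ball 0 R. ennreal \<bar>phase E (x + h) - phase E x\<bar> \<partial>lborel) < a"
    if h: "norm h < \<delta>" "norm h < 1" for h
  proof -
    let ?B = "\<lambda>h. {x. x + h \<in> ?A \<and> x \<notin> ?A}"
    have [measurable]: "?B h \<in> sets borel" for h by measurable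
    have le: "ennreal \<bar>phase E (x + h) - phase E x\<bar> * indicator (ball 0 R) x \<le>
        2 * indicator (?B h) x + 2 * indicator (?B (- h)) (x + h)" for x
    proof (cases "x \<in> ball 0 R")
      case True
      then have "norm (x + h) < R + 1" "norm x < R + 1"
        using norm_triangle_ineq[of x h] h by auto
      then show ?thesis by (auto simp: indicator_def phase_def)
    qed simp
    have "(\<integral>\<^sup>+x\<in>ball 0 R. ennreal \<bar>phase E (x + h) - phase E x\<bar> \<partial>lborel) \<le>
        (\<integral>\<^sup>+x. 2 * indicator (?B h) x + 2 * indicator (?B (- h)) (x + h) \<partial>lborel)"
      by (rule nn_integral_mono) (rule le)
    also have "\<dots> = 2 * emeasure lborel (?B h) + 2 * (\<integral>\<^sup>+x. indicator (?B (- h)) (h + x) \<partial>lborel)"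
      by (simp add: nn_integral_add nn_integral_cmult add.commute)
    also have "(\<integral>\<^sup>+x. indicator (?B (- h)) (h + x) \<partial>lborel) = (\<integral>\<^sup>+x. indicator (?B (- h)) x \<partial>distr lborel borel ((+) h))"
      by (subst nn_integral_distr) auto
    also have "\<dots> = emeasure lborel (?B (- h))" by (simp add: lborel_distr_plus)
    also have "2 * emeasure lborel (?B h) + 2 * emeasure lborel (?B (- h)) \<le> 2 * ennreal (\<epsilon> / 4) + 2 * ennreal (\<epsilon> / 4)"
      using \<delta>(2)[of h] \<delta>(2)[of "- h"] h by (intro add_mono mult_left_mono) auto
    also have "\<dots> = ennreal (2 * (\<epsilon> / 4) + 2 * (\<epsilon> / 4))"
    proof -
      have "2 * ennreal (\<epsilon> / 4) = ennreal (2 * (\<epsilon> / 4))"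
        using \<epsilon>(1) by (subst ennreal_mult) auto
      then show ?thesis using \<epsilon>(1) by (subst ennreal_plus) auto
    qed
    also have "2 * (\<epsilon> / 4) + 2 * (\<epsilon> / 4) = \<epsilon>" by simp
    finally show ?thesis using \<epsilon>(2) by (rule le_less_trans)
  qed
  then show "eventually (\<lambda>h. (\<integral>\<^sup>+x\<in>ball 0 R. ennreal \<bar>phase E (x + h) - phase E x\<bar> \<partial>lborel) < a) (at 0)"
    unfolding eventually_at using \<delta>(1) by (intro exI[of _ "min \<delta> 1"]) auto
qed simp

section \<open>Boundary values of the extension\<close>

lemma phase_bounded_datum: "0 < s \<Longrightarrow> E \<in> sets borel \<Longrightarrow> bounded_datum s (phase E :: 'a::euclidean_space \<Rightarrow> real)"
  by unfold_locales (auto simp: abs_phase_le)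

text \<open>As the kernel has mass 1, the difference is an average of increments of the phase.
  Rescaling \<open>y\<close> by \<open>z\<close> turns it into an average against the kernel at
  height 1, which does not depend on \<open>z\<close>.\<close>

lemma extension_slice_le:
  fixes E :: "'a::euclidean_space set"
  assumes s: "0 < s" and E [measurable]: "E \<in> sets borel" and z: "0 < z"
  shows "ennreal \<bar>extension s (phase E) (x, z) - phase E x\<bar> \<le>
    (\<integral>\<^sup>+w. ennreal (poisson_kernel s w 1) * ennreal \<bar>phase E (x - z *\<^sub>R w) - phase E x\<bar> \<partial>lborel)"
proof -
  interpret bounded_datum s "phase E" by (rule phase_bounded_datum[OF s E])
  let ?u = "phase E" and ?P = "\<lambda>y. poisson_kernel s (x - y) z"
  have P: "integrable lborel ?P" "(LINT y|lborel. ?P y) = 1"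
    using poisson_kernel_integrable[OF s z] by auto
  have Pu: "integrable lborel (\<lambda>y. ?P y * ?u y)"
    using integrable_kernel_mult[of "(x, z)"] z by simp
  have "extension s ?u (x, z) - ?u x = (LINT y|lborel. ?P y * ?u y) - ?u x * (LINT y|lborel. ?P y)"
    using P(2) by (simp add: extension_eq_lborel)
  also have "\<dots> = (LINT y|lborel. ?P y * ?u y - ?u x * ?P y)"
    using P(1) Pu by simp
  also have "\<dots> = (LINT y|lborel. ?P y * (?u y - ?u x))"
    by (simp add: algebra_simps)
  finally have "ennreal \<bar>extension s ?u (x, z) - ?u x\<bar> = ennreal (norm (LINT y|lborel. ?P y * (?u y - ?u x)))"
    by simp
  also have "\<dots> \<le> (\<integral>\<^sup>+y. norm (?P y * (?u y - ?u x)) \<partial>lborel)"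
  proof (rule integral_norm_bound_ennreal)
    show "integrable lborel (\<lambda>y. ?P y * (?u y - ?u x))"
      using P(1) Pu by (simp add: right_diff_distrib)
  qed
  also have "\<dots> = (\<integral>\<^sup>+y. (\<lambda>v. ennreal (poisson_kernel s v z * \<bar>?u (x - v) - ?u x\<bar>)) (x - y) \<partial>lborel)"
    by (simp add: abs_mult poisson_kernel_nonneg[OF s])
  also have "\<dots> = (\<integral>\<^sup>+v. ennreal (poisson_kernel s v z * \<bar>?u (x - v) - ?u x\<bar>) \<partial>lborel)"
    by (rule nn_integral_lborel_reflect) measurable
  also have "\<dots> = ennreal (z ^ DIM('a)) *
      (\<integral>\<^sup>+w. ennreal (poisson_kernel s (z *\<^sub>R w) z * \<bar>?u (x - z *\<^sub>R w) - ?u x\<bar>) \<partial>lborel)"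
    by (rule nn_integral_lborel_scale[OF _ z]) measurable
  also have "\<dots> = (\<integral>\<^sup>+w. ennreal (z ^ DIM('a)) * ennreal (poisson_kernel s (z *\<^sub>R w) z * \<bar>?u (x - z *\<^sub>R w) - ?u x\<bar>) \<partial>lborel)"
    by (rule nn_integral_cmult[symmetric]) measurable
  also have "\<dots> = (\<integral>\<^sup>+w. ennreal (poisson_kernel s w 1) * ennreal \<bar>?u (x - z *\<^sub>R w) - ?u x\<bar> \<partial>lborel)"
    using z
    by (intro nn_integral_cong)
       (simp add: poisson_kernel_scale[OF z, symmetric] ennreal_mult'[symmetric] mult.assoc
          poisson_kernel_nonneg[OF s])
  finally show ?thesis .
qed

text \<open>By Fubini, the \<open>L^1\<close> distance at height \<open>z\<close> is at most the
  average of the translation modulus at \<open>- z w\<close> against the kernel at height 1. The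
  modulus is bounded by twice the volume of the ball, so dominated convergence in \<open>w\<close>
  applies.\<close>

lemma extension_slice_tendsto:
  fixes E :: "'a::euclidean_space set"
  assumes s: "0 < s" and E [measurable]: "E \<in> sets borel"
  shows "((\<lambda>z. \<integral>\<^sup>+x\<in>ball 0 R. ennreal \<bar>extension s (phase E) (x, z) - phase E x\<bar> \<partial>lborel) \<longlongrightarrow> 0) (at_right 0)"
proof -
  let ?u = "phase E" and ?P = "\<lambda>w::'a. poisson_kernel s w 1"
  let ?\<omega> = "\<lambda>h. \<integral>\<^sup>+x\<in>ball 0 R. ennreal \<bar>?u (x + h) - ?u x\<bar> \<partial>lborel"
  let ?\<Theta> = "\<lambda>z. \<integral>\<^sup>+w. ennreal (?P w) * ?\<omega> (- (z *\<^sub>R w)) \<partial>lborel"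
  have \<omega>0: "?\<omega> 0 = 0" by simp
  \<comment> \<open>The full neighbourhood of 0 is needed because the shift \<open>- z w\<close> is
    zero for \<open>w = 0\<close>.\<close>
  have \<omega>_cont: "(?\<omega> \<longlongrightarrow> 0) (nhds 0)"
    using phase_translation_tendsto[OF E, of R] tendsto_at_iff_tendsto_nhds[of ?\<omega> 0]
    unfolding \<omega>0 by (rule iffD1[rotated])
  have \<omega>_le: "?\<omega> h \<le> 2 * emeasure lborel (ball (0::'a) R)" for h
  proof -
    have "?\<omega> h \<le> (\<integral>\<^sup>+x. 2 * indicator (ball (0::'a) R) x \<partial>lborel)"
      by (intro nn_integral_mono) (auto simp: indicator_def phase_def)
    then show ?thesis by (simp add: nn_integral_cmult)
  qed
  have lim: "(?\<Theta> \<longlongrightarrow> 0) (at_right 0)"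
  proof (rule tendsto_at_right_sequentially[of 0 1])
    fix S :: "nat \<Rightarrow> real"
    assume S: "\<And>n. 0 < S n" "\<And>n. S n < 1" "decseq S" "S \<longlonglongrightarrow> 0"
    have "(\<lambda>n. ?\<Theta> (S n)) \<longlonglongrightarrow> (\<integral>\<^sup>+w. 0 \<partial>(lborel :: 'a measure))"
    proof (rule nn_integral_dominated_convergence[where w="\<lambda>w. ennreal (?P w) * (2 * emeasure lborel (ball (0::'a) R))"])
      show "(\<integral>\<^sup>+w. ennreal (?P w) * (2 * emeasure lborel (ball (0::'a) R)) \<partial>lborel) < \<infinity>"
        using nn_integral_poisson_kernel_origin[OF s, of 1, where 'a='a]
          emeasure_lborel_ball_finite[of "0::'a" R]
        by (simp add: nn_integral_multc ennreal_mult_less_top)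
      show "AE w in lborel. ennreal (?P w) * ?\<omega> (- (S n *\<^sub>R w)) \<le> ennreal (?P w) * (2 * emeasure lborel (ball (0::'a) R))" for n
        by (intro AE_I2 mult_left_mono \<omega>_le) auto
      show "AE w in lborel. (\<lambda>n. ennreal (?P w) * ?\<omega> (- (S n *\<^sub>R w))) \<longlonglongrightarrow> 0"
      proof (rule AE_I2)
        fix w :: 'a
        have "(\<lambda>n. - (S n *\<^sub>R w)) \<longlonglongrightarrow> - (0 *\<^sub>R w)"
          by (intro tendsto_minus tendsto_scaleR tendsto_const S(4))
        then have "(\<lambda>n. ?\<omega> (- (S n *\<^sub>R w))) \<longlonglongrightarrow> 0"
          using filterlim_compose[OF \<omega>_cont, of "\<lambda>n. - (S n *\<^sub>R w)" sequentially]
          by (simp only: scaleR_zero_left minus_zero)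
        then have "(\<lambda>n. ennreal (?P w) * ?\<omega> (- (S n *\<^sub>R w))) \<longlonglongrightarrow> ennreal (?P w) * 0"
          by (intro ennreal_tendsto_cmult) auto
        then show "(\<lambda>n. ennreal (?P w) * ?\<omega> (- (S n *\<^sub>R w))) \<longlonglongrightarrow> 0" by simp
      qed
    qed measurable
    then show "(\<lambda>n. ?\<Theta> (S n)) \<longlonglongrightarrow> 0" by simp
  qed simp
  have ev: "eventually (\<lambda>z. (\<integral>\<^sup>+x\<in>ball 0 R. ennreal \<bar>extension s ?u (x, z) - ?u x\<bar> \<partial>lborel) \<le> ?\<Theta> z) (at_right 0)"
  proof (rule eventually_at_right_less[THEN eventually_mono])
    fix z :: real assume z: "0 < z"
    have "(\<integral>\<^sup>+x\<in>ball 0 R. ennreal \<bar>extension s ?u (x, z) - ?u x\<bar> \<partial>lborel) \<le>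
      (\<integral>\<^sup>+x. (\<integral>\<^sup>+w. ennreal (?P w) * (ennreal \<bar>?u (x - z *\<^sub>R w) - ?u x\<bar> * indicator (ball 0 R) x) \<partial>lborel) \<partial>lborel)"
    proof (rule nn_integral_mono)
      fix x
      have "ennreal \<bar>extension s ?u (x, z) - ?u x\<bar> * indicator (ball 0 R) x \<le>
        (\<integral>\<^sup>+w. ennreal (?P w) * ennreal \<bar>?u (x - z *\<^sub>R w) - ?u x\<bar> \<partial>lborel) * indicator (ball 0 R) x"
        by (intro mult_right_mono extension_slice_le s E z) simp
      also have "\<dots> = (\<integral>\<^sup>+w. ennreal (?P w) * (ennreal \<bar>?u (x - z *\<^sub>R w) - ?u x\<bar> * indicator (ball 0 R) x) \<partial>lborel)"
        by (subst nn_integral_multc[symmetric]) (auto simp: mult.assoc)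
      finally show "ennreal \<bar>extension s ?u (x, z) - ?u x\<bar> * indicator (ball 0 R) x \<le> \<dots>" .
    qed
    also have "\<dots> = (\<integral>\<^sup>+w. (\<integral>\<^sup>+x. ennreal (?P w) * (ennreal \<bar>?u (x - z *\<^sub>R w) - ?u x\<bar> * indicator (ball 0 R) x) \<partial>lborel) \<partial>lborel)"
      by (rule lborel_pair.Fubini') measurable
    also have "\<dots> = ?\<Theta> z"
      by (simp add: nn_integral_cmult)
    finally show "(\<integral>\<^sup>+x\<in>ball 0 R. ennreal \<bar>extension s ?u (x, z) - ?u x\<bar> \<partial>lborel) \<le> ?\<Theta> z" .
  qed
  show ?thesis
    by (rule tendsto_sandwich[OF _ ev tendsto_const lim]) simp
qed

text \<open>
  Both sides are compared through the point \<open>h(|x|) (x, z)\<close>: it differs from \<open>stretch (x, z)\<close> by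
  \<open>O(z\<^sup>2)\<close>, which beats the bound \<open>O(1/z)\<close> on the gradient, and its trace is that of a radial change
  of variables in the base alone.
\<close>

lemma (in radial_stretch) has_trace_stretch:
  fixes E :: "'a::euclidean_space set"
  assumes s: "0 < s" and E [measurable]: "E \<in> sets borel"
  shows "has_trace (\<lambda>X. extension s (phase E) (stretch X)) (\<lambda>x. phase E (stretch x))"
  unfolding has_trace_def
proof (intro allI impI)
  interpret bounded_datum s "phase E" by (rule phase_bounded_datum[OF s E])
  fix R :: real assume R: "0 < R"
  let ?u = "phase E" and ?v = "extension s (phase E)" and ?\<kappa> = "a / t"
  let ?F = "\<lambda>y z. ennreal \<bar>?v (y, z) - ?u y\<bar>"
  let ?g = "\<lambda>z. \<integral>\<^sup>+y\<in>ball 0 (?\<kappa> * R). ?F y z \<partial>lborel"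
  let ?I = "\<lambda>\<epsilon>. \<integral>\<^sup>+X\<in>ball 0 R \<times> {0<..<\<epsilon>}. ennreal \<bar>?v (stretch X) - ?u (stretch (fst X))\<bar> \<partial>lebesgue"
  have \<kappa>: "1 \<le> ?\<kappa>" by simp
  obtain C where C: "0 \<le> C" "\<And>f :: 'a \<Rightarrow> ennreal. f \<in> borel_measurable borel \<Longrightarrow>
    (\<integral>\<^sup>+X. f (stretch X) \<partial>lborel) \<le> ennreal C * (\<integral>\<^sup>+Y. f Y \<partial>lborel)"
    by (rule nn_integral_stretch_le[where 'b='a]) (rule that)
  obtain L where L: "0 \<le> L" "\<And>x y. \<bar>factor x - factor y\<bar> \<le> L * \<bar>x - y\<bar>"
    using factor_lipschitz by blast
  \<comment> \<open>The gradient bound \<open>(DIM('a) + 2 * s) / z\<close> multiplied by a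
    displacement of at most \<open>L * (r + 1) / t * z ^ 2\<close>.\<close>
  define K where "K = (real DIM('a) + 2 * s) * (L * (r + 1) / t)"
  have K: "0 \<le> K" using L(1) s by (simp add: K_def add_nonneg_nonneg)
  have near: "\<bar>?v (stretch (x, z)) - ?v (factor (norm x) *\<^sub>R (x, z))\<bar> \<le> K * z" if z: "0 < z" "z \<le> 1" for x z
  proof -
    let ?h = "factor (norm (x, z))" and ?k = "factor (norm x)"
    have n: "norm x \<le> norm (x, z)" by (rule norm_fst_le)
    have hh: "\<bar>?h - ?k\<bar> * norm (x, z) \<le> L * (r + 1) / t * z ^ 2"
    proof -
      have nonneg: "0 \<le> L * (r + 1) / t * z ^ 2" using L(1) by simp
      \<comment> \<open>In the first two cases both factors agree. In the third,
        \<open>norm (x, z) - norm x\<close> is \<open>z ^ 2\<close> divided by the sum of the two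
        norms, and that sum exceeds \<open>t\<close>.\<close>
      consider "r \<le> norm x" | "norm (x, z) \<le> t" | "t < norm (x, z)" "norm x < r" by linarith
      then show ?thesis
      proof cases
        case 1
        then show ?thesis using n nonneg by (simp add: factor_ge_r)
      next
        case 2
        then show ?thesis using n nonneg by (simp add: factor_le_t)
      next
        case 3
        have "(norm (x, z) - norm x) * (norm (x, z) + norm x) = z ^ 2"
        proof -
          have "norm (x, z) ^ 2 = norm x ^ 2 + z ^ 2" by (simp add: norm_Pair)
          then show ?thesis by (simp add: algebra_simps power2_eq_square)
        qed
        moreover have "(norm (x, z) - norm x) * t \<le> (norm (x, z) - norm x) * (norm (x, z) + norm x)"
          using n 3(1) by (intro mult_left_mono) (auto intro: add_increasing2)
        ultimately have "norm (x, z) - norm x \<le> z ^ 2 / t" by (simp add: le_divide_eq)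
        then have 1: "\<bar>?h - ?k\<bar> \<le> L * (z ^ 2 / t)"
          using n by (intro order_trans[OF L(2)] mult_left_mono L(1)) auto
        have "norm (x, z) \<le> r + 1"
          using norm_Pair_le[of x z] 3(2) z by simp
        then have "\<bar>?h - ?k\<bar> * norm (x, z) \<le> L * (z ^ 2 / t) * (r + 1)"
          using 1 L(1) by (intro mult_mono) auto
        then show ?thesis by (simp add: ac_simps)
      qed
    qed
    \<comment> \<open>Neither point lies below height \<open>z\<close>, so the Lipschitz constant
      valid above \<open>z\<close> may be used.\<close>
    have le: "z \<le> factor y * z" for y
      using mult_right_mono[OF factor_bounds(1)[of y], of z] z by simp
    have "\<bar>?v (stretch (x, z)) - ?v (?k *\<^sub>R (x, z))\<bar> \<le>
        (real DIM('a) + 2 * s) / z * dist (stretch (x, z)) (?k *\<^sub>R (x, z))"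
      using lipschitz_onD[OF extension_lipschitz[OF z(1)], of "stretch (x, z)" "?k *\<^sub>R (x, z)"] le
      by (simp add: stretch_def dist_real_def)
    also have "dist (stretch (x, z)) (?k *\<^sub>R (x, z)) = \<bar>?h - ?k\<bar> * norm (x, z)"
      unfolding dist_norm stretch_def by (simp only: scaleR_left_diff_distrib[symmetric] norm_scaleR)
    also have "(real DIM('a) + 2 * s) / z * (\<bar>?h - ?k\<bar> * norm (x, z)) \<le>
        (real DIM('a) + 2 * s) / z * (L * (r + 1) / t * z ^ 2)"
      using hh z s by (intro mult_left_mono) auto
    also have "\<dots> = K * z" using z by (simp add: K_def power2_eq_square)
    finally show ?thesis .
  qed
  \<comment> \<open>The factor is at most \<open>?\<kappa>\<close>, so images of the layer have base
    points in the ball of radius \<open>?\<kappa> * R\<close> and heights below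
    \<open>?\<kappa> * \<epsilon>\<close>.\<close>
  have I_le: "?I \<epsilon> \<le> ennreal (K * \<epsilon> * \<epsilon>) * emeasure lborel (ball (0::'a) R) +
      ennreal C * (\<integral>\<^sup>+\<zeta>\<in>{0<..<?\<kappa> * \<epsilon>}. ?g \<zeta> \<partial>lborel)" if \<epsilon>: "0 < \<epsilon>" "\<epsilon> < 1" for \<epsilon>
  proof -
    let ?k = "\<lambda>x::'a. factor (norm x)"
    have "?I \<epsilon> = (\<integral>\<^sup>+X\<in>ball 0 R \<times> {0<..<\<epsilon>}. ennreal \<bar>?v (stretch X) - ?u (stretch (fst X))\<bar> \<partial>lborel)"
      by (rule nn_integral_completion)
    also have "\<dots> \<le> (\<integral>\<^sup>+X. ennreal (K * \<epsilon>) * indicator (ball 0 R \<times> {0<..<\<epsilon>}) X +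
        ?F (stretch (fst X)) (?k (fst X) * snd X) * indicator (ball 0 R \<times> {0<..<\<epsilon>}) X \<partial>lborel)"
    proof (rule nn_integral_mono)
      fix X :: "'a \<times> real"
      show "ennreal \<bar>?v (stretch X) - ?u (stretch (fst X))\<bar> * indicator (ball 0 R \<times> {0<..<\<epsilon>}) X \<le>
        ennreal (K * \<epsilon>) * indicator (ball 0 R \<times> {0<..<\<epsilon>}) X +
        ?F (stretch (fst X)) (?k (fst X) * snd X) * indicator (ball 0 R \<times> {0<..<\<epsilon>}) X"
      proof (cases "X \<in> ball 0 R \<times> {0<..<\<epsilon>}")
        case True
        obtain x z where X: "X = (x, z)" by (cases X)
        with True have z: "0 < z" "z < \<epsilon>" by auto
        have "\<bar>?v (stretch X) - ?u (stretch x)\<bar> \<le> K * z + \<bar>?v (stretch x, ?k x * z) - ?u (stretch x)\<bar>"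
          using near[of z x] z \<epsilon> by (simp add: X stretch_def)
        also have "\<dots> \<le> K * \<epsilon> + \<bar>?v (stretch x, ?k x * z) - ?u (stretch x)\<bar>"
          using z K by (intro add_right_mono mult_left_mono) auto
        finally show ?thesis using True K \<epsilon> by (simp add: X flip: ennreal_plus)
      qed simp
    qed
    also have "\<dots> = ennreal (K * \<epsilon>) * emeasure lborel (ball (0::'a) R \<times> {0<..<\<epsilon>}) +
      (\<integral>\<^sup>+X. ?F (stretch (fst X)) (?k (fst X) * snd X) * indicator (ball 0 R \<times> {0<..<\<epsilon>}) X \<partial>lborel)"
    proof (subst nn_integral_add)
      have [measurable]: "ball (0::'a) R \<times> {0<..<\<epsilon>} \<in> sets borel"
        by (intro borel_open open_Times) auto
      show "(\<lambda>X. ennreal (K * \<epsilon>) * indicator (ball (0::'a) R \<times> {0<..<\<epsilon>}) X) \<in> borel_measurable lborel"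
        by measurable
      show "(\<lambda>X. ?F (stretch (fst X)) (?k (fst X) * snd X) * indicator (ball (0::'a) R \<times> {0<..<\<epsilon>}) X) \<in> borel_measurable lborel"
        by measurable
    qed (simp add: nn_integral_cmult open_Times)
    also have "emeasure lborel (ball (0::'a) R \<times> {0<..<\<epsilon>}) = emeasure lborel (ball (0::'a) R) * ennreal \<epsilon>"
      using \<epsilon> by (simp add: lborel_prod[symmetric] lborel.emeasure_pair_measure_Times)
    also have "(\<integral>\<^sup>+X. ?F (stretch (fst X)) (?k (fst X) * snd X) * indicator (ball 0 R \<times> {0<..<\<epsilon>}) X \<partial>lborel) =
        (\<integral>\<^sup>+x. (\<integral>\<^sup>+z. ?F (stretch x) (?k x * z) * indicator (ball 0 R \<times> {0<..<\<epsilon>}) (x, z) \<partial>lborel) \<partial>lborel)"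
    proof -
      have [measurable]: "ball (0::'a) R \<times> {0<..<\<epsilon>} \<in> sets borel"
        by (intro borel_open open_Times) auto
      have "(\<lambda>X. ?F (stretch (fst X)) (?k (fst X) * snd X) * indicator (ball 0 R \<times> {0<..<\<epsilon>}) X)
          \<in> borel_measurable (lborel \<Otimes>\<^sub>M lborel)"
        unfolding lborel_prod by measurable
      from lborel.nn_integral_fst[OF this] show ?thesis
        unfolding lborel_prod by simp
    qed
    also have "\<dots> \<le> (\<integral>\<^sup>+x. (\<integral>\<^sup>+\<zeta>. ?F (stretch x) \<zeta> * indicator {0<..<?\<kappa> * \<epsilon>} \<zeta> * indicator (ball 0 (?\<kappa> * R)) (stretch x) \<partial>lborel) \<partial>lborel)"
    proof (rule nn_integral_mono)
      fix x :: 'a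
      let ?f = "\<lambda>\<zeta>. ?F (stretch x) \<zeta> * indicator {0<..<?\<kappa> * \<epsilon>} \<zeta> * indicator (ball 0 (?\<kappa> * R)) (stretch x)"
      have h0: "0 < ?k x" "1 \<le> ?k x" "?k x \<le> ?\<kappa>" using factor_bounds by auto
      have "(\<integral>\<^sup>+z. ?F (stretch x) (?k x * z) * indicator (ball 0 R \<times> {0<..<\<epsilon>}) (x, z) \<partial>lborel) \<le> (\<integral>\<^sup>+z. ?f (?k x *\<^sub>R z) \<partial>lborel)"
      proof (rule nn_integral_mono)
        fix z
        have "?k x * z < ?\<kappa> * \<epsilon>" if "0 < z" "z < \<epsilon>"
          using h0 that by (intro mult_le_less_imp_less) auto
        moreover have "norm (stretch x) < ?\<kappa> * R" if "norm x < R"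
          unfolding norm_stretch using h0 that by (intro mult_le_less_imp_less) auto
        ultimately show "?F (stretch x) (?k x * z) * indicator (ball 0 R \<times> {0<..<\<epsilon>}) (x, z) \<le> ?f (?k x *\<^sub>R z)"
          using h0 by (auto simp: indicator_def)
      qed
      \<comment> \<open>The factor is at least 1, so inserting the Jacobian of the height variable
        only increases the integral.\<close>
      also have "\<dots> \<le> ennreal (?k x ^ DIM(real)) * (\<integral>\<^sup>+z. ?f (?k x *\<^sub>R z) \<partial>lborel)"
        using mult_right_mono[of 1 "ennreal (?k x ^ DIM(real))" "\<integral>\<^sup>+z. ?f (?k x *\<^sub>R z) \<partial>lborel"] h0(2) by simp
      also have "\<dots> = (\<integral>\<^sup>+\<zeta>. ?f \<zeta> \<partial>lborel)"
        by (rule nn_integral_lborel_scale[symmetric, OF _ h0(1)]) measurable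
      finally show "(\<integral>\<^sup>+z. ?F (stretch x) (?k x * z) * indicator (ball 0 R \<times> {0<..<\<epsilon>}) (x, z) \<partial>lborel) \<le> (\<integral>\<^sup>+\<zeta>. ?f \<zeta> \<partial>lborel)" .
    qed
    also have "\<dots> = (\<integral>\<^sup>+\<zeta>. (\<integral>\<^sup>+x. ?F (stretch x) \<zeta> * indicator {0<..<?\<kappa> * \<epsilon>} \<zeta> * indicator (ball 0 (?\<kappa> * R)) (stretch x) \<partial>lborel) \<partial>lborel)"
      by (rule lborel_pair.Fubini') measurable
    also have "\<dots> \<le> (\<integral>\<^sup>+\<zeta>. ennreal C * (\<integral>\<^sup>+y. ?F y \<zeta> * indicator {0<..<?\<kappa> * \<epsilon>} \<zeta> * indicator (ball 0 (?\<kappa> * R)) y \<partial>lborel) \<partial>lborel)"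
      by (intro nn_integral_mono C(2)) measurable
    also have "\<dots> = (\<integral>\<^sup>+\<zeta>. ennreal C * (?g \<zeta> * indicator {0<..<?\<kappa> * \<epsilon>} \<zeta>) \<partial>lborel)"
      by (intro nn_integral_cong arg_cong2[where f="(*)"] refl) (auto simp: indicator_def)
    also have "\<dots> = ennreal C * (\<integral>\<^sup>+\<zeta>\<in>{0<..<?\<kappa> * \<epsilon>}. ?g \<zeta> \<partial>lborel)"
      by (rule nn_integral_cmult) measurable
    finally show ?thesis
      using \<epsilon> K by (simp add: ennreal_mult' mult_ac add_mono)
  qed
  show "((\<lambda>\<epsilon>. ennreal (1 / \<epsilon>) * ?I \<epsilon>) \<longlongrightarrow> 0) (at_right 0)"
  proof (rule order_tendstoI)
    fix b :: ennreal assume "0 < b"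
    then obtain \<beta> where \<beta>: "0 < \<beta>" "ennreal \<beta> < b"
      by (rule ennreal_pos_real_between)
    \<comment> \<open>Chosen so that the slice term contributes at most half of
      \<open>\<beta>\<close>; \<open>e0\<close> does the same for the displacement term. The added 1
      keeps both denominators positive when the constants vanish.\<close>
    define \<eta> where "\<eta> = \<beta> / (2 * (C * ?\<kappa> + 1))"
    have C\<kappa>: "0 \<le> C * ?\<kappa>" using C(1) by simp
    have \<eta>: "0 < \<eta>" using \<beta>(1) C\<kappa> by (simp add: \<eta>_def add_nonneg_pos)
    have "eventually (\<lambda>z. ?g z < ennreal \<eta>) (at_right 0)"
      using extension_slice_tendsto[OF s E, of "?\<kappa> * R"] \<eta> by (intro order_tendstoD) auto
    then obtain d where d: "0 < d" "\<And>z. 0 < z \<Longrightarrow> z < d \<Longrightarrow> ?g z < ennreal \<eta>"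
      unfolding eventually_at_right_field by auto
    define V where "V = measure lborel (ball (0::'a) R)"
    have V: "emeasure lborel (ball (0::'a) R) = ennreal V" "0 \<le> V"
      using emeasure_lborel_ball_finite[of "0::'a" R] by (auto simp: V_def emeasure_eq_ennreal_measure)
    define e0 where "e0 = min (min 1 (d / ?\<kappa>)) (\<beta> / (2 * (K * V + 1)))"
    have KV: "0 \<le> K * V" using K V by simp
    have e0: "0 < e0" using d \<beta>(1) KV by (auto simp: e0_def add_nonneg_pos)
    have "ennreal (1 / \<epsilon>) * ?I \<epsilon> < b" if \<epsilon>: "0 < \<epsilon>" "\<epsilon> < e0" for \<epsilon>
    proof -
      have \<epsilon>1: "\<epsilon> < 1" "?\<kappa> * \<epsilon> < d" "K * \<epsilon> * V \<le> \<beta> / 2"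
      proof -
        show "\<epsilon> < 1" "?\<kappa> * \<epsilon> < d"
          using \<epsilon> by (auto simp: e0_def less_divide_eq field_simps)
        have "\<epsilon> * (2 * (K * V + 1)) < \<beta>"
          using \<epsilon>(2) KV by (simp add: e0_def less_divide_eq add_nonneg_pos)
        moreover have "0 \<le> \<epsilon>" using \<epsilon> by simp
        ultimately show "K * \<epsilon> * V \<le> \<beta> / 2" by (simp add: algebra_simps)
      qed
      have "(\<integral>\<^sup>+\<zeta>\<in>{0<..<?\<kappa> * \<epsilon>}. ?g \<zeta> \<partial>lborel) \<le> (\<integral>\<^sup>+\<zeta>. ennreal \<eta> * indicator {0<..<?\<kappa> * \<epsilon>} \<zeta> \<partial>lborel)"
        using d(2) \<epsilon>1 by (intro nn_integral_mono) (force simp: indicator_def intro: less_imp_le)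
      also have "\<dots> = ennreal (\<eta> * (?\<kappa> * \<epsilon>))"
        using \<epsilon> \<eta> by (simp add: nn_integral_cmult ennreal_mult'[symmetric])
      finally have "?I \<epsilon> \<le> ennreal (K * \<epsilon> * \<epsilon>) * ennreal V + ennreal C * ennreal (\<eta> * (?\<kappa> * \<epsilon>))"
        using I_le[OF \<epsilon>(1) \<epsilon>1(1)] unfolding V(1) by (meson add_left_mono mult_left_mono order_trans zero_le)
      also have "\<dots> = ennreal (K * \<epsilon> * \<epsilon> * V + C * (\<eta> * (?\<kappa> * \<epsilon>)))"
        unfolding ennreal_mult''[OF V(2), symmetric] ennreal_mult'[OF C(1), symmetric]
        using K V(2) C(1) \<eta> \<epsilon> by (intro ennreal_plus[symmetric]) auto
      finally have "ennreal (1 / \<epsilon>) * ?I \<epsilon> \<le> ennreal (1 / \<epsilon>) * ennreal (K * \<epsilon> * \<epsilon> * V + C * (\<eta> * (?\<kappa> * \<epsilon>)))"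
        by (rule mult_left_mono) simp
      also have "\<dots> = ennreal (K * \<epsilon> * V + C * ?\<kappa> * \<eta>)"
      proof -
        have "1 / \<epsilon> * (K * \<epsilon> * \<epsilon> * V + C * (\<eta> * (?\<kappa> * \<epsilon>))) = K * \<epsilon> * V + C * ?\<kappa> * \<eta>"
          using \<epsilon> by (simp add: field_simps)
        then show ?thesis using \<epsilon> by (simp add: ennreal_mult'[symmetric])
      qed
      also have "\<dots> \<le> ennreal \<beta>"
      proof (rule ennreal_leI)
        have "C * ?\<kappa> * \<eta> \<le> \<beta> / 2"
          using C\<kappa> \<beta>(1) by (simp add: \<eta>_def divide_simps add_nonneg_pos)
        then show "K * \<epsilon> * V + C * ?\<kappa> * \<eta> \<le> \<beta>" using \<epsilon>1(3) by linarith
      qed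
      finally show ?thesis using \<beta>(2) by (rule le_less_trans)
    qed
    then show "eventually (\<lambda>\<epsilon>. ennreal (1 / \<epsilon>) * ?I \<epsilon> < b) (at_right 0)"
      unfolding eventually_at_right_field using e0 by blast
  qed simp
qed

section \<open>Competitors\<close>

text \<open>With \<open>\<nu>\<close> the inner normal at \<open>p\<close>, the ball is locally the
  region above the lower hemisphere \<open>- sqrt (R^2 - norm y ^ 2)\<close>.\<close>

lemma bounded_lipschitz_domain_ball:
  assumes R: "0 < R"
  shows "bounded_lipschitz_domain (ball (0::'b::euclidean_space) R)"
  unfolding bounded_lipschitz_domain_def
proof (intro conjI ballI)
  fix p :: 'b assume "p \<in> frontier (ball 0 R)"
  then have p: "norm p = R" using R by (simp add: frontier_ball)
  define \<nu> where "\<nu> = - (1 / R) *\<^sub>R p"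
  have \<nu>: "norm \<nu> = 1" "\<nu> \<bullet> \<nu> = 1" using p R by (auto simp: \<nu>_def dot_square_norm)
  have p\<nu>: "p = - R *\<^sub>R \<nu>" using R by (simp add: \<nu>_def)
  \<comment> \<open>Truncating the norm at \<open>R / 2\<close> keeps the root at least
    \<open>R / 2\<close>, so that the graph is defined on the whole hyperplane and has slope at most
    1.\<close>
  define m where "m y = min (norm y) (R / 2)" for y :: 'b
  define g where "g y = - sqrt (R\<^sup>2 - (m y)\<^sup>2)" for y :: 'b
  have m: "0 \<le> m y" "m y \<le> R / 2" for y using R by (auto simp: m_def)
  have ge: "(R / 2)\<^sup>2 \<le> R\<^sup>2 - (m y)\<^sup>2" for y
  proof -
    have "(m y)\<^sup>2 \<le> (R / 2)\<^sup>2" using m by (intro power_mono)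
    moreover have "0 \<le> R\<^sup>2" by simp
    ultimately show ?thesis by (simp add: power_divide) (smt (verit) zero_le_power2)
  qed
  have sq: "R / 2 \<le> sqrt (R\<^sup>2 - (m y)\<^sup>2)" for y
    using ge[of y] R by (intro real_le_rsqrt)
  have lip: "1-lipschitz_on {y. y \<bullet> \<nu> = 0} g"
  proof (rule lipschitz_onI)
    fix x y :: 'b
    let ?X = "sqrt (R\<^sup>2 - (m x)\<^sup>2)" and ?Y = "sqrt (R\<^sup>2 - (m y)\<^sup>2)"
    have nn: "0 \<le> R\<^sup>2 - (m z)\<^sup>2" for z using ge[of z] by (meson order_trans zero_le_power2)
    have "(?X - ?Y) * (?X + ?Y) = ?X\<^sup>2 - ?Y\<^sup>2" by (simp add: algebra_simps power2_eq_square)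
    also have "\<dots> = (m y - m x) * (m y + m x)"
      using nn by (simp add: algebra_simps power2_eq_square)
    finally have "\<bar>?X - ?Y\<bar> * \<bar>?X + ?Y\<bar> = \<bar>m y - m x\<bar> * \<bar>m y + m x\<bar>"
      by (simp only: abs_mult[symmetric])
    moreover have "\<bar>?X + ?Y\<bar> = ?X + ?Y" "\<bar>m y + m x\<bar> = m y + m x"
      using sq[of x] sq[of y] R m(1)[of x] m(1)[of y] by auto
    ultimately have eq: "\<bar>?X - ?Y\<bar> * (?X + ?Y) = \<bar>m y - m x\<bar> * (m y + m x)"
      by (simp only:)
    have "\<bar>?X - ?Y\<bar> * R \<le> \<bar>?X - ?Y\<bar> * (?X + ?Y)"
      using sq[of x] sq[of y] by (intro mult_left_mono) auto
    also have "\<dots> \<le> \<bar>m y - m x\<bar> * R"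
      unfolding eq using m(2)[of x] m(2)[of y] by (intro mult_left_mono) auto
    finally have "\<bar>?X - ?Y\<bar> \<le> \<bar>m y - m x\<bar>" using R by simp
    also have "\<dots> \<le> \<bar>norm y - norm x\<bar>" by (auto simp: m_def)
    also have "\<dots> \<le> norm (x - y)" using norm_triangle_ineq3[of x y] by (simp add: abs_minus_commute)
    finally show "dist (g x) (g y) \<le> 1 * dist x y"
      by (simp add: g_def dist_real_def dist_norm abs_minus_commute)
  qed simp
  have "ball 0 R \<inter> ball p (R / 2) = {x \<in> ball p (R / 2). g (x - (x \<bullet> \<nu>) *\<^sub>R \<nu>) < x \<bullet> \<nu>}"
  proof -
    have "norm x < R \<longleftrightarrow> g (x - (x \<bullet> \<nu>) *\<^sub>R \<nu>) < x \<bullet> \<nu>" if x: "x \<in> ball p (R / 2)" for x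
    proof -
      let ?y = "x - (x \<bullet> \<nu>) *\<^sub>R \<nu>" and ?b = "x \<bullet> \<nu>"
      have orth: "?y \<bullet> \<nu> = 0" using \<nu> by (simp add: inner_diff_left)
      have pyth: "norm (?y + c *\<^sub>R \<nu>) ^ 2 = norm ?y ^ 2 + c ^ 2" for c
        using orth \<nu>(2) by (simp add: power2_norm_eq_inner inner_add_left inner_add_right inner_commute
            power2_eq_square[of c])
      have x2: "norm x ^ 2 = norm ?y ^ 2 + ?b ^ 2" using pyth[of ?b] by simp
      have "x - p = ?y + (?b + R) *\<^sub>R \<nu>" by (simp add: p\<nu> algebra_simps)
      then have "norm (x - p) ^ 2 = norm ?y ^ 2 + (?b + R) ^ 2" by (simp only: pyth)
      moreover have "norm (x - p) ^ 2 < (R / 2) ^ 2"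
        using x R by (intro power_strict_mono) (auto simp: dist_norm norm_minus_commute)
      ultimately have lt: "norm ?y ^ 2 < (R / 2) ^ 2" "(?b + R) ^ 2 < (R / 2) ^ 2"
        by (smt (verit) zero_le_power2)+
      \<comment> \<open>Closeness to \<open>p\<close> makes the truncation inactive and the normal
        component negative, so only the lower hemisphere is met and squaring is an
        equivalence.\<close>
      have yR: "norm ?y < R / 2" using power2_less_imp_less[OF lt(1)] R by simp
      have bR: "\<bar>?b + R\<bar> < R / 2" using power2_less_imp_less[of "\<bar>?b + R\<bar>" "R / 2"] lt(2) R by simp
      have b: "?b < 0" using bR R by linarith
      have my: "m ?y = norm ?y" using yR by (simp add: m_def)
      have "norm x < R \<longleftrightarrow> norm x ^ 2 < R ^ 2"
        using R by (metis norm_ge_zero power2_less_imp_less power_strict_mono less_imp_le zero_less_numeral)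
      also have "\<dots> \<longleftrightarrow> (- ?b) ^ 2 < R ^ 2 - norm ?y ^ 2" unfolding x2 by auto
      also have "\<dots> \<longleftrightarrow> - ?b < sqrt (R ^ 2 - norm ?y ^ 2)"
      proof
        assume "(- ?b) ^ 2 < R ^ 2 - norm ?y ^ 2"
        then show "- ?b < sqrt (R ^ 2 - norm ?y ^ 2)" by (rule real_less_rsqrt)
      next
        assume "- ?b < sqrt (R ^ 2 - norm ?y ^ 2)"
        then have "(- ?b) ^ 2 < sqrt (R ^ 2 - norm ?y ^ 2) ^ 2"
          using b by (intro power_strict_mono) auto
        also have "\<dots> = R ^ 2 - norm ?y ^ 2"
          using ge[of ?y] unfolding my by (intro real_sqrt_pow2) (meson order_trans zero_le_power2)
        finally show "(- ?b) ^ 2 < R ^ 2 - norm ?y ^ 2" .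
      qed
      also have "\<dots> \<longleftrightarrow> g ?y < ?b" unfolding g_def my by auto
      finally show ?thesis .
    qed
    then show ?thesis by auto
  qed
  with \<nu>(1) R lip have "norm \<nu> = 1 \<and> 0 < R / 2 \<and> 1-lipschitz_on {y. y \<bullet> \<nu> = 0} g \<and>
      ball 0 R \<inter> ball p (R / 2) = {x \<in> ball p (R / 2). g (x - (x \<bullet> \<nu>) *\<^sub>R \<nu>) < x \<bullet> \<nu>}"
    by simp
  then show "\<exists>\<nu> g L \<delta>. norm \<nu> = 1 \<and> 0 < \<delta> \<and> L-lipschitz_on {y. y \<bullet> \<nu> = 0} g \<and>
      ball 0 R \<inter> ball p \<delta> = {x \<in> ball p \<delta>. (g (x - (x \<bullet> \<nu>) *\<^sub>R \<nu>) :: real) < x \<bullet> \<nu>}"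
    by (intro exI)
qed auto

section \<open>Finiteness of nonlocal energies under the stretch\<close>

definition gagliardo :: "real \<Rightarrow> ('a::euclidean_space \<Rightarrow> real) \<Rightarrow> 'a set \<Rightarrow> 'a set \<Rightarrow> ennreal" where
  "gagliardo s u A B = (\<integral>\<^sup>+x\<in>A. (\<integral>\<^sup>+y\<in>B.
     ennreal (\<bar>u x - u y\<bar> ^ 2 / norm (x - y) powr (real DIM('a) + s)) \<partial>lborel) \<partial>lborel)"

lemma J1_eq_gagliardo:
  "J1 s u = gagliardo s u (ball 0 1) (ball 0 1) + 2 * gagliardo s u (- ball 0 1) (ball 0 1)"
  by (simp add: J1_def gagliardo_def nn_integral_completion)

context radial_stretch
begin

text \<open>The Lipschitz bound on the stretch costs a power of \<open>L\<close> in the kernel, and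
  changing each of the two variables costs the constant \<open>C\<close>. Pairs with equal images
  have a zero numerator.\<close>

lemma gagliardo_stretch_finite:
  fixes u :: "'a::euclidean_space \<Rightarrow> real"
  assumes u [measurable]: "u \<in> borel_measurable borel" and AB [measurable]: "A \<in> sets borel" "B \<in> sets borel"
    and inv: "\<And>x. x \<in> A \<Longrightarrow> stretch x \<in> A" "\<And>x. x \<in> B \<Longrightarrow> stretch x \<in> B"
    and s: "0 < s" and fin: "gagliardo s u A B < \<infinity>"
  shows "gagliardo s (\<lambda>x. u (stretch x)) A B < \<infinity>"
proof -
  let ?p = "real DIM('a) + s"
  let ?K = "\<lambda>x y. ennreal (\<bar>u x - u y\<bar> ^ 2 / norm (x - y) powr ?p)"
  obtain C where C: "0 \<le> C" "\<And>f :: 'a \<Rightarrow> ennreal. f \<in> borel_measurable borel \<Longrightarrow>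
    (\<integral>\<^sup>+X. f (stretch X) \<partial>lborel) \<le> ennreal C * (\<integral>\<^sup>+Y. f Y \<partial>lborel)"
    by (rule nn_integral_stretch_le[where 'b='a]) (rule that)
  obtain L where L: "0 < L" "\<And>X Y::'a. norm (stretch X - stretch Y) \<le> L * norm (X - Y)"
    using stretch_lipschitz by blast
  have K_le: "ennreal (\<bar>u (stretch x) - u (stretch y)\<bar> ^ 2 / norm (x - y) powr ?p) \<le>
      ennreal (L powr ?p) * ?K (stretch x) (stretch y)" for x y
  proof (cases "stretch x = stretch y")
    case False
    then have n: "0 < norm (stretch x - stretch y)" "0 < norm (x - y)" by auto
    have "norm (stretch x - stretch y) powr ?p \<le> L powr ?p * norm (x - y) powr ?p"
      using L s by (subst powr_mult[symmetric]) (auto intro!: powr_mono2)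
    then have "1 / norm (x - y) powr ?p \<le> L powr ?p / norm (stretch x - stretch y) powr ?p"
      using n by (simp add: field_simps)
    then have "\<bar>u (stretch x) - u (stretch y)\<bar> ^ 2 * (1 / norm (x - y) powr ?p) \<le>
        \<bar>u (stretch x) - u (stretch y)\<bar> ^ 2 * (L powr ?p / norm (stretch x - stretch y) powr ?p)"
      by (rule mult_left_mono) simp
    then show ?thesis
      by (subst ennreal_mult[symmetric]) (auto intro!: ennreal_leI simp: mult.commute)
  qed simp
  have inner: "(\<integral>\<^sup>+y\<in>B. ennreal (\<bar>u (stretch x) - u (stretch y)\<bar> ^ 2 / norm (x - y) powr ?p) \<partial>lborel) \<le>
      ennreal (L powr ?p) * (ennreal C * (\<integral>\<^sup>+y\<in>B. ?K (stretch x) y \<partial>lborel))" for x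
  proof -
    have "(\<integral>\<^sup>+y\<in>B. ennreal (\<bar>u (stretch x) - u (stretch y)\<bar> ^ 2 / norm (x - y) powr ?p) \<partial>lborel) \<le>
        (\<integral>\<^sup>+y. ennreal (L powr ?p) * (?K (stretch x) (stretch y) * indicator B (stretch y)) \<partial>lborel)"
      using K_le[of x] inv(2) by (intro nn_integral_mono) (auto simp: indicator_def)
    also have "\<dots> = ennreal (L powr ?p) * (\<integral>\<^sup>+y. ?K (stretch x) (stretch y) * indicator B (stretch y) \<partial>lborel)"
      by (rule nn_integral_cmult) measurable
    also have "\<dots> \<le> ennreal (L powr ?p) * (ennreal C * (\<integral>\<^sup>+y\<in>B. ?K (stretch x) y \<partial>lborel))"
    proof (rule mult_left_mono)
      have "(\<lambda>y. ?K (stretch x) y * indicator B y) \<in> borel_measurable borel" by measurable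
      then show "(\<integral>\<^sup>+y. ?K (stretch x) (stretch y) * indicator B (stretch y) \<partial>lborel) \<le>
          ennreal C * (\<integral>\<^sup>+y\<in>B. ?K (stretch x) y \<partial>lborel)"
        by (rule C(2))
    qed simp
    finally show ?thesis .
  qed
  have "gagliardo s (\<lambda>x. u (stretch x)) A B \<le>
    (\<integral>\<^sup>+x. ennreal (L powr ?p) * (ennreal C * ((\<integral>\<^sup>+y\<in>B. ?K (stretch x) y \<partial>lborel) * indicator A (stretch x))) \<partial>lborel)"
    unfolding gagliardo_def using inner inv(1)
    by (intro nn_integral_mono) (auto simp: indicator_def)
  also have "\<dots> = ennreal (L powr ?p) * (ennreal C * (\<integral>\<^sup>+x. (\<integral>\<^sup>+y\<in>B. ?K (stretch x) y \<partial>lborel) * indicator A (stretch x) \<partial>lborel))"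
    by (subst nn_integral_cmult, measurable, subst nn_integral_cmult, measurable)
  also have "\<dots> \<le> ennreal (L powr ?p) * (ennreal C * (ennreal C * gagliardo s u A B))"
    unfolding gagliardo_def
  proof (intro mult_left_mono)
    have "(\<lambda>x. (\<integral>\<^sup>+y\<in>B. ?K x y \<partial>lborel) * indicator A x) \<in> borel_measurable borel" by measurable
    then show "(\<integral>\<^sup>+x. (\<integral>\<^sup>+y\<in>B. ?K (stretch x) y \<partial>lborel) * indicator A (stretch x) \<partial>lborel) \<le>
        ennreal C * (\<integral>\<^sup>+x\<in>A. (\<integral>\<^sup>+y\<in>B. ?K x y \<partial>lborel) \<partial>lborel)"
      by (rule C(2))
  qed simp_all
  also have "\<dots> < \<infinity>" using fin by (simp add: ennreal_mult_less_top)
  finally show ?thesis .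
qed

text \<open>For \<open>r < 1\<close> the stretch maps the unit ball and its complement into
  themselves, so both parts of \<open>J1\<close> are covered.\<close>

lemma J1_stretch_finite:
  fixes u :: "'a::euclidean_space \<Rightarrow> real"
  assumes u: "u \<in> borel_measurable borel" and s: "0 < s" and fin: "J1 s u < \<infinity>" and r: "r < 1"
  shows "J1 s (\<lambda>x. u (stretch x)) < \<infinity>"
proof -
  have inv: "norm (stretch x) < 1 \<longleftrightarrow> norm x < 1" for x :: 'a
  proof (cases "norm x < r")
    case True
    with norm_stretch_less[of x] r show ?thesis by auto
  qed (simp add: stretch_outside)
  have fin': "gagliardo s u (ball 0 1) (ball 0 1) < \<infinity>" "gagliardo s u (- ball 0 1) (ball 0 1) < \<infinity>"
    using fin unfolding J1_eq_gagliardo by (auto simp: ennreal_mult_less_top)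
  have [simp]: "- ball (0::'a) 1 \<in> sets borel" by (intro borel_comp) simp
  have "gagliardo s (\<lambda>x. u (stretch x)) (ball 0 1) (ball 0 1) < \<infinity>"
    using inv by (intro gagliardo_stretch_finite[OF u _ _ _ _ s fin'(1)]) auto
  moreover have "gagliardo s (\<lambda>x. u (stretch x)) (- ball 0 1) (ball 0 1) < \<infinity>"
    using inv by (intro gagliardo_stretch_finite[OF u _ _ _ _ s fin'(2)]) auto
  ultimately show ?thesis unfolding J1_eq_gagliardo by (auto simp: ennreal_mult_less_top)
qed

end

section \<open>Gradient and energy of the stretched extension\<close>

definition dirichlet :: "real \<Rightarrow> 'a::euclidean_space set \<Rightarrow> real \<Rightarrow> ennreal" where
  "dirichlet s E r = (\<integral>\<^sup>+X\<in>half_ball r. ennreal (snd X powr (1 - s) *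
     norm (gradient (extension s (phase E)) X) ^ 2) \<partial>lborel)"

lemma half_ball_eq: "0 < r \<Longrightarrow> half_ball r = upper_half_space \<inter> ball (0 :: 'a::euclidean_space \<times> real) r"
proof -
  assume r: "0 < r"
  have "norm X < r \<longleftrightarrow> norm (fst X) ^ 2 + snd X ^ 2 < r ^ 2" for X :: "'a \<times> real"
  proof -
    have "norm X < r \<longleftrightarrow> sqrt (norm (fst X) ^ 2 + snd X ^ 2) < sqrt (r ^ 2)"
      using r by (simp add: norm_prod_def)
    then show ?thesis by (simp only: real_sqrt_less_iff)
  qed
  then show ?thesis by (auto simp: half_ball_def upper_half_space_def)
qed

context radial_stretch
begin

lemma GDERIV_extension_stretch:
  fixes E :: "'a::euclidean_space set"
  assumes s: "0 < s" and E: "E \<in> sets borel"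
    and X: "0 < snd X" "norm X \<noteq> t" "norm X \<noteq> r"
  obtains G where "GDERIV (\<lambda>X. extension s (phase E) (stretch X)) X :> G"
    "norm G \<le> factor (norm X) * norm (gradient (extension s (phase E)) (stretch X))"
proof -
  interpret bounded_datum s "phase E" by (rule phase_bounded_datum[OF s E])
  let ?h = "factor (norm X)" and ?g = "ext_gradient (stretch X)"
  have sX: "0 < snd (stretch X)" using X(1) by (simp add: stretch_def)
  obtain c where c: "-1 \<le> c" "c \<le> 0"
    "(stretch has_derivative (\<lambda>Y. ?h *\<^sub>R (Y + (c * (sgn X \<bullet> Y)) *\<^sub>R sgn X))) (at X)"
    by (rule has_derivative_stretch[OF X(2,3)])
  \<comment> \<open>The derivative of the stretch is a symmetric linear map, so the chain rule
    applies that same map to the gradient at the image point.\<close>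
  define G where "G = ?h *\<^sub>R (?g + (c * (sgn X \<bullet> ?g)) *\<^sub>R sgn X)"
  have "GDERIV (\<lambda>X. extension s (phase E) (stretch X)) X :> G"
  proof -
    have "((\<lambda>X. extension s (phase E) (stretch X)) has_derivative
        (\<lambda>Y. (?h *\<^sub>R (Y + (c * (sgn X \<bullet> Y)) *\<^sub>R sgn X)) \<bullet> ?g)) (at X)"
      by (rule has_derivative_compose[OF c(3)]) (use GDERIV_extension[OF sX] in \<open>simp add: gderiv_def\<close>)
    moreover have "(?h *\<^sub>R (Y + (c * (sgn X \<bullet> Y)) *\<^sub>R sgn X)) \<bullet> ?g = Y \<bullet> G" for Y
      by (simp add: G_def inner_add_left inner_add_right inner_commute algebra_simps)
    ultimately show ?thesis by (simp add: gderiv_def)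
  qed
  moreover have "norm G \<le> ?h * norm ?g"
  proof -
    have X0: "X \<noteq> 0" using X(1) by auto
    have e: "sgn X \<bullet> sgn X = 1" using X0 by (simp add: dot_square_norm norm_sgn)
    let ?i = "sgn X \<bullet> ?g"
    \<comment> \<open>The coefficient \<open>c * (c + 2)\<close> is nonpositive for \<open>c\<close>
      between -1 and 0, so the radial correction can only shorten the gradient.\<close>
    have "norm (?g + (c * ?i) *\<^sub>R sgn X) ^ 2 = norm ?g ^ 2 + c * (c + 2) * ?i ^ 2"
    proof -
      have "norm (g + k *\<^sub>R v) ^ 2 = norm g ^ 2 + 2 * k * (v \<bullet> g) + k ^ 2 * (v \<bullet> v)" for g v :: "'a \<times> real" and k
        unfolding power2_norm_eq_inner
        by (simp add: inner_add_left inner_add_right inner_commute[of g v] power2_eq_square algebra_simps)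
      then show ?thesis by (simp only: e) (simp add: power2_eq_square algebra_simps)
    qed
    also have "\<dots> \<le> norm ?g ^ 2"
      using c by (simp add: mult_nonpos_nonneg)
    finally have "norm (?g + (c * ?i) *\<^sub>R sgn X) \<le> norm ?g"
      by (rule power2_le_imp_le) simp
    then show ?thesis by (simp add: G_def mult_left_mono less_imp_le)
  qed
  moreover have "gradient (extension s (phase E)) (stretch X) = ?g"
    by (rule gradient_extension[OF sX])
  ultimately show thesis by (intro that[of G]) auto
qed

text \<open>The factor is at least 1, so heights never decrease and the region above
  \<open>z\<close> is mapped into itself, where the extension is Lipschitz.\<close>

lemma extension_stretch_lipschitz:
  fixes E :: "'a::euclidean_space set"
  assumes s: "0 < s" and E: "E \<in> sets borel" and z: "0 < z"
  shows "\<exists>L. L-lipschitz_on {X. z \<le> snd X} (\<lambda>X. extension s (phase E) (stretch X))"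
proof -
  interpret bounded_datum s "phase E" by (rule phase_bounded_datum[OF s E])
  obtain L where L: "0 < L" "\<And>X Y::'a \<times> real. norm (stretch X - stretch Y) \<le> L * norm (X - Y)"
    using stretch_lipschitz by blast
  have sn: "z \<le> snd (stretch X)" if "z \<le> snd X" for X :: "'a \<times> real"
    using mult_mono[OF factor_bounds(1)[of "norm X"] that] z by (simp add: stretch_def less_imp_le)
  have "L-lipschitz_on {X. z \<le> snd X} (stretch :: 'a \<times> real \<Rightarrow> _)"
    using L by (intro lipschitz_onI) (auto simp: dist_norm)
  moreover have "((real DIM('a) + 2 * s) / z)-lipschitz_on (stretch ` {X. z \<le> snd X}) (extension s (phase E))"
    by (rule lipschitz_on_subset[OF extension_lipschitz[OF z]]) (use sn in auto)
  ultimately show ?thesis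
    by (blast intro: lipschitz_on_compose2)
qed

end

lemma dirichlet_mono: "0 < \<rho> \<Longrightarrow> \<rho> \<le> r \<Longrightarrow> dirichlet s E \<rho> \<le> dirichlet s E r"
  unfolding dirichlet_def
  by (intro nn_integral_mono mult_left_mono) (auto simp: half_ball_eq indicator_def)

lemma sphere_null_lborel: "{X :: 'b::euclidean_space. norm X = r} \<in> null_sets lborel"
proof -
  have "{X :: 'b. norm X = r} = sphere 0 r" by (auto simp: dist_norm)
  moreover have "sphere (0::'b) r \<in> null_sets lebesgue"
    using negligible_sphere[of "0::'b" r] by (simp add: negligible_iff_null_sets)
  ultimately show ?thesis by (simp add: null_sets_completion_iff)
qed

text \<open>The two energies are known to be finite on the half ball of radius \<open>r\<close>,
  while \<open>U\<close> is larger. Representing the signed density by two functions supported in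
  the half ball avoids subtracting possibly infinite energies on \<open>U\<close>.\<close>

lemma set_integrable_LINT_diff_of_nn_integrals:
  fixes f g :: "'b::euclidean_space \<Rightarrow> real"
  assumes [measurable]: "f \<in> borel_measurable borel" "g \<in> borel_measurable borel" "h \<in> borel_measurable borel"
    "U \<in> sets borel"
    and nonneg: "\<And>X. 0 \<le> f X" "\<And>X. 0 \<le> g X"
    and fin: "(\<integral>\<^sup>+X. f X \<partial>lborel) < \<infinity>" "(\<integral>\<^sup>+X. g X \<partial>lborel) < \<infinity>"
    and eq: "AE X in lborel. indicator U X * h X = f X - g X"
  shows "set_integrable lebesgue U h"
    and "(LINT X:U|lebesgue. h X) = enn2real (\<integral>\<^sup>+X. f X \<partial>lborel) - enn2real (\<integral>\<^sup>+X. g X \<partial>lborel)"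
proof -
  have i: "integrable lborel f" "integrable lborel g"
    using fin nonneg by (auto simp: integrable_iff_bounded)
  have "integrable lborel (\<lambda>X. f X - g X)" using i by simp
  then have ih: "integrable lborel (\<lambda>X. indicator U X * h X)"
    by (rule integrable_cong_AE_imp) (use eq in \<open>auto elim: eventually_mono\<close>)
  then show "set_integrable lebesgue U h"
    unfolding set_integrable_def by (simp add: integrable_completion)
  have "(LINT X:U|lebesgue. h X) = (LINT X|lborel. indicator U X * h X)"
    unfolding set_lebesgue_integral_def real_scaleR_def
  proof (rule integral_completion)
    show "(\<lambda>X. indicator U X * h X) \<in> borel_measurable lborel" by measurable
  qed
  also have "\<dots> = (LINT X|lborel. f X - g X)"
    by (rule integral_cong_AE) (use eq in \<open>measurable\<close>)
  also have "\<dots> = enn2real (\<integral>\<^sup>+X. f X \<partial>lborel) - enn2real (\<integral>\<^sup>+X. g X \<partial>lborel)"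
    using i nonneg by (simp add: integral_eq_nn_integral)
  finally show "(LINT X:U|lebesgue. h X) = enn2real (\<integral>\<^sup>+X. f X \<partial>lborel) - enn2real (\<integral>\<^sup>+X. g X \<partial>lborel)" .
qed

text \<open>One use of minimality, with the preimage of \<open>E\<close> under the stretch as the
  competing set. The extension constant bounds \<open>c\<close> times the change of
  \<open>J1\<close> by the change of energy, and minimality bounds that change below by
  \<open>- 8 * \<Lambda>\<close> times the volume of the ball of radius \<open>r\<close>.\<close>

lemma (in radial_stretch) dirichlet_le_stretch:
  fixes E :: "'a::euclidean_space set"
  assumes s: "0 < s" "s < 1" and q: "q = real DIM('a) - s" and r: "r < 1"
    and E [measurable]: "E \<in> sets borel" and J1: "J1 s (phase E) < \<infinity>"
    and const: "is_extension_const TYPE('a) s c"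
    and min: "\<And>F. F \<in> sets borel \<Longrightarrow> sym_diff E F \<subseteq> ball 0 1 \<Longrightarrow>
      J1 s (phase E) \<le> J1 s (phase F) + ennreal (8 * \<Lambda>) * emeasure lborel (sym_diff E F)"
    and \<Lambda>: "0 \<le> \<Lambda>" and fin: "dirichlet s E r < \<infinity>"
  shows "enn2real (dirichlet s E r) \<le> (t / a) powr q * enn2real (dirichlet s E a) +
      slope * (enn2real (dirichlet s E r) - enn2real (dirichlet s E a)) +
      8 * c * \<Lambda> * (measure lebesgue (ball (0::'a) 1) * r ^ DIM('a))"
proof -
  interpret bounded_datum s "phase E" by (rule phase_bounded_datum[OF s(1) E])
  let ?u = "phase E" and ?v = "extension s (phase E)" and ?H = "upper_half_space :: ('a \<times> real) set"
  define w where "w = (\<lambda>X :: 'a \<times> real. ?v (stretch X))"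
  define N where "N = {X :: 'a \<times> real. norm X = t} \<union> {X. norm X = r}"
  \<comment> \<open>On the two exceptional spheres and outside the half space the gradient is set to
    0, as the criterion for weak gradients demands.\<close>
  define G where "G X = (if X \<in> ?H - N then gradient w X else 0)" for X
  have N: "N \<in> null_sets lborel"
    unfolding N_def by (intro null_sets.Un sphere_null_lborel)
  have [measurable]: "N \<in> sets borel" using N by (auto simp: null_sets_def)
  have G: "GDERIV w X :> G X" "norm (G X) \<le> factor (norm X) * norm (gradient ?v (stretch X))"
    if "X \<in> ?H - N" for X
  proof -
    have X: "0 < snd X" "norm X \<noteq> t" "norm X \<noteq> r"
      using that by (auto simp: upper_half_space_def N_def)
    obtain G' where G': "GDERIV w X :> G'" "norm G' \<le> factor (norm X) * norm (gradient ?v (stretch X))"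
      using GDERIV_extension_stretch[OF s(1) E X] unfolding w_def by blast
    then have "G X = G'" using that gradient_eq by (auto simp: G_def)
    with G' show "GDERIV w X :> G X" "norm (G X) \<le> factor (norm X) * norm (gradient ?v (stretch X))"
      by auto
  qed
  have lip: "\<exists>L. L-lipschitz_on {X. z \<le> snd X} w" if "0 < z" for z
    unfolding w_def by (rule extension_stretch_lipschitz[OF s(1) E that])
  have G_borel [measurable]: "G \<in> borel_measurable borel"
    by (rule borel_measurable_GDERIV[OF open_upper_half_space continuous_on_upper_half_space_lipschitz[OF lip] _ G(1)])
       (auto simp: G_def)
  have G_out: "G X = gradient ?v X" if "X \<in> ?H" "r < norm X" for X
  proof -
    have X: "X \<in> ?H - N" using that less_trans[OF pos(5), of "norm X"] by (auto simp: N_def)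
    have "open (- cball (0 :: 'a \<times> real) r)" by (intro open_Compl closed_cball)
    then have "GDERIV w X :> ext_gradient X"
      using GDERIV_extension[of X] that unfolding gderiv_def upper_half_space_def
      by (intro has_derivative_transform_within_open[of ?v _ X UNIV "- cball 0 r" w])
         (auto simp: w_def stretch_outside)
    moreover have "gradient ?v X = ext_gradient X"
      using that by (intro gradient_extension) (simp add: upper_half_space_def)
    ultimately show ?thesis using X by (simp add: G_def gradient_eq)
  qed
  \<comment> \<open>Strictly between \<open>r\<close> and 1: the closed support must fit into the
    open set \<open>U\<close>, whose trace on the base must stay in the unit ball.\<close>
  define R where "R = (r + 1) / 2"
  have R: "r < R" "R < 1" "0 < R" using r pos(4) by (auto simp: R_def simp del: pos)
  define U where "U = ball (0 :: 'a \<times> real) R"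
  define F where "F = stretch -` E"
  have F [measurable]: "F \<in> sets borel"
    using measurable_sets[OF borel_measurable_stretch E] by (simp add: F_def)
  have vF: "phase F = (\<lambda>x. ?u (stretch x))"
    by (auto simp: fun_eq_iff phase_def F_def indicator_def)
  have J1F: "J1 s (phase F) < \<infinity>"
    unfolding vF by (rule J1_stretch_finite[OF u_borel s(1) J1 r])
  have EF: "sym_diff E F \<subseteq> ball 0 r"
  proof
    fix x assume x: "x \<in> sym_diff E F"
    show "x \<in> ball 0 r"
    proof (rule ccontr)
      assume "x \<notin> ball 0 r"
      then have "stretch x = x" by (intro stretch_outside) simp
      with x show False by (auto simp: F_def)
    qed
  qed
  have supp: "closure {X \<in> ?H. w X \<noteq> ?v X} \<subseteq> cball 0 r"
  proof (rule closure_minimal, rule subsetI)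
    fix X assume "X \<in> {X \<in> ?H. w X \<noteq> ?v X}"
    then have "stretch X \<noteq> X" by (auto simp: w_def)
    then show "X \<in> cball 0 r" using stretch_outside[of X] by force
  qed simp

  \<comment> \<open>Both energies are cut to the ball of radius \<open>r\<close>. Beyond it the two
    gradients coincide and the density on \<open>U\<close> is zero.\<close>
  define f where "f X = indicator (?H \<inter> ball 0 r) X * (snd X powr (1 - s) * norm (G X) ^ 2)" for X
  define g where "g X = indicator (?H \<inter> ball 0 r) X * (snd X powr (1 - s) * norm (ext_gradient X) ^ 2)" for X
  have [measurable]: "f \<in> borel_measurable borel" "g \<in> borel_measurable borel"
    unfolding f_def[abs_def] g_def[abs_def] by measurable
  have nonneg: "0 \<le> f X" "0 \<le> g X" for X by (auto simp: f_def g_def)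
  define k where "k Y = ennreal (indicator ?H Y * (snd Y powr (1 - s) * norm (ext_gradient Y) ^ 2))" for Y
  have [measurable]: "k \<in> borel_measurable borel" unfolding k_def[abs_def] by measurable
  have dir: "dirichlet s E \<rho> = (\<integral>\<^sup>+Y. k Y * indicator (ball 0 \<rho>) Y \<partial>lborel)" if "0 < \<rho>" for \<rho>
    unfolding dirichlet_def half_ball_eq[OF that]
    by (intro nn_integral_cong) (auto simp: k_def indicator_def upper_half_space_def gradient_extension)
  have g_int: "(\<integral>\<^sup>+X. g X \<partial>lborel) = dirichlet s E r"
    unfolding dir[OF pos(4)] by (intro nn_integral_cong) (auto simp: g_def k_def indicator_def)
  have fa: "dirichlet s E a < \<infinity>"
    using dirichlet_mono[of a r s E] fin by (auto intro: le_less_trans)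
  define Dr Da where "Dr = enn2real (dirichlet s E r)" and "Da = enn2real (dirichlet s E a)"
  have Dr: "dirichlet s E r = ennreal Dr" "0 \<le> Dr" and Da: "dirichlet s E a = ennreal Da" "0 \<le> Da"
    using fin fa by (auto simp: Dr_def Da_def less_top)
  have DaDr: "Da \<le> Dr"
    using dirichlet_mono[of a r s E] Dr Da by (simp add: ennreal_le_iff)
  have diff: "(\<integral>\<^sup>+Y. k Y * indicator (ball 0 r - ball 0 a) Y \<partial>lborel) = ennreal (Dr - Da)"
  proof -
    have "dirichlet s E r = (\<integral>\<^sup>+Y. k Y * indicator (ball 0 a) Y + k Y * indicator (ball 0 r - ball 0 a) Y \<partial>lborel)"
      unfolding dir[OF pos(4)] using less_trans[OF _ pos(7)]
      by (intro nn_integral_cong) (auto simp: indicator_def)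
    also have "\<dots> = dirichlet s E a + (\<integral>\<^sup>+Y. k Y * indicator (ball 0 r - ball 0 a) Y \<partial>lborel)"
      unfolding dir[OF pos(3)] by (rule nn_integral_add) measurable
    finally have eq: "ennreal Dr = ennreal Da + (\<integral>\<^sup>+Y. k Y * indicator (ball 0 r - ball 0 a) Y \<partial>lborel)"
      unfolding Dr(1) Da(1) .
    show ?thesis
    proof (cases "\<integral>\<^sup>+Y. k Y * indicator (ball 0 r - ball 0 a) Y \<partial>lborel")
      case (real i)
      then have "ennreal Dr = ennreal (Da + i)" using eq Da(2) by simp
      then have "Dr = Da + i" using Dr(2) Da(2) real by (subst (asm) ennreal_inj) auto
      then show ?thesis using real by simp
    qed (use eq in auto)
  qed
  have f_int: "(\<integral>\<^sup>+X. f X \<partial>lborel) \<le> ennreal ((t / a) powr q * Da + slope * (Dr - Da))"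
  proof -
    have "(\<integral>\<^sup>+X. f X \<partial>lborel) \<le>
        (\<integral>\<^sup>+X. ennreal (factor (norm X) powr (DIM('a \<times> real) - q)) * k (stretch X) * indicator (ball 0 r) X \<partial>lborel)"
    proof (rule nn_integral_mono)
      fix X :: "'a \<times> real"
      show "ennreal (f X) \<le> ennreal (factor (norm X) powr (DIM('a \<times> real) - q)) * k (stretch X) * indicator (ball 0 r) X"
      proof (cases "X \<in> ?H \<inter> ball 0 r \<and> X \<notin> N")
        case True
        let ?h = "factor (norm X)"
        have X: "0 < snd X" "X \<in> ?H - N" using True by (auto simp: upper_half_space_def)
        have sX: "snd (stretch X) = ?h * snd X" "stretch X \<in> ?H"
          using X by (auto simp: stretch_def upper_half_space_def)
        have "norm (G X) ^ 2 \<le> (?h * norm (ext_gradient (stretch X))) ^ 2"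
          using G(2)[OF X(2)] gradient_extension[of "stretch X"] sX X by (intro power_mono) auto
        then have "snd X powr (1 - s) * norm (G X) ^ 2 \<le>
            snd X powr (1 - s) * (?h * norm (ext_gradient (stretch X))) ^ 2"
          by (rule mult_left_mono) simp
        \<comment> \<open>Of the two powers from the gradient, \<open>1 - s\<close> are spent on
          replacing the height of \<open>X\<close> by that of its image.\<close>
        also have "\<dots> = ?h powr (1 + s) * ((?h * snd X) powr (1 - s) * norm (ext_gradient (stretch X)) ^ 2)"
        proof -
          have "?h powr (1 + s) * ?h powr (1 - s) = ?h\<^sup>2"
            using less_imp_le[OF factor_pos, of "norm X"] by (simp add: powr_add[symmetric])
          then show ?thesis using X(1)
            by (simp add: powr_mult power_mult_distrib less_imp_le mult.assoc[symmetric])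
        qed
        finally have "f X \<le> ?h powr (1 + s) * ((?h * snd X) powr (1 - s) * norm (ext_gradient (stretch X)) ^ 2)"
          using True by (simp add: f_def)
        moreover have "real DIM('a \<times> real) - q = 1 + s" by (simp add: q)
        ultimately show ?thesis
          using True sX by (simp only: k_def) (simp add: ennreal_mult'[symmetric] ennreal_leI)
      qed (auto simp: f_def G_def)
    qed
    also have "\<dots> = ennreal ((t / a) powr q) * ennreal Da + ennreal slope * ennreal (Dr - Da)"
      by (subst nn_integral_stretch) (simp_all add: dir[symmetric] diff Da(1))
    also have "\<dots> = ennreal ((t / a) powr q * Da + slope * (Dr - Da))"
      using Da(2) DaDr by (subst ennreal_plus) (auto simp: ennreal_mult')
    finally show ?thesis .
  qed
  have f_fin: "(\<integral>\<^sup>+X. f X \<partial>lborel) < \<infinity>"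
    using f_int by (rule le_less_trans) simp
  have UH: "U \<inter> ?H \<in> sets borel" by (auto simp: U_def)
  have dens: "AE X in lborel. indicator (U \<inter> ?H) X * (snd X powr (1 - s) * (norm (G X) ^ 2 - norm (ext_gradient X) ^ 2)) = f X - g X"
    using AE_not_in[OF N]
  proof eventually_elim
    case (elim X)
    then have "norm X \<noteq> r" by (auto simp: N_def)
    then consider "X \<notin> ?H" | "X \<in> ?H" "norm X < r" | "X \<in> ?H" "r < norm X" by fastforce
    then show ?case
    proof cases
      case 3
      then have "G X = ext_gradient X"
        using G_out gradient_extension[of X] by (simp add: upper_half_space_def)
      then show ?thesis using 3 by (simp add: f_def g_def)
    qed (use R in \<open>auto simp: f_def g_def U_def indicator_def algebra_simps\<close>)
  qed
  have meas_f: "f \<in> borel_measurable borel" and meas_g: "g \<in> borel_measurable borel"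
    and meas_d: "(\<lambda>X. snd X powr (1 - s) * (norm (G X) ^ 2 - norm (ext_gradient X) ^ 2)) \<in> borel_measurable borel"
    by measurable
  have g_fin: "(\<integral>\<^sup>+X. g X \<partial>lborel) < \<infinity>"
    using fin by (simp add: g_int)
  note int = set_integrable_LINT_diff_of_nn_integrals[OF meas_f meas_g meas_d UH nonneg f_fin g_fin dens]
  have dens_eq: "indicator (U \<inter> ?H) X *\<^sub>R ext_energy_density s ?u G X =
      indicator (U \<inter> ?H) X *\<^sub>R (snd X powr (1 - s) * (norm (G X) ^ 2 - norm (ext_gradient X) ^ 2))" for X
    by (auto simp: indicator_def ext_energy_density_def upper_half_space_def gradient_extension)
  have int': "set_integrable lebesgue (U \<inter> ?H) (ext_energy_density s ?u G)"
    "(LINT X:U \<inter> ?H|lebesgue. ext_energy_density s ?u G X) =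
      enn2real (\<integral>\<^sup>+X. f X \<partial>lborel) - Dr"
    using int unfolding set_integrable_def set_lebesgue_integral_def dens_eq g_int Dr_def by auto
  have "(U, w, G) \<in> competitors s ?u (phase F)"
    unfolding competitors_def mem_Collect_eq case_prod_conv
  proof (intro conjI)
    show "bounded_lipschitz_domain U" unfolding U_def by (rule bounded_lipschitz_domain_ball[OF R(3)])
    show "{x. (x, 0) \<in> U} \<subseteq> ball 0 1"
      using R by (auto simp: U_def norm_Pair)
    show "weak_gradient_on ?H w G"
      by (rule weak_gradient_on_upper_half_spaceI[OF lip N G(1)]) (auto simp: G_def)
    show "has_trace w (phase F)"
      unfolding vF w_def by (rule has_trace_stretch[OF s(1) E])
    show "compact (closure {X \<in> ?H. w X \<noteq> ?v X})"
      using supp by (meson bounded_cball bounded_subset closed_closure compact_eq_bounded_closed)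
    show "closure {X \<in> ?H. w X \<noteq> ?v X} \<subseteq> U"
      using supp R by (force simp: U_def)
    show "set_integrable lebesgue (U \<inter> ?H) (ext_energy_density s ?u G)" by (rule int'(1))
  qed
  then have le: "(INF (U, w, G)\<in>competitors s ?u (phase F).
      ereal (LINT X:U \<inter> ?H|lebesgue. ext_energy_density s ?u G X)) \<le>
      ereal (enn2real (\<integral>\<^sup>+X. f X \<partial>lborel) - Dr)"
    using int'(2) by (intro INF_lower2[where i="(U, w, G)"]) auto
  have meas: "?u \<in> borel_measurable lebesgue" "phase F \<in> borel_measurable lebesgue"
    by (auto intro!: measurable_completion)
  have "closure {x. ?u x - phase F x \<noteq> 0} \<subseteq> cball 0 r"
  proof (rule closure_minimal)
    show "{x. ?u x - phase F x \<noteq> 0} \<subseteq> cball 0 r"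
    proof
      fix x assume "x \<in> {x. ?u x - phase F x \<noteq> 0}"
      then have "x \<in> sym_diff E F" by (cases "x \<in> E"; cases "x \<in> F") (auto simp: phase_def)
      with EF have "x \<in> ball 0 r" by blast
      then show "x \<in> cball 0 r" by simp
    qed
  qed simp
  then have "closure {x. ?u x - phase F x \<noteq> 0} \<subseteq> ball 0 1" using r by force
  with const meas J1 J1F le have c: "0 < c"
    "c * (enn2real (J1 s (phase F)) - enn2real (J1 s ?u)) \<le> enn2real (\<integral>\<^sup>+X. f X \<partial>lborel) - Dr"
    unfolding is_extension_const_def
    by (auto simp: ereal_less_eq(3)[symmetric] simp del: ereal_less_eq(3))
  define V where "V = measure lebesgue (ball (0::'a) 1) * r ^ DIM('a)"
  have V: "0 \<le> V" by (simp add: V_def)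
  have "J1 s ?u \<le> J1 s (phase F) + ennreal (8 * \<Lambda>) * emeasure lborel (sym_diff E F)"
    using EF r by (intro min F) force
  also have "emeasure lborel (sym_diff E F) \<le> emeasure lborel (ball (0::'a) r)"
    by (rule emeasure_mono[OF EF]) simp
  also have "emeasure lborel (ball (0::'a) r) = ennreal V"
  proof -
    have "emeasure lborel (ball (0::'a) r) = ennreal (r ^ DIM('a)) * emeasure lborel (ball (0::'a) 1)"
      using emeasure_cone_sector[of "UNIV::'a set" r] emeasure_cone_sector[of "UNIV::'a set" 1] by simp
    then show ?thesis
      using emeasure_lborel_ball_finite[of "0::'a" 1]
      by (simp add: V_def emeasure_eq_ennreal_measure ennreal_mult' measure_completion mult.commute)
  qed
  finally have J1_le: "J1 s ?u \<le> J1 s (phase F) + ennreal (8 * \<Lambda>) * ennreal V"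
    by (simp add: add_left_mono mult_left_mono)
  have "enn2real (J1 s ?u) \<le> enn2real (J1 s (phase F)) + 8 * \<Lambda> * V"
  proof -
    obtain j1 where j1: "J1 s ?u = ennreal j1" "0 \<le> j1" using J1 by (cases "J1 s ?u") auto
    obtain j2 where j2: "J1 s (phase F) = ennreal j2" "0 \<le> j2" using J1F by (cases "J1 s (phase F)") auto
    have "ennreal j1 \<le> ennreal (j2 + 8 * \<Lambda> * V)"
      using J1_le \<Lambda> V j2(2) unfolding j1(1) j2(1) by (simp add: ennreal_mult')
    then have "j1 \<le> j2 + 8 * \<Lambda> * V" using j2 \<Lambda> V by (subst (asm) ennreal_le_iff) auto
    then show ?thesis using j1 j2 by simp
  qed
  then have "c * (- (8 * \<Lambda> * V)) \<le> c * (enn2real (J1 s (phase F)) - enn2real (J1 s ?u))"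
    using c(1) by (intro mult_left_mono) auto
  with c(2) have "Dr \<le> enn2real (\<integral>\<^sup>+X. f X \<partial>lborel) + 8 * c * \<Lambda> * V"
    by (simp add: mult.commute mult.left_commute)
  also have "enn2real (\<integral>\<^sup>+X. f X \<partial>lborel) \<le> (t / a) powr q * Da + slope * (Dr - Da)"
    using f_int Da(2) DaDr by (intro enn2real_leI) auto
  finally show ?thesis by (simp add: Dr_def Da_def V_def)
qed

section \<open>Monotonicity\<close>

text \<open>The limit \<open>t \<rightarrow> 0\<close> removes the energy of the small ball and
  turns the slope into \<open>r powr q / (r powr q - a powr q)\<close>.\<close>

lemma dirichlet_ratio_le:
  fixes E :: "'a::euclidean_space set"
  assumes s: "0 < s" "s < 1" and E: "E \<in> sets borel" and J1: "J1 s (phase E) < \<infinity>"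
    and const: "is_extension_const TYPE('a) s c"
    and min: "\<And>F. F \<in> sets borel \<Longrightarrow> sym_diff E F \<subseteq> ball 0 1 \<Longrightarrow>
      J1 s (phase E) \<le> J1 s (phase F) + ennreal (8 * \<Lambda>) * emeasure lborel (sym_diff E F)"
    and \<Lambda>: "0 \<le> \<Lambda>" and fin: "dirichlet s E r < \<infinity>"
    and a: "0 < a" "a < r" "r < 1" and q: "q = real DIM('a) - s"
  shows "enn2real (dirichlet s E a) * a powr (-q) \<le> enn2real (dirichlet s E r) * r powr (-q) +
      (a powr (-q) - r powr (-q)) * (8 * c * \<Lambda> * measure lebesgue (ball (0::'a) 1)) * r ^ DIM('a)"
proof -
  let ?Da = "enn2real (dirichlet s E a)" and ?Dr = "enn2real (dirichlet s E r)"
  let ?K = "8 * c * \<Lambda> * (measure lebesgue (ball (0::'a) 1) * r ^ DIM('a))"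
  have q0: "0 < q" using s(2) DIM_positive[where 'a='a] unfolding q by linarith
  have ev: "?Dr \<le> (t / a) powr q * ?Da + (r powr q - t powr q) / (r powr q - a powr q) * (?Dr - ?Da) + ?K"
    if t: "0 < t" "t < a" for t
  proof -
    interpret radial_stretch q t a r using q0 t a by unfold_locales
    show ?thesis
      using dirichlet_le_stretch[OF s q a(3) E J1 const min \<Lambda> fin] unfolding slope_def by simp
  qed
  have lim0: "((\<lambda>t. t powr q) \<longlongrightarrow> 0) (at_right 0)"
    using tendsto_powr'[of "\<lambda>t. t" 0 "at_right 0" "\<lambda>_. q" q] q0
    by (auto simp: eventually_at_filter tendsto_const)
  have lim1: "((\<lambda>t. (t / a) powr q) \<longlongrightarrow> 0) (at_right 0)"
  proof -
    have "((\<lambda>t. t powr q / a powr q) \<longlongrightarrow> 0 / a powr q) (at_right 0)"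
      using a by (intro tendsto_divide lim0 tendsto_const) auto
    moreover have "eventually (\<lambda>t. t powr q / a powr q = (t / a) powr q) (at_right 0)"
      using a by (intro eventually_at_right_less[THEN eventually_mono]) (simp add: powr_divide)
    ultimately show ?thesis by (simp add: Lim_transform_eventually)
  qed
  have ar: "a powr q < r powr q" using a q0 by (intro powr_less_mono2) auto
  have "?Dr \<le> 0 * ?Da + (r powr q - 0) / (r powr q - a powr q) * (?Dr - ?Da) + ?K"
  proof (rule tendsto_lowerbound)
    show "((\<lambda>t. (t / a) powr q * ?Da + (r powr q - t powr q) / (r powr q - a powr q) * (?Dr - ?Da) + ?K) \<longlongrightarrow>
      0 * ?Da + (r powr q - 0) / (r powr q - a powr q) * (?Dr - ?Da) + ?K) (at_right 0)"
      using ar by (intro tendsto_intros lim0 lim1) auto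
    show "eventually (\<lambda>t. ?Dr \<le> (t / a) powr q * ?Da + (r powr q - t powr q) / (r powr q - a powr q) * (?Dr - ?Da) + ?K) (at_right 0)"
      using eventually_at_right_real[OF a(1)] by eventually_elim (use ev in auto)
  qed simp
  \<comment> \<open>After clearing the denominator the two terms \<open>r powr q * ?Dr\<close>
    cancel. Dividing by \<open>a powr q * r powr q\<close> then produces the normalised
    energies.\<close>
  then have "?Dr * (r powr q - a powr q) \<le> r powr q * (?Dr - ?Da) + ?K * (r powr q - a powr q)"
    using ar by (simp add: field_simps)
  then have *: "?Da * r powr q \<le> ?Dr * a powr q + ?K * (r powr q - a powr q)"
    by (simp add: algebra_simps)
  have pos: "0 < a powr q" "0 < r powr q" using a by auto
  have "?Da / a powr q = ?Da * r powr q / (a powr q * r powr q)"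
    using pos by simp
  also have "\<dots> \<le> (?Dr * a powr q + ?K * (r powr q - a powr q)) / (a powr q * r powr q)"
    using * pos by (intro divide_right_mono) auto
  also have "\<dots> = ?Dr / r powr q + (1 / a powr q - 1 / r powr q) * ?K"
    using pos by (simp add: field_simps)
  finally show ?thesis
    by (simp add: powr_minus divide_inverse mult.assoc)
qed

text \<open>
  One step of length \<open>r - \<rho>\<close> gains at most the derivative of \<open>(q / s) K r\<^sup>s\<close> up to an error which
  telescopes over a partition and carries the mesh as a factor.
\<close>

lemma powr_step:
  assumes "0 < q" "0 < s" "s \<le> 1" "0 < \<rho>" "\<rho> < r" and n: "real n = q + s"
  shows "(\<rho> powr (-q) - r powr (-q)) * r ^ n \<le>
    (q / s) * (r powr s - \<rho> powr s) + q * (r - \<rho>) * r ^ n * (\<rho> powr (-q-1) - r powr (-q-1))"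
proof -
  \<comment> \<open>Both derivatives are decreasing up to sign conventions: the one of
    \<open>- x powr (-q)\<close> is bounded above by its value at \<open>\<rho>\<close>, the one of
    \<open>x powr s\<close> below by its value at \<open>r\<close>. The mismatch of these endpoints
    is the error term.\<close>
  obtain \<xi> where \<xi>: "\<rho> < \<xi>" "\<xi> < r" "- (r powr (-q)) - - (\<rho> powr (-q)) = (r - \<rho>) * (q * \<xi> powr (-q-1))"
    using MVT2[OF assms(5), of "\<lambda>x. - (x powr (-q))" "\<lambda>x. q * x powr (-q-1)"] assms
    by (force intro!: derivative_eq_intros)
  obtain \<eta> where \<eta>: "\<rho> < \<eta>" "\<eta> < r" "r powr s - \<rho> powr s = (r - \<rho>) * (s * \<eta> powr (s-1))"
    using MVT2[OF assms(5), of "\<lambda>x. x powr s" "\<lambda>x. s * x powr (s-1)"] assms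
    by (force intro!: derivative_eq_intros)
  have r: "0 < r" using assms by linarith
  have "\<xi> powr (-q-1) \<le> \<rho> powr (-q-1)"
    using \<xi> assms by (intro powr_mono2') auto
  then have "\<rho> powr (-q) - r powr (-q) \<le> (r - \<rho>) * (q * \<rho> powr (-q-1))"
    using \<xi>(3) assms mult_left_mono[of "q * \<xi> powr (-q-1)" "q * \<rho> powr (-q-1)" "r - \<rho>"] by simp
  then have 1: "(\<rho> powr (-q) - r powr (-q)) * r ^ n \<le> (r - \<rho>) * (q * \<rho> powr (-q-1)) * r ^ n"
    using r by (intro mult_right_mono) auto
  have "r powr (s-1) \<le> \<eta> powr (s-1)"
    using \<eta> assms by (intro powr_mono2') auto
  then have "(r - \<rho>) * (s * r powr (s-1)) \<le> r powr s - \<rho> powr s"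
    unfolding \<eta>(3) using assms by (intro mult_left_mono) auto
  then have 2: "(q / s) * ((r - \<rho>) * (s * r powr (s-1))) \<le> (q / s) * (r powr s - \<rho> powr s)"
    using assms by (intro mult_left_mono) auto
  \<comment> \<open>Here \<open>n = q + s\<close> enters: it makes the two main terms agree.\<close>
  have e: "r powr (s-1) = r ^ n * r powr (-q-1)"
    using r by (simp add: powr_realpow[symmetric] n powr_add[symmetric])
  have "q * (r - \<rho>) * (r ^ n * r powr (-q-1)) = (q / s) * ((r - \<rho>) * (s * r powr (s-1)))"
    unfolding e using assms by simp
  then have "q * (r - \<rho>) * (r ^ n * r powr (-q-1)) \<le> (q / s) * (r powr s - \<rho> powr s)"
    using 2 by linarith
  with 1 show ?thesis by (simp add: algebra_simps)
qed

text \<open>With \<open>N + 1\<close> equal steps the accumulated error is a fixed constant divided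
  by \<open>N + 1\<close>. No regularity of \<open>D\<close> is assumed, only the inequality between
  any two radii.\<close>

lemma monotone_from_steps:
  fixes D :: "real \<Rightarrow> real"
  assumes q: "0 < q" and s: "0 < s" "s \<le> 1" and n: "real n = q + s" and K: "0 \<le> K"
    and r: "0 < r1" "r1 < r2"
    and step: "\<And>\<rho> r. r1 \<le> \<rho> \<Longrightarrow> \<rho> < r \<Longrightarrow> r \<le> r2 \<Longrightarrow>
      D \<rho> * \<rho> powr (-q) \<le> D r * r powr (-q) + (\<rho> powr (-q) - r powr (-q)) * K * r ^ n"
  shows "D r1 * r1 powr (-q) + (q / s) * K * r1 powr s \<le> D r2 * r2 powr (-q) + (q / s) * K * r2 powr s"
proof -
  define g where "g r = D r * r powr (-q) + (q / s) * K * r powr s" for r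
  define e where "e r = r powr (-q-1)" for r :: real
  have e_anti: "e r \<le> e \<rho>" if "0 < \<rho>" "\<rho> < r" for \<rho> r
    unfolding e_def using that q by (intro powr_mono2') auto
  have gstep: "g \<rho> \<le> g r + K * (q * (r - \<rho>) * r2 ^ n * (e \<rho> - e r))"
    if h: "r1 \<le> \<rho>" "\<rho> < r" "r \<le> r2" for \<rho> r
  proof -
    have \<rho>: "0 < \<rho>" "0 < r" using r h by auto
    \<comment> \<open>Replacing \<open>r ^ n\<close> by its value at the right end makes the error
      telescope.\<close>
    have "r ^ n \<le> r2 ^ n" using h \<rho> by (intro power_mono) auto
    then have "q * (r - \<rho>) * r ^ n * (e \<rho> - e r) \<le> q * (r - \<rho>) * r2 ^ n * (e \<rho> - e r)"
      using q h e_anti[OF \<rho>(1) h(2)] by (intro mult_right_mono mult_left_mono) auto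
    then have "(\<rho> powr (-q) - r powr (-q)) * r ^ n \<le>
        (q / s) * (r powr s - \<rho> powr s) + q * (r - \<rho>) * r2 ^ n * (e \<rho> - e r)"
      using powr_step[OF q s \<rho>(1) h(2) n] unfolding e_def by linarith
    then have "K * ((\<rho> powr (-q) - r powr (-q)) * r ^ n) \<le>
        K * ((q / s) * (r powr s - \<rho> powr s) + q * (r - \<rho>) * r2 ^ n * (e \<rho> - e r))"
      using K by (rule mult_left_mono)
    moreover have "K * ((\<rho> powr (-q) - r powr (-q)) * r ^ n) = (\<rho> powr (-q) - r powr (-q)) * K * r ^ n"
      by simp
    moreover have "K * ((q / s) * (r powr s - \<rho> powr s) + q * (r - \<rho>) * r2 ^ n * (e \<rho> - e r)) =
        (q / s) * K * r powr s - (q / s) * K * \<rho> powr s + K * (q * (r - \<rho>) * r2 ^ n * (e \<rho> - e r))"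
      by (simp add: algebra_simps)
    ultimately show ?thesis using step[OF h] unfolding g_def by linarith
  qed
  define C where "C = K * q * (r2 - r1) * r2 ^ n * (e r1 - e r2)"
  have bound: "g r1 \<le> g r2 + C * inverse (real (Suc N))" for N
  proof -
    define h where "h = (r2 - r1) / real (Suc N)"
    have h: "0 < h" "r1 + real (Suc N) * h = r2" using r by (auto simp: h_def)
    have "g r1 \<le> g (r1 + real i * h) + K * (q * h * r2 ^ n * (e r1 - e (r1 + real i * h)))" if "i \<le> Suc N" for i
      using that
    proof (induction i)
      case 0
      then show ?case by simp
    next
      case (Suc i)
      let ?x = "r1 + real i * h" and ?y = "r1 + real (Suc i) * h"
      have y: "?y = ?x + h" by (simp add: algebra_simps)
      have "real (Suc i) * h \<le> real (Suc N) * h" using Suc.prems h by (intro mult_right_mono) auto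
      then have "?y \<le> r2" using h by linarith
      moreover have "r1 \<le> ?x" using h by simp
      moreover have "?x < ?y" using y h by simp
      ultimately have "g ?x \<le> g ?y + K * (q * (?y - ?x) * r2 ^ n * (e ?x - e ?y))"
        by (intro gstep)
      moreover have "?y - ?x = h" using y by simp
      moreover have "g r1 \<le> g ?x + K * (q * h * r2 ^ n * (e r1 - e ?x))" using Suc by simp
      ultimately have "g r1 \<le> g ?y + (K * (q * h * r2 ^ n * (e ?x - e ?y)) + K * (q * h * r2 ^ n * (e r1 - e ?x)))"
        by simp
      also have "K * (q * h * r2 ^ n * (e ?x - e ?y)) + K * (q * h * r2 ^ n * (e r1 - e ?x)) =
          K * (q * h * r2 ^ n * (e r1 - e ?y))"
        by (simp add: right_diff_distrib)
      finally show ?case .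
    qed
    from this[of "Suc N"] have "g r1 \<le> g r2 + K * (q * h * r2 ^ n * (e r1 - e r2))"
      using h(2) by simp
    also have "K * (q * h * r2 ^ n * (e r1 - e r2)) = C * inverse (real (Suc N))"
      by (simp add: C_def h_def divide_inverse)
    finally show ?thesis .
  qed
  have "(\<lambda>N. g r2 + C * inverse (real (Suc N))) \<longlonglongrightarrow> g r2 + C * 0"
    by (intro tendsto_add tendsto_mult tendsto_const LIMSEQ_inverse_real_of_nat)
  then have "g r1 \<le> g r2 + C * 0"
    by (rule tendsto_lowerbound) (use bound in \<open>auto intro: always_eventually\<close>)
  then show ?thesis by (simp add: g_def)
qed

lemma Phi_eq_dirichlet:
  "Phi s \<Lambda>h (E :: 'a::euclidean_space set) r = ennreal (r powr (s - real DIM('a))) * dirichlet s E r +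
     ennreal ((real DIM('a) - s) / s * measure lebesgue (ball (0::'a) 1) * \<Lambda>h * r powr s)"
  by (simp add: Phi_def dirichlet_def nn_integral_completion)

text \<open>If the energy at \<open>r2\<close> is infinite, so is the right side. Otherwise all
  energies up to \<open>r2\<close> are finite and the comparison takes place among real
  numbers.\<close>

lemma Phi_mono_unit_ball:
  fixes E :: "'a::euclidean_space set"
  assumes s: "0 < s" "s < 1" and E: "E \<in> sets borel" and J1: "J1 s (phase E) < \<infinity>"
    and const: "is_extension_const TYPE('a) s c"
    and min: "\<And>F. F \<in> sets borel \<Longrightarrow> sym_diff E F \<subseteq> ball 0 1 \<Longrightarrow>
      J1 s (phase E) \<le> J1 s (phase F) + ennreal (8 * \<Lambda>) * emeasure lborel (sym_diff E F)"
    and \<Lambda>: "0 \<le> \<Lambda>" and r: "0 < r1" "r1 < r2" "r2 < 1"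
  shows "Phi s (8 * c * \<Lambda>) E r1 \<le> Phi s (8 * c * \<Lambda>) E r2"
proof (cases "dirichlet s E r2 = \<infinity>")
  case True
  then have "Phi s (8 * c * \<Lambda>) E r2 = \<infinity>"
    using r by (simp add: Phi_eq_dirichlet ennreal_mult_top)
  then show ?thesis by simp
next
  case False
  define q where "q = real DIM('a) - s"
  have q0: "0 < q" using s(2) DIM_positive[where 'a='a] unfolding q_def by linarith
  have c: "0 < c" using const by (simp add: is_extension_const_def)
  let ?D = "\<lambda>r. enn2real (dirichlet s E r)"
  define K where "K = 8 * c * \<Lambda> * measure lebesgue (ball (0::'a) 1)"
  have K: "0 \<le> K" using c \<Lambda> by (simp add: K_def)
  have fin: "dirichlet s E r < \<infinity>" if "0 < r" "r \<le> r2" for r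
    using dirichlet_mono[OF that, of s E] False by (auto simp: less_top top_unique)
  have mono: "?D r1 * r1 powr (-q) + (q / s) * K * r1 powr s \<le> ?D r2 * r2 powr (-q) + (q / s) * K * r2 powr s"
  proof (rule monotone_from_steps[where n="DIM('a)"])
    show "?D \<rho> * \<rho> powr (-q) \<le> ?D r * r powr (-q) + (\<rho> powr (-q) - r powr (-q)) * K * r ^ DIM('a)"
      if h: "r1 \<le> \<rho>" "\<rho> < r" "r \<le> r2" for \<rho> r
      unfolding K_def using h r
      by (intro dirichlet_ratio_le[OF s E J1 const min \<Lambda> fin _ _ _ q_def]) auto
  qed (use q0 s K r in \<open>auto simp: q_def\<close>)
  have "Phi s (8 * c * \<Lambda>) E r = ennreal (?D r * r powr (-q) + (q / s) * K * r powr s)" if "0 < r" "r \<le> r2" for r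
  proof -
    have "ennreal (?D r) = dirichlet s E r" using fin[OF that] by (simp add: less_top)
    then have "Phi s (8 * c * \<Lambda>) E r = ennreal (r powr (-q)) * ennreal (?D r) + ennreal ((q / s) * K * r powr s)"
      by (simp add: Phi_eq_dirichlet q_def K_def ac_simps)
    also have "\<dots> = ennreal (?D r * r powr (-q) + (q / s) * K * r powr s)"
      using K q0 s by (subst ennreal_plus) (auto simp: ennreal_mult' mult.commute)
    finally show ?thesis .
  qed
  then show ?thesis using mono r by (simp add: ennreal_leI)
qed

section \<open>Perimeters, null sets and scaling\<close>

lemma interaction_cong_AE:
  fixes A B :: "'a::euclidean_space set"
  assumes "AE x in lborel. x \<in> A \<longleftrightarrow> x \<in> A'" "AE x in lborel. x \<in> B \<longleftrightarrow> x \<in> B'"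
  shows "interaction s A B = interaction s A' B'"
proof -
  let ?k = "\<lambda>x y. ennreal (1 / norm (x - y :: 'a) powr (real DIM('a) + s))"
  have "(\<integral>\<^sup>+y\<in>B. ?k x y \<partial>lborel) = (\<integral>\<^sup>+y\<in>B'. ?k x y \<partial>lborel)" for x
    by (rule nn_integral_cong_AE) (use assms(2) in \<open>auto simp: indicator_def\<close>)
  moreover have "(\<integral>\<^sup>+x\<in>A. (\<integral>\<^sup>+y\<in>B'. ?k x y \<partial>lborel) \<partial>lborel) = (\<integral>\<^sup>+x\<in>A'. (\<integral>\<^sup>+y\<in>B'. ?k x y \<partial>lborel) \<partial>lborel)"
    by (rule nn_integral_cong_AE) (use assms(1) in \<open>auto simp: indicator_def\<close>)
  ultimately show ?thesis
    by (simp add: interaction_def nn_integral_completion)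
qed

lemma frac_perimeter_cong_AE:
  fixes E :: "'a::euclidean_space set"
  assumes "AE x in lborel. x \<in> E \<longleftrightarrow> x \<in> E'"
  shows "frac_perimeter s E S = frac_perimeter s E' S"
  unfolding frac_perimeter_def
  by (intro arg_cong2[where f="(+)"] interaction_cong_AE) (use assms in \<open>auto elim: eventually_mono\<close>)

text \<open>The energy of ordered pairs that leave \<open>E\<close>, restricted to a window
  \<open>W\<close>. A predicate on pairs is used because the window of a perimeter, at least one
  point in \<open>S\<close>, is not a product of sets; splitting perimeters becomes splitting
  windows.\<close>

definition jump_energy :: "real \<Rightarrow> 'a::euclidean_space set \<Rightarrow> ('a \<Rightarrow> 'a \<Rightarrow> bool) \<Rightarrow> ennreal" where
  "jump_energy s E W = (\<integral>\<^sup>+x. (\<integral>\<^sup>+y. ennreal (1 / norm (x - y) powr (real DIM('a) + s)) *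
     (if x \<in> E \<and> y \<notin> E \<and> W x y then 1 else 0) \<partial>lborel) \<partial>lborel)"

lemma interaction_eq_lborel:
  fixes A B :: "'a::euclidean_space set"
  shows "interaction s A B = (\<integral>\<^sup>+x. (\<integral>\<^sup>+y. ennreal (1 / norm (x - y) powr (real DIM('a) + s)) *
     (if x \<in> A \<and> y \<in> B then 1 else 0) \<partial>lborel) \<partial>lborel)"
  unfolding interaction_def nn_integral_completion
proof (rule nn_integral_cong)
  fix x
  show "(\<integral>\<^sup>+y\<in>B. ennreal (1 / norm (x - y) powr (real DIM('a) + s)) \<partial>lborel) * indicator A x =
    (\<integral>\<^sup>+y. ennreal (1 / norm (x - y) powr (real DIM('a) + s)) * (if x \<in> A \<and> y \<in> B then 1 else 0) \<partial>lborel)"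
    by (cases "x \<in> A") (auto intro!: nn_integral_cong simp: indicator_def)
qed

lemma jump_energy_add:
  fixes E :: "'a::euclidean_space set"
  assumes [measurable]: "E \<in> sets borel"
    "Measurable.pred (borel \<Otimes>\<^sub>M borel) (\<lambda>p. W1 (fst p) (snd p))"
    "Measurable.pred (borel \<Otimes>\<^sub>M borel) (\<lambda>p. W2 (fst p) (snd p))"
    and disj: "\<And>x y. \<not> (W1 x y \<and> W2 x y)"
  shows "jump_energy s E (\<lambda>x y. W1 x y \<or> W2 x y) = jump_energy s E W1 + jump_energy s E W2"
proof -
  let ?f = "\<lambda>W x y. ennreal (1 / norm (x - y :: 'a) powr (real DIM('a) + s)) *
     (if x \<in> E \<and> y \<notin> E \<and> W x y then 1 else 0)"
  have m: "(\<lambda>p. ?f W1 (fst p) (snd p)) \<in> borel_measurable (borel \<Otimes>\<^sub>M borel)"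
    "(\<lambda>p. ?f W2 (fst p) (snd p)) \<in> borel_measurable (borel \<Otimes>\<^sub>M borel)"
    by measurable
  have mi: "?f W x \<in> borel_measurable lborel" and mo: "(\<lambda>x. \<integral>\<^sup>+y. ?f W x y \<partial>lborel) \<in> borel_measurable lborel"
    if m: "(\<lambda>p. ?f W (fst p) (snd p)) \<in> borel_measurable (borel \<Otimes>\<^sub>M borel)" for W x
  proof -
    show "?f W x \<in> borel_measurable lborel"
      using measurable_compose[OF measurable_Pair1'[of x borel borel, unfolded space_borel, OF UNIV_I] m,
          unfolded fst_conv snd_conv] unfolding measurable_lborel2 .
    have "(\<lambda>p. ?f W (fst p) (snd p)) \<in> borel_measurable (lborel \<Otimes>\<^sub>M lborel)"
      using m by (simp cong: measurable_cong_sets sets_pair_measure_cong)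
    then show "(\<lambda>x. \<integral>\<^sup>+y. ?f W x y \<partial>lborel) \<in> borel_measurable lborel"
      by (intro lborel.borel_measurable_nn_integral) (simp only: case_prod_beta')
  qed
  have "jump_energy s E (\<lambda>x y. W1 x y \<or> W2 x y) = (\<integral>\<^sup>+x. (\<integral>\<^sup>+y. ?f W1 x y + ?f W2 x y \<partial>lborel) \<partial>lborel)"
    unfolding jump_energy_def using disj by (intro nn_integral_cong) auto
  also have "\<dots> = (\<integral>\<^sup>+x. (\<integral>\<^sup>+y. ?f W1 x y \<partial>lborel) + (\<integral>\<^sup>+y. ?f W2 x y \<partial>lborel) \<partial>lborel)"
    by (intro nn_integral_cong nn_integral_add mi m)
  also have "\<dots> = jump_energy s E W1 + jump_energy s E W2"
    unfolding jump_energy_def by (intro nn_integral_add mo m)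
  finally show ?thesis .
qed

lemma frac_perimeter_eq_jump_energy:
  fixes E :: "'a::euclidean_space set"
  assumes [measurable]: "E \<in> sets borel" "S \<in> sets borel"
  shows "frac_perimeter s E S = jump_energy s E (\<lambda>x y. x \<in> S \<or> y \<in> S)"
proof -
  have "jump_energy s E (\<lambda>x y. x \<in> S \<or> y \<in> S) = jump_energy s E (\<lambda>x y. x \<in> S \<or> (x \<notin> S \<and> y \<in> S))"
    by (intro arg_cong2[where f="jump_energy s"]) (auto simp: fun_eq_iff)
  also have "\<dots> = jump_energy s E (\<lambda>x y. x \<in> S) + jump_energy s E (\<lambda>x y. x \<notin> S \<and> y \<in> S)"
    by (rule jump_energy_add) auto
  also have "\<dots> = frac_perimeter s E S"
    unfolding frac_perimeter_def interaction_eq_lborel jump_energy_def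
    by (intro arg_cong2[where f="(+)"] nn_integral_cong) auto
  finally show ?thesis by simp
qed

text \<open>The jump energy of pairs outside the smaller window is unaffected by changes inside it.\<close>

lemma frac_perimeter_diff_window:
  fixes E F :: "'a::euclidean_space set"
  assumes [measurable]: "E \<in> sets borel" "F \<in> sets borel" "B \<in> sets borel" "S \<in> sets borel"
    and BS: "B \<subseteq> S" and EF: "sym_diff E F \<subseteq> B"
  obtains D where "frac_perimeter s E S = frac_perimeter s E B + D" "frac_perimeter s F S = frac_perimeter s F B + D"
proof -
  let ?W = "\<lambda>x y. x \<notin> B \<and> y \<notin> B \<and> (x \<in> S \<or> y \<in> S)"
  have split: "frac_perimeter s A S = frac_perimeter s A B + jump_energy s A ?W"
    if [measurable]: "A \<in> sets borel" for A
  proof -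
    have "frac_perimeter s A S = jump_energy s A (\<lambda>x y. (x \<in> B \<or> y \<in> B) \<or> ?W x y)"
      unfolding frac_perimeter_eq_jump_energy[OF that assms(4)]
      using BS by (intro arg_cong2[where f="jump_energy s"]) (auto simp: fun_eq_iff)
    also have "\<dots> = jump_energy s A (\<lambda>x y. x \<in> B \<or> y \<in> B) + jump_energy s A ?W"
      by (rule jump_energy_add) auto
    finally show ?thesis
      unfolding frac_perimeter_eq_jump_energy[OF that assms(3)] .
  qed
  have "jump_energy s E ?W = jump_energy s F ?W"
    unfolding jump_energy_def using EF
    by (intro nn_integral_cong arg_cong2[where f="(*)"] refl) auto
  then show thesis using split[OF assms(1)] split[OF assms(2)] by (intro that) auto
qed

text \<open>The phase jumps by 2, hence the factor 4, and a pair can cross \<open>E\<close> in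
  either direction, hence the two terms.\<close>

lemma gagliardo_phase:
  fixes E :: "'a::euclidean_space set"
  assumes [measurable]: "E \<in> sets borel" "A \<in> sets borel" "B \<in> sets borel"
  shows "gagliardo s (phase E) A B = 4 * (interaction s (E \<inter> A) (- E \<inter> B) + interaction s (- E \<inter> A) (E \<inter> B))"
proof -
  let ?k = "\<lambda>x y. ennreal (1 / norm (x - y :: 'a) powr (real DIM('a) + s))"
  let ?f = "\<lambda>x y. ?k x y * (if x \<in> E \<inter> A \<and> y \<in> - E \<inter> B then 1 else 0)"
  let ?g = "\<lambda>x y. ?k x y * (if x \<in> - E \<inter> A \<and> y \<in> E \<inter> B then 1 else 0)"
  have [measurable]: "(\<lambda>p. ?f (fst p) (snd p)) \<in> borel_measurable (borel \<Otimes>\<^sub>M borel)"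
    "(\<lambda>p. ?g (fst p) (snd p)) \<in> borel_measurable (borel \<Otimes>\<^sub>M borel)"
    by measurable
  have pt: "ennreal (\<bar>phase E x - phase E y\<bar> ^ 2 / norm (x - y) powr (real DIM('a) + s)) * indicator B y * indicator A x =
      4 * (?f x y + ?g x y)" for x y
  proof -
    have "ennreal (4 / norm (x - y) powr (real DIM('a) + s)) = 4 * ?k x y"
      using ennreal_mult'[of 4 "1 / norm (x - y) powr (real DIM('a) + s)"] by simp
    then show ?thesis by (auto simp: phase_def indicator_def)
  qed
  have "gagliardo s (phase E) A B = (\<integral>\<^sup>+x. (\<integral>\<^sup>+y. ennreal (\<bar>phase E x - phase E y\<bar> ^ 2 / norm (x - y) powr (real DIM('a) + s)) * indicator B y * indicator A x \<partial>lborel) \<partial>lborel)"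
    unfolding gagliardo_def by (intro nn_integral_cong) (auto simp: indicator_def)
  also have "\<dots> = (\<integral>\<^sup>+x. (\<integral>\<^sup>+y. 4 * (?f x y + ?g x y) \<partial>lborel) \<partial>lborel)"
    unfolding pt ..
  also have "\<dots> = (\<integral>\<^sup>+x. 4 * ((\<integral>\<^sup>+y. ?f x y \<partial>lborel) + (\<integral>\<^sup>+y. ?g x y \<partial>lborel)) \<partial>lborel)"
    by (intro nn_integral_cong, subst nn_integral_cmult, measurable, subst nn_integral_add, measurable)
  also have "\<dots> = 4 * ((\<integral>\<^sup>+x. (\<integral>\<^sup>+y. ?f x y \<partial>lborel) \<partial>lborel) + (\<integral>\<^sup>+x. (\<integral>\<^sup>+y. ?g x y \<partial>lborel) \<partial>lborel))"
    by (subst nn_integral_cmult, measurable, subst nn_integral_add, measurable)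
  finally show ?thesis unfolding interaction_eq_lborel .
qed

lemma interaction_commute:
  fixes A B :: "'a::euclidean_space set"
  assumes [measurable]: "A \<in> sets borel" "B \<in> sets borel"
  shows "interaction s A B = interaction s B A"
proof -
  let ?k = "\<lambda>x y. ennreal (1 / norm (x - y :: 'a) powr (real DIM('a) + s))"
  have "interaction s A B = (\<integral>\<^sup>+x. (\<integral>\<^sup>+y. ?k x y * (if x \<in> A \<and> y \<in> B then 1 else 0) \<partial>lborel) \<partial>lborel)"
    by (rule interaction_eq_lborel)
  also have "\<dots> = (\<integral>\<^sup>+y. (\<integral>\<^sup>+x. ?k x y * (if x \<in> A \<and> y \<in> B then 1 else 0) \<partial>lborel) \<partial>lborel)"
    by (rule lborel_pair.Fubini') measurable
  also have "\<dots> = interaction s B A"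
    unfolding interaction_eq_lborel
    by (intro nn_integral_cong arg_cong2[where f="(*)"]) (auto simp: norm_minus_commute)
  finally show ?thesis .
qed

lemma interaction_add:
  fixes A B C :: "'a::euclidean_space set"
  assumes [measurable]: "A \<in> sets borel" "B \<in> sets borel" "C \<in> sets borel" and "B \<inter> C = {}"
  shows "interaction s A (B \<union> C) = interaction s A B + interaction s A C"
proof -
  let ?k = "\<lambda>x y. ennreal (1 / norm (x - y :: 'a) powr (real DIM('a) + s))"
  let ?f = "\<lambda>B x y. ?k x y * (if x \<in> A \<and> y \<in> B then 1 else 0)"
  have "interaction s A (B \<union> C) = (\<integral>\<^sup>+x. (\<integral>\<^sup>+y. ?f B x y + ?f C x y \<partial>lborel) \<partial>lborel)"
    unfolding interaction_eq_lborel using assms(4) by (intro nn_integral_cong) auto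
  also have "\<dots> = (\<integral>\<^sup>+x. (\<integral>\<^sup>+y. ?f B x y \<partial>lborel) + (\<integral>\<^sup>+y. ?f C x y \<partial>lborel) \<partial>lborel)"
    by (intro nn_integral_cong nn_integral_add) measurable
  also have "\<dots> = interaction s A B + interaction s A C"
    unfolding interaction_eq_lborel by (rule nn_integral_add) measurable
  finally show ?thesis .
qed

text \<open>Pairs inside the ball are counted in both orders, and pairs with one point outside carry
  the factor 2 of \<open>J1\<close>. Either way the squared jump 4 is doubled to 8.\<close>

lemma J1_phase:
  fixes E :: "'a::euclidean_space set"
  assumes [measurable]: "E \<in> sets borel"
  shows "J1 s (phase E) = 8 * frac_perimeter s E (ball 0 1)"
proof -
  let ?B = "ball (0::'a) 1" and ?I = "interaction s :: 'a set \<Rightarrow> 'a set \<Rightarrow> ennreal"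
  have [measurable]: "- E \<in> sets borel" "- ?B \<in> sets borel" by (auto intro!: borel_comp)
  let ?a = "?I (E \<inter> ?B) (- E \<inter> ?B)" and ?b = "?I (E \<inter> ?B) (- E \<inter> - ?B)" and ?c = "?I (E \<inter> - ?B) (- E \<inter> ?B)"
  have 1: "gagliardo s (phase E) ?B ?B = 8 * ?a"
  proof -
    have "?I (- E \<inter> ?B) (E \<inter> ?B) = ?a" by (rule interaction_commute) auto
    then have "gagliardo s (phase E) ?B ?B = 4 * (?a + ?a)" by (simp add: gagliardo_phase)
    also have "\<dots> = 8 * ?a" by (simp flip: mult_2 mult.assoc)
    finally show ?thesis .
  qed
  have 2: "gagliardo s (phase E) (- ?B) ?B = 4 * (?c + ?b)"
  proof -
    have "?I (- E \<inter> - ?B) (E \<inter> ?B) = ?b" by (rule interaction_commute) auto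
    then show ?thesis by (simp add: gagliardo_phase)
  qed
  have "- E = (- E \<inter> ?B) \<union> (- E \<inter> - ?B)" by auto
  then have "?I (E \<inter> ?B) (- E) = ?I (E \<inter> ?B) ((- E \<inter> ?B) \<union> (- E \<inter> - ?B))" by simp
  also have "\<dots> = ?a + ?b" by (rule interaction_add) auto
  finally have 3: "frac_perimeter s E ?B = (?a + ?b) + ?c"
    by (simp add: frac_perimeter_def)
  have "J1 s (phase E) = 8 * ?a + 2 * (4 * (?c + ?b))"
    unfolding J1_eq_gagliardo 1 2 ..
  also have "2 * (4 * (?c + ?b)) = 8 * (?c + ?b)" by (simp flip: mult.assoc)
  finally show ?thesis unfolding 3 by (simp add: distrib_left ac_simps)
qed

text \<open>Two Jacobians \<open>R ^ DIM('a)\<close> against the kernel, homogeneous of degree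
  \<open>- DIM('a) - s\<close>.\<close>

lemma frac_perimeter_scale:
  fixes E S :: "'a::euclidean_space set"
  assumes [measurable]: "E \<in> sets borel" "S \<in> sets borel" and R: "0 < R"
  shows "frac_perimeter s E S = ennreal (R powr (real DIM('a) - s)) * frac_perimeter s {x. R *\<^sub>R x \<in> E} {x. R *\<^sub>R x \<in> S}"
proof -
  let ?p = "real DIM('a) + s"
  have int: "interaction s A B = ennreal (R powr (real DIM('a) - s)) * interaction s {x. R *\<^sub>R x \<in> A} {x. R *\<^sub>R x \<in> B}"
    if [measurable]: "A \<in> sets borel" "B \<in> sets borel" for A B :: "'a set"
  proof -
    let ?f = "\<lambda>A B x y. ennreal (1 / norm (x - y :: 'a) powr ?p) * (if x \<in> A \<and> y \<in> B then 1 else 0)"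
    let ?A = "{x. R *\<^sub>R x \<in> A}" and ?B = "{x. R *\<^sub>R x \<in> B}" and ?Rn = "ennreal (R ^ DIM('a))"
    have [measurable]: "?A \<in> sets borel" "?B \<in> sets borel"
      by measurable
    have "interaction s A B = (\<integral>\<^sup>+x. (\<integral>\<^sup>+y. ?f A B x y \<partial>lborel) \<partial>lborel)"
      by (rule interaction_eq_lborel)
    also have "\<dots> = ?Rn * (\<integral>\<^sup>+x. (\<integral>\<^sup>+y. ?f A B (R *\<^sub>R x) y \<partial>lborel) \<partial>lborel)"
      by (rule nn_integral_lborel_scale[OF _ R]) measurable
    also have "\<dots> = ?Rn * (\<integral>\<^sup>+x. ?Rn * (\<integral>\<^sup>+y. ?f A B (R *\<^sub>R x) (R *\<^sub>R y) \<partial>lborel) \<partial>lborel)"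
      by (intro arg_cong2[where f="(*)"] nn_integral_cong refl nn_integral_lborel_scale R) measurable
    also have "\<dots> = ?Rn * (\<integral>\<^sup>+x. ?Rn * (\<integral>\<^sup>+y. ennreal (R powr (- ?p)) * ?f ?A ?B x y \<partial>lborel) \<partial>lborel)"
    proof -
      have "?f A B (R *\<^sub>R x) (R *\<^sub>R y) = ennreal (R powr (- ?p)) * ?f ?A ?B x y" for x y
      proof -
        have "norm (R *\<^sub>R x - R *\<^sub>R y) = R * norm (x - y)"
          using R by (simp flip: scaleR_diff_right)
        moreover have "1 / (R * w) powr ?p = R powr (- ?p) * (1 / w powr ?p)" if "0 \<le> w" for w
          using R that unfolding powr_minus by (simp add: powr_mult divide_inverse)
        ultimately have "ennreal (1 / norm (R *\<^sub>R x - R *\<^sub>R y) powr ?p) =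
            ennreal (R powr (- ?p)) * ennreal (1 / norm (x - y) powr ?p)"
          by (simp only: norm_ge_zero ennreal_mult'[OF powr_ge_zero])
        then show ?thesis by (simp only: mult.assoc mem_Collect_eq)
      qed
      then show ?thesis by simp
    qed
    also have "\<dots> = ?Rn * (?Rn * (ennreal (R powr (- ?p)) * (\<integral>\<^sup>+x. (\<integral>\<^sup>+y. ?f ?A ?B x y \<partial>lborel) \<partial>lborel)))"
    proof -
      have "(\<integral>\<^sup>+x. ?Rn * (\<integral>\<^sup>+y. ennreal (R powr (- ?p)) * ?f ?A ?B x y \<partial>lborel) \<partial>lborel) =
        (\<integral>\<^sup>+x. ?Rn * (ennreal (R powr (- ?p)) * (\<integral>\<^sup>+y. ?f ?A ?B x y \<partial>lborel)) \<partial>lborel)"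
        by (intro nn_integral_cong arg_cong2[where f="(*)"] refl nn_integral_cmult) measurable
      also have "\<dots> = ?Rn * (\<integral>\<^sup>+x. ennreal (R powr (- ?p)) * (\<integral>\<^sup>+y. ?f ?A ?B x y \<partial>lborel) \<partial>lborel)"
        by (rule nn_integral_cmult) measurable
      also have "(\<integral>\<^sup>+x. ennreal (R powr (- ?p)) * (\<integral>\<^sup>+y. ?f ?A ?B x y \<partial>lborel) \<partial>lborel) =
          ennreal (R powr (- ?p)) * (\<integral>\<^sup>+x. (\<integral>\<^sup>+y. ?f ?A ?B x y \<partial>lborel) \<partial>lborel)"
        by (rule nn_integral_cmult) measurable
      finally show ?thesis by simp
    qed
    also have "\<dots> = ?Rn * (?Rn * ennreal (R powr (- ?p))) * interaction s ?A ?B"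
      unfolding interaction_eq_lborel by (simp add: mult.assoc)
    also have "?Rn * (?Rn * ennreal (R powr (- ?p))) = ennreal (R powr (real DIM('a) - s))"
    proof -
      have "R ^ DIM('a) * (R ^ DIM('a) * R powr (- ?p)) = R powr (real DIM('a) - s)"
        using R by (simp add: powr_realpow[symmetric] powr_add[symmetric])
      then show ?thesis using R by (simp add: ennreal_mult'[symmetric])
    qed
    finally show ?thesis .
  qed
  show ?thesis
    unfolding frac_perimeter_def
    by (subst (1 2) int) (auto simp: distrib_left Collect_conj_eq Collect_neg_eq intro!: borel_comp sets.Int)
qed

section \<open>Null sets and scaling for the extension\<close>

lemma extension_cong_AE:
  fixes u v :: "'a::euclidean_space \<Rightarrow> real"
  assumes "u \<in> borel_measurable lebesgue" "v \<in> borel_measurable lebesgue" "AE x in lebesgue. u x = v x"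
  shows "extension s u = extension s v"
proof
  fix X :: "'a \<times> real"
  have [measurable]: "(\<lambda>y. poisson_kernel s (fst X - y) (snd X)) \<in> borel_measurable lebesgue"
    by (intro measurable_completion) simp
  show "extension s u X = extension s v X"
    unfolding extension_def using assms
    by (intro integral_cong_AE) (auto elim: eventually_mono)
qed

lemma LINT_lborel_scale:
  fixes f :: "'b::euclidean_space \<Rightarrow> real"
  assumes [measurable]: "f \<in> borel_measurable borel" and c: "0 < c"
  shows "(LINT x|lborel. f x) = c ^ DIM('b) * (LINT x|lborel. f (c *\<^sub>R x))"
proof -
  have "(LINT x|lborel. f x) = (LINT x|density (distr lborel borel (\<lambda>x. 0 + c *\<^sub>R x)) (\<lambda>_. \<bar>c\<bar> ^ DIM('b)). f x)"
    using c by (subst lborel_affine[of c 0]) auto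
  also have "\<dots> = (LINT x|lborel. c ^ DIM('b) * f (c *\<^sub>R x))"
    using c by (subst integral_density) (auto simp: integral_distr ennreal_power)
  finally show ?thesis by simp
qed

lemma poisson_kernel_scale2:
  assumes "0 < R" "0 < z"
  shows "R ^ DIM('a) * poisson_kernel s (R *\<^sub>R x) (R * z) = poisson_kernel s (x::'a::euclidean_space) z"
proof -
  have e: "(R * z) *\<^sub>R (x /\<^sub>R z) = R *\<^sub>R x" "z *\<^sub>R (x /\<^sub>R z) = x"
    using assms by (auto simp: mult.assoc)
  have "z ^ DIM('a) * (R ^ DIM('a) * poisson_kernel s (R *\<^sub>R x) (R * z)) = z ^ DIM('a) * poisson_kernel s x z"
    using poisson_kernel_scale[of "R * z" s "x /\<^sub>R z"] poisson_kernel_scale[of z s "x /\<^sub>R z"] assms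
    unfolding e by (simp add: power_mult_distrib mult.assoc mult.left_commute)
  then show ?thesis using assms by simp
qed

lemma extension_scale:
  fixes E :: "'a::euclidean_space set"
  assumes s: "0 < s" and E [measurable]: "E \<in> sets borel" and R: "0 < R" and X: "0 < snd X"
  shows "extension s (phase {x. R *\<^sub>R x \<in> E}) X = extension s (phase E) (R *\<^sub>R X)"
proof -
  let ?E = "{x. R *\<^sub>R x \<in> E}"
  have E': "?E \<in> sets borel"
    by measurable
  interpret A: bounded_datum s "phase E" by (rule phase_bounded_datum[OF s E])
  interpret B: bounded_datum s "phase ?E" by (rule phase_bounded_datum[OF s E'])
  have "extension s (phase E) (R *\<^sub>R X) =
      R ^ DIM('a) * (LINT y|lborel. poisson_kernel s (fst (R *\<^sub>R X) - R *\<^sub>R y) (snd (R *\<^sub>R X)) * phase E (R *\<^sub>R y))"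
    unfolding A.extension_eq_lborel by (rule LINT_lborel_scale[OF _ R]) measurable
  also have "\<dots> = (LINT y|lborel. R ^ DIM('a) * (poisson_kernel s (fst (R *\<^sub>R X) - R *\<^sub>R y) (snd (R *\<^sub>R X)) * phase E (R *\<^sub>R y)))"
    by simp
  also have "\<dots> = (LINT y|lborel. poisson_kernel s (fst X - y) (snd X) * phase ?E y)"
  proof (intro Bochner_Integration.integral_cong refl)
    fix y
    have "R ^ DIM('a) * poisson_kernel s (fst (R *\<^sub>R X) - R *\<^sub>R y) (snd (R *\<^sub>R X)) = poisson_kernel s (fst X - y) (snd X)"
      using poisson_kernel_scale2[OF R X, of s "fst X - y"] by (simp add: scaleR_diff_right)
    moreover have "phase E (R *\<^sub>R y) = phase ?E y" by (simp add: phase_def indicator_def)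
    ultimately show "R ^ DIM('a) * (poisson_kernel s (fst (R *\<^sub>R X) - R *\<^sub>R y) (snd (R *\<^sub>R X)) * phase E (R *\<^sub>R y)) =
        poisson_kernel s (fst X - y) (snd X) * phase ?E y"
      by (simp add: mult.assoc[symmetric])
  qed
  finally show ?thesis unfolding B.extension_eq_lborel by simp
qed

text \<open>With \<open>n = DIM('a)\<close>, the Jacobian gives \<open>n + 1\<close> powers of
  \<open>R\<close>, the weight \<open>1 - s\<close>, and passing to the gradient of the rescaled
  extension takes away 2, in total \<open>n - s\<close>.\<close>

lemma dirichlet_scale:
  fixes E :: "'a::euclidean_space set"
  assumes s: "0 < s" and E [measurable]: "E \<in> sets borel" and R: "0 < R" and r: "0 < r"
  shows "dirichlet s E (R * r) = ennreal (R powr (real DIM('a) - s)) * dirichlet s {x. R *\<^sub>R x \<in> E} r"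
proof -
  let ?E = "{x. R *\<^sub>R x \<in> E}"
  have E': "?E \<in> sets borel"
    by measurable
  interpret A: bounded_datum s "phase E" by (rule phase_bounded_datum[OF s E])
  interpret B: bounded_datum s "phase ?E" by (rule phase_bounded_datum[OF s E'])
  have Rr: "0 < R * r" using R r by simp
  have grad: "B.ext_gradient X = R *\<^sub>R A.ext_gradient (R *\<^sub>R X)" if X: "X \<in> upper_half_space" for X
  proof -
    have X0: "0 < snd X" "0 < snd (R *\<^sub>R X)" using X R by (auto simp: upper_half_space_def)
    have "((\<lambda>X. extension s (phase E) (R *\<^sub>R X)) has_derivative (\<lambda>h. (R *\<^sub>R h) \<bullet> A.ext_gradient (R *\<^sub>R X))) (at X)"
    proof -
      have "((\<lambda>X. R *\<^sub>R X) has_derivative (\<lambda>h. R *\<^sub>R h)) (at X)"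
        by (auto intro!: derivative_eq_intros)
      from has_derivative_compose[OF this A.GDERIV_extension[OF X0(2), unfolded gderiv_def]]
      show ?thesis .
    qed
    then have "(extension s (phase ?E) has_derivative (\<lambda>h. (R *\<^sub>R h) \<bullet> A.ext_gradient (R *\<^sub>R X))) (at X)"
      by (rule has_derivative_transform_within_open[OF _ open_upper_half_space X])
         (simp add: extension_scale[OF s E R] upper_half_space_def)
    then have "GDERIV (extension s (phase ?E)) X :> R *\<^sub>R A.ext_gradient (R *\<^sub>R X)"
      by (simp add: gderiv_def)
    then show ?thesis using gradient_eq B.gradient_extension[OF X0(1)] by metis
  qed
  define k where "k Y = ennreal (snd Y powr (1 - s) * norm (A.ext_gradient Y) ^ 2) *
    indicator (upper_half_space \<inter> ball 0 (R * r)) Y" for Y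
  have [measurable]: "k \<in> borel_measurable borel" unfolding k_def[abs_def] by measurable
  have "dirichlet s E (R * r) = (\<integral>\<^sup>+Y. k Y \<partial>lborel)"
    unfolding dirichlet_def half_ball_eq[OF Rr] k_def
    by (intro nn_integral_cong) (auto simp: indicator_def upper_half_space_def A.gradient_extension)
  also have "\<dots> = ennreal (R ^ DIM('a \<times> real)) * (\<integral>\<^sup>+Y. k (R *\<^sub>R Y) \<partial>lborel)"
    by (rule nn_integral_lborel_scale[OF _ R]) measurable
  also have "(\<integral>\<^sup>+Y. k (R *\<^sub>R Y) \<partial>lborel) = (\<integral>\<^sup>+Y. ennreal (R powr (-1 - s)) *
     (ennreal (snd Y powr (1 - s) * norm (B.ext_gradient Y) ^ 2) * indicator (upper_half_space \<inter> ball 0 r) Y) \<partial>lborel)"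
  proof (rule nn_integral_cong)
    fix Y :: "'a \<times> real"
    show "k (R *\<^sub>R Y) = ennreal (R powr (-1 - s)) *
     (ennreal (snd Y powr (1 - s) * norm (B.ext_gradient Y) ^ 2) * indicator (upper_half_space \<inter> ball 0 r) Y)"
    proof (cases "Y \<in> upper_half_space")
      case True
      then have Y: "0 < snd Y" by (simp add: upper_half_space_def)
      have "(R * snd Y) powr (1 - s) * g\<^sup>2 = R powr (-1 - s) * (snd Y powr (1 - s) * (R * g)\<^sup>2)" for g
      proof -
        have "R powr (1 - s) = R powr (-1 - s) * R\<^sup>2"
          using R by (simp add: powr_realpow[symmetric] powr_add[symmetric] flip: powr_numeral)
        then show ?thesis using R Y by (simp add: powr_mult power_mult_distrib)
      qed
      then show ?thesis
        using True R by (simp add: k_def grad upper_half_space_def indicator_def ennreal_mult'[symmetric])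
    next
      case False
      then show ?thesis using R by (simp add: k_def upper_half_space_def zero_less_mult_iff indicator_def)
    qed
  qed
  also have "\<dots> = ennreal (R powr (-1 - s)) * (\<integral>\<^sup>+Y. ennreal (snd Y powr (1 - s) * norm (B.ext_gradient Y) ^ 2) *
      indicator (upper_half_space \<inter> ball 0 r) Y \<partial>lborel)"
    by (rule nn_integral_cmult) measurable
  also have "(\<integral>\<^sup>+Y. ennreal (snd Y powr (1 - s) * norm (B.ext_gradient Y) ^ 2) *
      indicator (upper_half_space \<inter> ball 0 r) Y \<partial>lborel) = dirichlet s ?E r"
    unfolding dirichlet_def half_ball_eq[OF r]
    by (intro nn_integral_cong) (auto simp: indicator_def upper_half_space_def B.gradient_extension)
  also have "ennreal (R ^ DIM('a \<times> real)) * (ennreal (R powr (-1 - s)) * dirichlet s ?E r) =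
      ennreal (R powr (real DIM('a) - s)) * dirichlet s ?E r"
  proof -
    have "R ^ DIM('a \<times> real) * R powr (-1 - s) = R powr (real DIM('a) - s)"
      using R by (simp add: powr_realpow[symmetric] powr_add[symmetric] del: power_Suc)
    then show ?thesis using R by (simp add: mult.assoc[symmetric] ennreal_mult'[symmetric])
  qed
  finally show ?thesis .
qed

section \<open>Reduction to the unit ball\<close>

theorem theorem1p9:
  fixes s \<Lambda> c :: real and E \<Omega> :: "'a::euclidean_space set"
  assumes "0 < s" and "s < 1" and "0 \<le> \<Lambda>"
    and "is_extension_const TYPE('a) s c"
    and "bounded_lipschitz_domain \<Omega>"
    and "Lambda_minimal s \<Lambda> E \<Omega>"
    and "0 \<in> measure_boundary E \<inter> \<Omega>"
  shows "\<exists>r\<^sub>0>0. \<forall>r\<^sub>1 r\<^sub>2. 0 < r\<^sub>1 \<and> r\<^sub>1 < r\<^sub>2 \<and> r\<^sub>2 < r\<^sub>0 \<longrightarrow>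
           Phi s (8 * c * \<Lambda>) E r\<^sub>1 \<le> Phi s (8 * c * \<Lambda>) E r\<^sub>2"
proof -
  have s: "0 < s" "s < 1" using assms by auto
  have \<Omega>: "open \<Omega>" "0 \<in> \<Omega>" using assms(5,7) by (auto simp: bounded_lipschitz_domain_def)
  \<comment> \<open>This ball is dilated to the unit ball, to which the extension constant refers;
    \<open>R\<close> is also the witness for the threshold radius.\<close>
  then obtain R where R: "0 < R" "ball 0 R \<subseteq> \<Omega>" by (meson open_contains_ball)
  have [measurable]: "\<Omega> \<in> sets borel" using \<Omega>(1) by simp
  have E: "E \<in> sets lebesgue" "frac_perimeter s E \<Omega> < \<infinity>"
    and minE: "\<And>F. F \<in> sets lebesgue \<Longrightarrow> sym_diff E F \<subseteq> \<Omega> \<Longrightarrow>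
      frac_perimeter s E \<Omega> \<le> frac_perimeter s F \<Omega> + ennreal \<Lambda> * emeasure lebesgue (sym_diff E F)"
    using assms(6) by (auto simp: Lambda_minimal_def)
  \<comment> \<open>A Borel set that differs from \<open>E\<close> by a null set only, so that
    perimeters and the extension are unchanged.\<close>
  obtain E1 N N' where E1: "E = E1 \<union> N" "N \<subseteq> N'" "N' \<in> null_sets lborel" "E1 \<in> sets lborel"
    by (rule sets_completionE[OF E(1)]) (rule that)
  have E1_borel [measurable]: "E1 \<in> sets borel" using E1(4) by simp
  have EE1: "AE x in lborel. x \<in> E \<longleftrightarrow> x \<in> E1"
    using AE_not_in[OF E1(3)] by eventually_elim (use E1 in auto)
  define E0 where "E0 = {x. R *\<^sub>R x \<in> E1}"
  have vimage_borel: "{x. q *\<^sub>R x \<in> A} \<in> sets borel" if "A \<in> sets borel" for A :: "'a set" and q :: real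
    using that by measurable
  have E0 [measurable]: "E0 \<in> sets borel" unfolding E0_def by (rule vimage_borel) simp
  let ?R = "R powr (real DIM('a) - s)"
  have vB: "{x. R *\<^sub>R x \<in> ball 0 R} = ball (0::'a) 1" using R(1) by auto
  have scale: "frac_perimeter s A (ball 0 R) = ennreal ?R * frac_perimeter s {x. R *\<^sub>R x \<in> A} (ball 0 1)"
    if "A \<in> sets borel" for A :: "'a set"
    using frac_perimeter_scale[OF that _ R(1), of "ball 0 R" s] vB by simp
  have perE1: "frac_perimeter s E \<Omega> = frac_perimeter s E1 \<Omega>"
    by (rule frac_perimeter_cong_AE[OF EE1])
  have fin: "frac_perimeter s E0 (ball 0 1) < \<infinity>"
  proof -
    obtain D where "frac_perimeter s E1 \<Omega> = frac_perimeter s E1 (ball 0 R) + D"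
      by (rule frac_perimeter_diff_window[of E1 E1 "ball 0 R" \<Omega>]) (use R(2) in auto)
    then have "frac_perimeter s E1 (ball 0 R) < \<infinity>"
      using E(2) unfolding perE1 by (auto simp: less_top)
    then show ?thesis
      unfolding scale[OF E1_borel] E0_def using R(1) by (auto simp: ennreal_mult_less_top)
  qed
  have J1: "J1 s (phase E0) < \<infinity>"
    using fin by (simp add: J1_phase ennreal_mult_less_top)
  \<comment> \<open>Perimeters scale by \<open>R powr (DIM('a) - s)\<close> and volumes by
    \<open>R ^ DIM('a)\<close>; the quotient \<open>R powr s\<close> goes into the minimality
    constant.\<close>
  have min: "J1 s (phase E0) \<le> J1 s (phase F) + ennreal (8 * (\<Lambda> * R powr s)) * emeasure lborel (sym_diff E0 F)"
    if F [measurable]: "F \<in> sets borel" and EF: "sym_diff E0 F \<subseteq> ball 0 1" for F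
  proof -
    define F1 where "F1 = {x. (1 / R) *\<^sub>R x \<in> F}"
    have F1 [measurable]: "F1 \<in> sets borel" unfolding F1_def by (rule vimage_borel) simp
    have F1F: "{x. R *\<^sub>R x \<in> F1} = F" using R(1) by (auto simp: F1_def)
    have E1F1: "sym_diff E1 F1 \<subseteq> ball 0 R"
    proof
      fix x assume x: "x \<in> sym_diff E1 F1"
      then have "(1 / R) *\<^sub>R x \<in> sym_diff E0 F" using R(1) by (auto simp: E0_def F1_def)
      with EF have "norm ((1 / R) *\<^sub>R x) < 1" by (auto simp: dist_norm)
      then show "x \<in> ball 0 R" using R(1) by (simp add: divide_less_eq)
    qed
    \<comment> \<open>\<open>F1\<close> agrees with \<open>E1\<close> outside the ball, but with
      \<open>E\<close> possibly only up to a null set. Taking \<open>E\<close> itself there gives a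
      competitor whose difference from \<open>E\<close> really lies in
      \<open>\<Omega>\<close>.\<close>
    define F' where "F' = (F1 \<inter> ball 0 R) \<union> (E - ball 0 R)"
    have F': "F' \<in> sets lebesgue"
      unfolding F'_def using E(1) by (intro sets.Un sets.Diff) auto
    have FF1: "AE x in lborel. x \<in> F' \<longleftrightarrow> x \<in> F1"
      using EE1 by eventually_elim (use E1F1 in \<open>auto simp: F'_def\<close>)
    have "sym_diff E F' \<subseteq> \<Omega>" using R(2) by (auto simp: F'_def)
    from minE[OF F' this]
    have "frac_perimeter s E \<Omega> \<le> frac_perimeter s F' \<Omega> + ennreal \<Lambda> * emeasure lebesgue (sym_diff E F')" .
    moreover have "emeasure lebesgue (sym_diff E F') = emeasure lborel (sym_diff E1 F1)"
    proof -
      have "emeasure lebesgue (sym_diff E F') = emeasure lebesgue (sym_diff E1 F1)"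
      proof (rule emeasure_eq_AE)
        have "AE x in lborel. x \<in> sym_diff E F' \<longleftrightarrow> x \<in> sym_diff E1 F1"
          using EE1 FF1 by eventually_elim auto
        then show "AE x in lebesgue. x \<in> sym_diff E F' \<longleftrightarrow> x \<in> sym_diff E1 F1"
          by (rule AE_completion)
      qed (use E(1) F' in auto)
      then show ?thesis by simp
    qed
    moreover have "frac_perimeter s F' \<Omega> = frac_perimeter s F1 \<Omega>"
      by (rule frac_perimeter_cong_AE[OF FF1])
    ultimately have le: "frac_perimeter s E1 \<Omega> \<le> frac_perimeter s F1 \<Omega> + ennreal \<Lambda> * emeasure lborel (sym_diff E1 F1)"
      unfolding perE1 by simp
    obtain D where D: "frac_perimeter s E1 \<Omega> = frac_perimeter s E1 (ball 0 R) + D"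
      "frac_perimeter s F1 \<Omega> = frac_perimeter s F1 (ball 0 R) + D"
      by (rule frac_perimeter_diff_window[OF E1_borel F1 _ _ R(2) E1F1]) auto
    \<comment> \<open>The common contribution of pairs outside the ball is finite, so it cancels in
      the extended reals.\<close>
    have "D \<noteq> top" using E(2) unfolding perE1 D(1) by auto
    moreover have "D + frac_perimeter s E1 (ball 0 R) \<le>
        D + (frac_perimeter s F1 (ball 0 R) + ennreal \<Lambda> * emeasure lborel (sym_diff E1 F1))"
      using le unfolding D by (simp add: ac_simps)
    ultimately have le2: "frac_perimeter s E1 (ball 0 R) \<le>
        frac_perimeter s F1 (ball 0 R) + ennreal \<Lambda> * emeasure lborel (sym_diff E1 F1)"
      by (simp add: ennreal_add_left_cancel_le)
    have em: "emeasure lborel (sym_diff E1 F1) = ennreal (R ^ DIM('a)) * emeasure lborel (sym_diff E0 F)"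
    proof -
      have "emeasure lborel (sym_diff E1 F1) = (\<integral>\<^sup>+x. indicator (sym_diff E1 F1) x \<partial>lborel)"
        by (intro nn_integral_indicator[symmetric]) auto
      also have "\<dots> = ennreal (R ^ DIM('a)) * (\<integral>\<^sup>+x. indicator (sym_diff E1 F1) (R *\<^sub>R x) \<partial>lborel)"
        by (intro nn_integral_lborel_scale R(1) borel_measurable_indicator) auto
      also have "(\<lambda>x. indicator (sym_diff E1 F1) (R *\<^sub>R x) :: ennreal) = indicator (sym_diff E0 F)"
        using R(1) by (auto simp: fun_eq_iff indicator_def E0_def F1_def)
      also have "(\<integral>\<^sup>+x. indicator (sym_diff E0 F) x \<partial>lborel) = emeasure lborel (sym_diff E0 F)"
        by (intro nn_integral_indicator) auto
      finally show ?thesis .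
    qed
    have "ennreal (8 * R powr (s - real DIM('a))) * (ennreal ?R * frac_perimeter s E0 (ball 0 1)) \<le>
        ennreal (8 * R powr (s - real DIM('a))) * (ennreal ?R * frac_perimeter s F (ball 0 1) +
          ennreal \<Lambda> * (ennreal (R ^ DIM('a)) * emeasure lborel (sym_diff E0 F)))"
      using le2 unfolding scale[OF E1_borel] scale[OF F1] em F1F E0_def[symmetric]
      by (rule mult_left_mono) simp
    moreover have "ennreal (8 * R powr (s - real DIM('a))) * (ennreal ?R * P) = 8 * P" for P
    proof -
      have "8 * R powr (s - real DIM('a)) * ?R = 8" using R(1) by (simp add: powr_add[symmetric])
      then have "ennreal (8 * R powr (s - real DIM('a))) * ennreal ?R = ennreal 8"
        by (simp only: ennreal_mult'[symmetric, OF mult_nonneg_nonneg[OF zero_le_numeral powr_ge_zero]])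
      then show ?thesis by (simp add: mult.assoc[symmetric])
    qed
    moreover have "ennreal (8 * R powr (s - real DIM('a))) * (ennreal \<Lambda> * (ennreal (R ^ DIM('a)) * P)) =
        ennreal (8 * (\<Lambda> * R powr s)) * P" for P
    proof -
      have "8 * R powr (s - real DIM('a)) * (\<Lambda> * R ^ DIM('a)) = 8 * (\<Lambda> * R powr s)"
        using R(1) by (simp add: powr_diff powr_realpow)
      moreover have "ennreal (8 * R powr (s - real DIM('a))) * (ennreal \<Lambda> * ennreal (R ^ DIM('a))) =
          ennreal (8 * R powr (s - real DIM('a)) * (\<Lambda> * R ^ DIM('a)))"
        using assms(3) R(1) by (subst ennreal_mult'[symmetric], simp, subst ennreal_mult'[symmetric], simp_all)
      ultimately have "ennreal (8 * R powr (s - real DIM('a))) * (ennreal \<Lambda> * ennreal (R ^ DIM('a))) * P =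
          ennreal (8 * (\<Lambda> * R powr s)) * P"
        by (simp only:)
      then show ?thesis by (simp only: mult.assoc)
    qed
    ultimately show ?thesis
      by (simp only: J1_phase[OF E0] J1_phase[OF F] distrib_left)
  qed
  \<comment> \<open>The monotone quantity is scale invariant: \<open>r powr (s - DIM('a))\<close>
    offsets the scaling of the energy, and \<open>\<Lambda> * R powr s * r powr s\<close> equals
    \<open>\<Lambda> * (R * r) powr s\<close>.\<close>
  have Phi: "Phi s (8 * c * \<Lambda>) E (R * r) = Phi s (8 * c * (\<Lambda> * R powr s)) E0 r" if r: "0 < r" for r
  proof -
    have "extension s (phase E) = extension s (phase E1)"
    proof (rule extension_cong_AE)
      show "phase E \<in> borel_measurable lebesgue"
        unfolding phase_def[abs_def] using E(1)
        by (intro borel_measurable_diff borel_measurable_indicator) (auto simp: Compl_in_sets_lebesgue)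
      show "phase E1 \<in> borel_measurable lebesgue" by (intro measurable_completion) simp
      have "AE x in lborel. phase E x = phase E1 x"
        using EE1 by eventually_elim (simp add: phase_def indicator_def)
      then show "AE x in lebesgue. phase E x = phase E1 x"
        by (rule AE_completion)
    qed
    then have "dirichlet s E (R * r) = ennreal ?R * dirichlet s E0 r"
      unfolding E0_def dirichlet_scale[OF s(1) E1_borel R(1) r, symmetric] by (simp add: dirichlet_def)
    moreover have "ennreal ((R * r) powr (s - real DIM('a))) * (ennreal ?R * P) = ennreal (r powr (s - real DIM('a))) * P" for P
    proof -
      have "(R * r) powr (s - real DIM('a)) * ?R = r powr (s - real DIM('a))"
        using R(1) r by (simp add: powr_mult mult.commute mult.left_commute powr_add[symmetric])
      then show ?thesis by (simp add: mult.assoc[symmetric] ennreal_mult'[symmetric])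
    qed
    ultimately show ?thesis
      using R(1) r by (simp add: Phi_eq_dirichlet powr_mult ac_simps)
  qed
  have "0 \<le> \<Lambda> * R powr s" using assms(3) by simp
  note mono = Phi_mono_unit_ball[OF s E0 J1 assms(4) min this]
  show ?thesis
  proof (intro exI[of _ R] conjI allI impI R(1))
    fix r1 r2 assume r: "0 < r1 \<and> r1 < r2 \<and> r2 < R"
    have "Phi s (8 * c * (\<Lambda> * R powr s)) E0 (r1 / R) \<le> Phi s (8 * c * (\<Lambda> * R powr s)) E0 (r2 / R)"
      using r R(1) by (intro mono divide_strict_right_mono) auto
    then have "Phi s (8 * c * \<Lambda>) E (R * (r1 / R)) \<le> Phi s (8 * c * \<Lambda>) E (R * (r2 / R))"
      using r R(1) Phi[of "r1 / R"] Phi[of "r2 / R"] by simp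
    then show "Phi s (8 * c * \<Lambda>) E r1 \<le> Phi s (8 * c * \<Lambda>) E r2"
      using R(1) by simp
  qed
qed

end
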